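(* Let $\mathfrak{A}$ be the operator in the Hilbert space $\mathfrak{H}$ with domain $\mathsf{D}(\mathfrak{A})=C_0^\infty(B_R;\mathbb{C}^3)$ defined by $\mathfrak{A}\boldsymbol{\xi}=\mathbf{L}\boldsymbol{\xi}$. Then $\mathfrak{A}$ admits a Friedrichs extension, and this Friedrichs extension is a self-adjoint operator in $\mathfrak{H}$ which is bounded from below.
   Context: Let $\mathsf{G}>0$ be a constant. (Pressure law.) $P$ is a given function of $\rho>0$ with $P>0$ and $dP/d\rho>0$ for $\rho>0$, and $P=\mathsf{A}\rho^{\gamma}(1+\Lambda(\rho^{\gamma-1}))$ for $\rho>0$, where $\Lambda$ is a smooth function on $\mathbb{R}$ with $\Lambda(0)=0$ and $\mathsf{A}>0$, $1<\gamma<2$ are constants. The enthalpy is $u=\int_0^\rho \frac{dP}{\rho}$, and $\mathsf{f}(u)$ denotes the corresponding $\rho$ if $u>0$ and $0$ if $u\le 0$. For $f$ supported in a bounded set, $\mathcal{K}f(\vec x)=\frac{1}{4\pi}\int_{\mathbb{R}^3}\frac{f(\vec x')}{\|\vec x-\vec x'\|}d\vec x'$. (Equilibrium.) There is a spherically symmetric stationary solution with zero velocity of the Euler–Poisson equations, i.e. $\nabla P(\bar\rho)+\bar\rho\nabla\bar\Phi=0$ with $\bar\Phi=-4\pi\mathsf{G}\mathcal{K}\bar\rho$, of the form $\bar\rho(\vec x)=\mathsf{f}(\bar u^{\mathsf r}(\|\vec x\|))$, where $\bar u^{\mathsf r}\in C^{2,\alpha}([0,\infty))\cap C^\infty([0,R))$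 for some $0<\alpha<1$ and some finite $R>0$, $\bar u^{\mathsf r}(r)>0\iff 0\le r<R$, and $d\bar u^{\mathsf r}/dr<0$ for all $r>0$. Fix it; $B_R=\{\|\vec x\|<R\}$, and $\rho,u,\frac{1}{\rho}\frac{dP}{d\rho}$ etc. denote these quantities evaluated at the equilibrium, as functions of $\vec x\in B_R$. For a vector field $\boldsymbol{\xi}$ on $B_R$ put $g=\mathrm{div}(\rho\boldsymbol{\xi})$ and $\mathbf{L}\boldsymbol{\xi}=\mathrm{grad}\big(-\frac{1}{\rho}\frac{dP}{d\rho}g+4\pi\mathsf{G}\mathcal{K}g\big)$ (with $g$ extended by zero outside $B_R$). $\mathfrak{H}$ is the Hilbert space of $\mathbb{C}^3$-valued functions on $B_R$ with inner product $(\mathbf{f}_1|\mathbf{f}_2)_{\mathfrak{H}}=\int_{B_R}(\mathbf{f}_1(\vec x)|\mathbf{f}_2(\vec x))\rho(\vec x)d\vec x$. *)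

theory Defs
  imports "HOL-Analysis.Analysis"
begin

definition smooth_on_real :: "real set \<Rightarrow> (real \<Rightarrow> real) \<Rightarrow> bool" where
  "smooth_on_real S f \<longleftrightarrow> (\<exists>D :: nat \<Rightarrow> real \<Rightarrow> real.
      (\<forall>x\<in>S. D 0 x = f x) \<and>
      (\<forall>k. \<forall>x\<in>S. (D k has_real_derivative D (Suc k) x) (at x within S)))"

fun dirderivs :: "(real^3 \<Rightarrow> 'b::real_normed_vector) \<Rightarrow> (real^3) list \<Rightarrow> real^3 \<Rightarrow> 'b" where
  "dirderivs f [] = f"
| "dirderivs f (v # vs) = (\<lambda>x. frechet_derivative (dirderivs f vs) (at x) v)"

definition smooth3 :: "(real^3 \<Rightarrow> 'b::real_normed_vector) \<Rightarrow> bool" where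
  "smooth3 f \<longleftrightarrow> (\<forall>vs x. dirderivs f vs differentiable (at x))"

definition Ccinf :: "real \<Rightarrow> (real^3 \<Rightarrow> complex^3) set" where
  "Ccinf R = {\<xi>. smooth3 \<xi> \<and> (\<exists>K. compact K \<and> K \<subseteq> ball 0 R \<and> (\<forall>x. x \<notin> K \<longrightarrow> \<xi> x = 0))}"

definition rgrad :: "(real^3 \<Rightarrow> real) \<Rightarrow> real^3 \<Rightarrow> real^3" where
  "rgrad f x = (\<chi> i. frechet_derivative f (at x) (axis i 1))"

definition cgrad :: "(real^3 \<Rightarrow> complex) \<Rightarrow> real^3 \<Rightarrow> complex^3" where
  "cgrad h x = (\<chi> i. frechet_derivative h (at x) (axis i 1))"

definition cdiv :: "(real^3 \<Rightarrow> complex^3) \<Rightarrow> real^3 \<Rightarrow> complex" where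
  "cdiv F x = (\<Sum>i\<in>UNIV. frechet_derivative (\<lambda>y. F y $ i) (at x) (axis i 1))"

definition Kop :: "(real^3 \<Rightarrow> 'b::{banach, second_countable_topology}) \<Rightarrow> real^3 \<Rightarrow> 'b" where
  "Kop f x = (1 / (4 * pi)) *\<^sub>R (LINT y|lborel. (1 / dist x y) *\<^sub>R f y)"

definition enthalpy :: "(real \<Rightarrow> real) \<Rightarrow> real \<Rightarrow> real" where
  "enthalpy P \<rho> = (LBINT s=0..\<rho>. deriv P s / s)"

definition ff :: "(real \<Rightarrow> real) \<Rightarrow> real \<Rightarrow> real" where
  "ff P u = (if u > 0 then (THE \<rho>. \<rho> > 0 \<and> enthalpy P \<rho> = u) else 0)"

definition Lop :: "real \<Rightarrow> (real \<Rightarrow> real) \<Rightarrow> (real^3 \<Rightarrow> real) \<Rightarrow> real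
     \<Rightarrow> (real^3 \<Rightarrow> complex^3) \<Rightarrow> real^3 \<Rightarrow> complex^3" where
  "Lop G P rho R \<xi> =
     (let g = (\<lambda>y. if y \<in> ball 0 R then cdiv (\<lambda>z. rho z *\<^sub>R \<xi> z) y else 0)
      in cgrad (\<lambda>y. - complex_of_real (deriv P (rho y) / rho y) * g y
                    + complex_of_real (4 * pi * G) * Kop g y))"

definition Hsp :: "(real^3 \<Rightarrow> real) \<Rightarrow> real \<Rightarrow> (real^3 \<Rightarrow> complex^3) set" where
  "Hsp rho R = {f. set_borel_measurable lebesgue (ball 0 R) f \<and>
       set_integrable lebesgue (ball 0 R) (\<lambda>x. rho x * (norm (f x))\<^sup>2)}"

definition cinner3 :: "complex^3 \<Rightarrow> complex^3 \<Rightarrow> complex" where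
  "cinner3 a b = (\<Sum>i\<in>UNIV. a $ i * cnj (b $ i))"

definition ipH :: "(real^3 \<Rightarrow> real) \<Rightarrow> real \<Rightarrow> (real^3 \<Rightarrow> complex^3) \<Rightarrow> (real^3 \<Rightarrow> complex^3) \<Rightarrow> complex" where
  "ipH rho R f g = (LINT x:ball 0 R|lebesgue. cinner3 (f x) (g x) * complex_of_real (rho x))"

definition normH :: "(real^3 \<Rightarrow> real) \<Rightarrow> real \<Rightarrow> (real^3 \<Rightarrow> complex^3) \<Rightarrow> real" where
  "normH rho R f = sqrt (Re (ipH rho R f f))"

definition eqH :: "real \<Rightarrow> (real^3 \<Rightarrow> complex^3) \<Rightarrow> (real^3 \<Rightarrow> complex^3) \<Rightarrow> bool" where
  "eqH R f g \<longleftrightarrow> (AE x in lebesgue. x \<in> ball 0 R \<longrightarrow> f x = g x)"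

type_synonym opgraph = "((real^3 \<Rightarrow> complex^3) \<times> (real^3 \<Rightarrow> complex^3)) set"

definition is_operator :: "(real^3 \<Rightarrow> real) \<Rightarrow> real \<Rightarrow> opgraph \<Rightarrow> bool" where
  "is_operator rho R T \<longleftrightarrow>
     T \<subseteq> Hsp rho R \<times> Hsp rho R \<and>
     (\<lambda>_. 0, \<lambda>_. 0) \<in> T \<and>
     (\<forall>x y x' y'. (x, y) \<in> T \<longrightarrow> (x', y') \<in> T \<longrightarrow> (\<lambda>t. x t + x' t, \<lambda>t. y t + y' t) \<in> T) \<and>
     (\<forall>x y (c::complex). (x, y) \<in> T \<longrightarrow> (\<lambda>t. c *s x t, \<lambda>t. c *s y t) \<in> T) \<and>
     (\<forall>x y x' y'. (x, y) \<in> T \<longrightarrow> x' \<in> Hsp rho R \<longrightarrow> y' \<in> Hsp rho R \<longrightarrow>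
                  eqH R x x' \<longrightarrow> eqH R y y' \<longrightarrow> (x', y') \<in> T) \<and>
     (\<forall>x y x' y'. (x, y) \<in> T \<longrightarrow> (x', y') \<in> T \<longrightarrow> eqH R x x' \<longrightarrow> eqH R y y')"

definition densely_defined :: "(real^3 \<Rightarrow> real) \<Rightarrow> real \<Rightarrow> opgraph \<Rightarrow> bool" where
  "densely_defined rho R T \<longleftrightarrow>
     (\<forall>u\<in>Hsp rho R. \<forall>\<epsilon>>0. \<exists>x\<in>fst ` T. normH rho R (\<lambda>t. x t - u t) < \<epsilon>)"

definition adjoint :: "(real^3 \<Rightarrow> real) \<Rightarrow> real \<Rightarrow> opgraph \<Rightarrow> opgraph" where
  "adjoint rho R T = {(v, w). v \<in> Hsp rho R \<and> w \<in> Hsp rho R \<and>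
       (\<forall>(x, y)\<in>T. ipH rho R y v = ipH rho R x w)}"

definition symmetric_op :: "(real^3 \<Rightarrow> real) \<Rightarrow> real \<Rightarrow> opgraph \<Rightarrow> bool" where
  "symmetric_op rho R T \<longleftrightarrow> (\<forall>(x, y)\<in>T. \<forall>(x', y')\<in>T. ipH rho R y x' = ipH rho R x y')"

definition lower_bound :: "(real^3 \<Rightarrow> real) \<Rightarrow> real \<Rightarrow> opgraph \<Rightarrow> real \<Rightarrow> bool" where
  "lower_bound rho R T m \<longleftrightarrow> (\<forall>(x, y)\<in>T. m * (normH rho R x)\<^sup>2 \<le> Re (ipH rho R y x))"

definition bounded_below :: "(real^3 \<Rightarrow> real) \<Rightarrow> real \<Rightarrow> opgraph \<Rightarrow> bool" where
  "bounded_below rho R T \<longleftrightarrow> (\<exists>m. lower_bound rho R T m)"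

definition self_adjoint :: "(real^3 \<Rightarrow> real) \<Rightarrow> real \<Rightarrow> opgraph \<Rightarrow> bool" where
  "self_adjoint rho R T \<longleftrightarrow> is_operator rho R T \<and> densely_defined rho R T \<and> T = adjoint rho R T"

definition admits_Friedrichs :: "(real^3 \<Rightarrow> real) \<Rightarrow> real \<Rightarrow> opgraph \<Rightarrow> bool" where
  "admits_Friedrichs rho R T \<longleftrightarrow> is_operator rho R T \<and> densely_defined rho R T \<and>
     symmetric_op rho R T \<and> bounded_below rho R T"

text \<open>Form domain: completion of D(T) w.r.t. the form norm, realised inside H.\<close>
definition form_domain :: "(real^3 \<Rightarrow> real) \<Rightarrow> real \<Rightarrow> opgraph \<Rightarrow> real \<Rightarrow> (real^3 \<Rightarrow> complex^3) set" where
  "form_domain rho R T m = {u \<in> Hsp rho R. \<exists>x y. (\<forall>n. (x n, y n) \<in> T) \<and>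
      (\<lambda>n. normH rho R (\<lambda>t. x n t - u t)) \<longlonglongrightarrow> 0 \<and>
      (\<forall>\<epsilon>>0. \<exists>N. \<forall>n\<ge>N. \<forall>k\<ge>N.
          Re (ipH rho R (\<lambda>t. y n t - y k t) (\<lambda>t. x n t - x k t))
            - m * (normH rho R (\<lambda>t. x n t - x k t))\<^sup>2 < \<epsilon>)}"

definition Friedrichs_ext :: "(real^3 \<Rightarrow> real) \<Rightarrow> real \<Rightarrow> opgraph \<Rightarrow> opgraph" where
  "Friedrichs_ext rho R T =
     (let m = (SOME m. lower_bound rho R T m)
      in {(v, w) \<in> adjoint rho R T. v \<in> form_domain rho R T m})"

definition Aop :: "real \<Rightarrow> (real \<Rightarrow> real) \<Rightarrow> (real^3 \<Rightarrow> real) \<Rightarrow> real \<Rightarrow> opgraph" where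
  "Aop G P rho R = {(a, b). \<exists>\<xi>\<in>Ccinf R. a \<in> Hsp rho R \<and> eqH R a \<xi> \<and> eqH R b (Lop G P rho R \<xi>)}"

end

theory Submission
  imports Defs "HOL-Library.Function_Algebras"
begin

text \<open>
  Put \<open>F = rho \<xi>\<close> and \<open>g = div F\<close>. Integration by parts gives
  \<open>\<langle>L \<xi>, \<xi>\<rangle> = \<integral> (P'/rho) |g|\<^sup>2 - 4 \<pi> G \<integral> K g cnj g\<close>. Since \<open>\<gamma> < 2\<close>, the stiffness \<open>P'/rho\<close> is bounded
  below by a positive constant on the ball. Moving the derivative in \<open>K g = K (div F)\<close> onto the Newtonian
  kernel yields the integrable kernel \<open>1 / |x - y|\<^sup>2\<close>, so the second integral is at most
  \<open>C (l \<parallel>F\<parallel>\<^sup>2 + \<parallel>g\<parallel>\<^sup>2 / l)\<close>; for large \<open>l\<close> the \<open>g\<close>-part is absorbed by the first integral and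
  \<open>\<parallel>F\<parallel>\<^sup>2\<close> is at most \<open>max rho\<close> times the squared norm of \<open>\<xi>\<close> in the weighted space. Hence \<open>L\<close> is
  symmetric and bounded below on test functions, and Friedrichs' theorem applies. At the centre of the
  star, regularity of the density uses that \<open>u1(0) = 0\<close>, which follows from differentiability of \<open>P \<circ> rho\<close>.
\<close>

subsection \<open>The Friedrichs extension in a semi-Hilbert space\<close>

text \<open>The space \<open>Hsp\<close> consists of functions, not of classes modulo null sets, so
  its norm is only a seminorm and operators are graphs saturated under \<open>eqH\<close>. The
  abstract part therefore lives in a semi-Hilbert space, where equality is replaced by distance zero
  and no quotient is formed. The form is put on the graph of the operator rather than on its domain:
  a pair \<open>(x, y)\<close> carries its own image, so no value has to be selected. At the sphere
  of radius \<open>R\<close> the density vanishes and the stiffness blows up. Test functions have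
  compact support in the open ball, so their products with these quantities extend by zero to C1 or
  C2 functions on all of space, and no boundary term ever arises. The gravitational potential is not
  compactly supported, but it enters the integrations by parts only against a factor that
  is.\<close>

lemma tendsto_null_bound:
  fixes f :: "nat \<Rightarrow> 'a::real_normed_vector"
  assumes "g \<longlonglongrightarrow> 0" "\<And>n. norm (f n) \<le> g n"
  shows "f \<longlonglongrightarrow> 0"
  using assms by (intro Lim_null_comparison[of f g]) auto

text \<open>The form is only semidefinite, since nonzero functions may have norm zero. Scaling is a
  parameter because the locale is used twice: for the inner product on \<open>H\<close>, and for the
  shifted form on the graph of an operator with componentwise scaling.\<close>

locale sesquilinear_form =
  fixes sc :: "complex \<Rightarrow> 'v::ab_group_add \<Rightarrow> 'v" and D :: "'v set" and h :: "'v \<Rightarrow> 'v \<Rightarrow> complex"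
  assumes sc_minus_one: "sc (-1) x = - x" and sc_diff: "sc c (x - y) = sc c x - sc c y"
    and zero_closed: "0 \<in> D"
    and add_closed: "x \<in> D \<Longrightarrow> y \<in> D \<Longrightarrow> x + y \<in> D"
    and sc_closed: "x \<in> D \<Longrightarrow> sc c x \<in> D"
    and add_left: "x \<in> D \<Longrightarrow> y \<in> D \<Longrightarrow> z \<in> D \<Longrightarrow> h (x + y) z = h x z + h y z"
    and sc_left: "x \<in> D \<Longrightarrow> z \<in> D \<Longrightarrow> h (sc c x) z = c * h x z"
    and hermitian: "x \<in> D \<Longrightarrow> y \<in> D \<Longrightarrow> h x y = cnj (h y x)"
    and nonneg: "x \<in> D \<Longrightarrow> 0 \<le> Re (h x x)"
begin

definition qf :: "'v \<Rightarrow> real" where "qf x = Re (h x x)"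
definition nrm :: "'v \<Rightarrow> real" where "nrm x = sqrt (qf x)"

lemma minus_closed: "x \<in> D \<Longrightarrow> - x \<in> D"
  using sc_closed[of x "-1"] by (simp add: sc_minus_one)

lemma diff_closed: "x \<in> D \<Longrightarrow> y \<in> D \<Longrightarrow> x - y \<in> D"
  using add_closed[of x "- y"] minus_closed by simp

lemma minus_left: "x \<in> D \<Longrightarrow> z \<in> D \<Longrightarrow> h (- x) z = - h x z"
  using sc_left[of x z "-1"] by (simp add: sc_minus_one)

lemma diff_left: "x \<in> D \<Longrightarrow> y \<in> D \<Longrightarrow> z \<in> D \<Longrightarrow> h (x - y) z = h x z - h y z"
  using add_left[of x "- y" z] by (simp add: minus_left minus_closed)

lemma add_right: "x \<in> D \<Longrightarrow> y \<in> D \<Longrightarrow> z \<in> D \<Longrightarrow> h z (x + y) = h z x + h z y"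
  using hermitian[of z "x + y"] hermitian[of z x] hermitian[of z y] by (simp add: add_left add_closed)

lemma sc_right: "x \<in> D \<Longrightarrow> z \<in> D \<Longrightarrow> h z (sc c x) = cnj c * h z x"
  using hermitian[of z "sc c x"] hermitian[of z x] by (simp add: sc_left sc_closed)

lemma diff_right: "x \<in> D \<Longrightarrow> y \<in> D \<Longrightarrow> z \<in> D \<Longrightarrow> h z (x - y) = h z x - h z y"
  using hermitian[of z "x - y"] hermitian[of z x] hermitian[of z y] by (simp add: diff_left diff_closed)

lemma zero_left: "z \<in> D \<Longrightarrow> h 0 z = 0"
  using diff_left[of 0 0 z] zero_closed by simp

lemma h_self: "x \<in> D \<Longrightarrow> h x x = complex_of_real (qf x)"
  using hermitian[of x x] by (auto simp: qf_def complex_eq_iff)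

lemma qf_nonneg: "x \<in> D \<Longrightarrow> 0 \<le> qf x"
  using nonneg by (simp add: qf_def)

lemma nrm_nonneg: "x \<in> D \<Longrightarrow> 0 \<le> nrm x"
  by (simp add: nrm_def qf_nonneg)

lemma nrm_sq: "x \<in> D \<Longrightarrow> (nrm x)\<^sup>2 = qf x"
  by (simp add: nrm_def qf_nonneg)

lemma qf_add: "x \<in> D \<Longrightarrow> y \<in> D \<Longrightarrow> qf (x + y) = qf x + qf y + 2 * Re (h x y)"
  using hermitian[of y x] by (simp add: qf_def add_left add_right add_closed)

lemma qf_diff: "x \<in> D \<Longrightarrow> y \<in> D \<Longrightarrow> qf (x - y) = qf x + qf y - 2 * Re (h x y)"
  using hermitian[of y x] by (simp add: qf_def diff_left diff_right diff_closed)

lemma qf_sc: "x \<in> D \<Longrightarrow> qf (sc c x) = (cmod c)\<^sup>2 * qf x"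
proof -
  assume x: "x \<in> D"
  have "h (sc c x) (sc c x) = (c * cnj c) * complex_of_real (qf x)"
    using x by (simp add: sc_left sc_right sc_closed flip: h_self)
  also have "\<dots> = complex_of_real ((cmod c)\<^sup>2 * qf x)"
    by (metis complex_norm_square of_real_mult)
  finally show ?thesis by (simp add: qf_def)
qed

lemma parallelogram: "x \<in> D \<Longrightarrow> y \<in> D \<Longrightarrow> qf (x + y) + qf (x - y) = 2 * qf x + 2 * qf y"
  by (simp add: qf_add qf_diff)

text \<open>Expand \<open>qf (x - t y) >= 0\<close>. Semidefiniteness forces a separate treatment of
  \<open>qf y = 0\<close>, where the expression is affine along \<open>t = s * h x y\<close> and
  would become negative for large \<open>s\<close>.\<close>

lemma Cauchy_Schwarz_sq:
  assumes x: "x \<in> D" and y: "y \<in> D"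
  shows "(cmod (h x y))\<^sup>2 \<le> qf x * qf y"
proof -
  have key: "0 \<le> qf x + (cmod t)\<^sup>2 * qf y - 2 * Re (cnj t * h x y)" for t
    using qf_nonneg[OF diff_closed[OF x sc_closed[OF y, of t]]] x y
    by (simp add: qf_diff sc_closed qf_sc sc_right)
  have R: "Re (cnj (h x y) * h x y) = (cmod (h x y))\<^sup>2"
    by (metis Re_complex_of_real complex_norm_square mult.commute)
  show ?thesis
  proof (cases "qf y = 0")
    case True
    have "(cmod (h x y))\<^sup>2 \<le> 0"
    proof (rule ccontr)
      assume "\<not> ?thesis"
      then have pos: "(cmod (h x y))\<^sup>2 > 0" by simp
      \<comment> \<open>Chosen so that \<open>s * |h x y|^2\<close> is \<open>qf x + 1\<close>,
        which exceeds what positivity permits.\<close>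
      define s where "s = (qf x + 1) / (cmod (h x y))\<^sup>2"
      have "Re (cnj (of_real s * h x y) * h x y) = s * Re (cnj (h x y) * h x y)"
        by (simp add: algebra_simps)
      then have "Re (cnj (of_real s * h x y) * h x y) = s * (cmod (h x y))\<^sup>2"
        using R by simp
      then have "2 * (s * (cmod (h x y))\<^sup>2) \<le> qf x"
        using key[of "of_real s * h x y"] True by simp
      moreover have "s * (cmod (h x y))\<^sup>2 = qf x + 1" using pos by (simp add: s_def)
      ultimately show False using qf_nonneg[OF x] by linarith
    qed
    then show ?thesis using True by simp
  next
    case False
    then have p: "qf y > 0" using qf_nonneg[OF y] by simp
    \<comment> \<open>The minimiser of the quadratic expression in \<open>t\<close>.\<close>
    define t where "t = h x y / of_real (qf y)"
    have "cnj t * h x y = of_real ((cmod (h x y))\<^sup>2 / qf y)"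
      unfolding t_def using complex_norm_square[of "h x y"] by (simp add: mult.commute)
    then have 1: "Re (cnj t * h x y) = (cmod (h x y))\<^sup>2 / qf y" by (metis Re_complex_of_real)
    have 2: "(cmod t)\<^sup>2 * qf y = (cmod (h x y))\<^sup>2 / qf y"
      using p by (simp add: t_def norm_divide power_divide power2_eq_square)
    from key[of t] have "(cmod (h x y))\<^sup>2 / qf y \<le> qf x" unfolding 1 2 by simp
    then show ?thesis using p by (simp add: divide_simps)
  qed
qed

lemma Cauchy_Schwarz: "x \<in> D \<Longrightarrow> y \<in> D \<Longrightarrow> cmod (h x y) \<le> nrm x * nrm y"
  using Cauchy_Schwarz_sq[of x y]
  by (metis nrm_def real_le_rsqrt real_sqrt_mult)

lemma nrm_triangle: "x \<in> D \<Longrightarrow> y \<in> D \<Longrightarrow> nrm (x + y) \<le> nrm x + nrm y"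
proof -
  assume xy: "x \<in> D" "y \<in> D"
  have "Re (h x y) \<le> nrm x * nrm y"
    using Cauchy_Schwarz[OF xy] complex_Re_le_cmod order_trans by blast
  then have "(nrm (x + y))\<^sup>2 \<le> (nrm x + nrm y)\<^sup>2"
    using xy by (simp add: nrm_sq add_closed qf_add power2_sum)
  then show ?thesis using xy by (meson nrm_nonneg add_nonneg_nonneg power2_le_imp_le)
qed

lemma nrm_minus_commute: "x \<in> D \<Longrightarrow> y \<in> D \<Longrightarrow> nrm (x - y) = nrm (y - x)"
  using hermitian[of y x] by (simp add: nrm_def qf_diff)

lemma nrm_diff_triangle: "x \<in> D \<Longrightarrow> y \<in> D \<Longrightarrow> z \<in> D \<Longrightarrow> nrm (x - z) \<le> nrm (x - y) + nrm (y - z)"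
  using nrm_triangle[of "x - y" "y - z"] by (simp add: diff_closed)

lemma nrm_zero: "nrm 0 = 0"
  by (simp add: nrm_def qf_def zero_left zero_closed)

lemma tendsto_right:
  assumes "\<And>n. x n \<in> D" "u \<in> D" "z \<in> D" "(\<lambda>n. nrm (x n - u)) \<longlonglongrightarrow> 0"
  shows "(\<lambda>n. h z (x n)) \<longlonglongrightarrow> h z u"
proof -
  have "(\<lambda>n. nrm z * nrm (x n - u)) \<longlonglongrightarrow> 0"
    using tendsto_mult_right_zero[OF assms(4)] .
  moreover have "norm (h z (x n) - h z u) \<le> nrm z * nrm (x n - u)" for n
    using Cauchy_Schwarz[of z "x n - u"] assms(1)[of n] assms(2,3) by (simp add: diff_right diff_closed)
  ultimately have "(\<lambda>n. h z (x n) - h z u) \<longlonglongrightarrow> 0"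
    by (rule tendsto_null_bound)
  then show ?thesis by (simp add: LIM_zero_iff)
qed

lemma tendsto_left:
  assumes "\<And>n. x n \<in> D" "u \<in> D" "z \<in> D" "(\<lambda>n. nrm (x n - u)) \<longlonglongrightarrow> 0"
  shows "(\<lambda>n. h (x n) z) \<longlonglongrightarrow> h u z"
proof -
  have "h (x n) z = cnj (h z (x n))" "h u z = cnj (h z u)" for n
    by (rule hermitian[OF assms(1) assms(3)], rule hermitian[OF assms(2,3)])
  then show ?thesis using tendsto_cnj[OF tendsto_right[OF assms]] by simp
qed

lemma tendsto_qf:
  assumes "\<And>n. x n \<in> D" "u \<in> D" "(\<lambda>n. nrm (x n - u)) \<longlonglongrightarrow> 0"
  shows "(\<lambda>n. qf (x n)) \<longlonglongrightarrow> qf u"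
proof -
  have "(\<lambda>n. (nrm (x n - u))\<^sup>2 + 2 * Re (h (x n) u) - qf u) \<longlonglongrightarrow> 0\<^sup>2 + 2 * Re (h u u) - qf u"
    using assms by (intro tendsto_intros tendsto_left)
  then show ?thesis using assms by (simp add: nrm_sq diff_closed qf_diff) (simp add: qf_def)
qed

text \<open>By Cauchy-Schwarz, elements at distance zero are interchangeable inside the form; this
  takes the place of passing to the quotient space.\<close>

lemma null_diff_left:
  "x \<in> D \<Longrightarrow> y \<in> D \<Longrightarrow> z \<in> D \<Longrightarrow> nrm (x - y) = 0 \<Longrightarrow> h x z = h y z"
  using Cauchy_Schwarz[of "x - y" z] by (simp add: diff_closed diff_left)

lemma null_diff_right:
  "x \<in> D \<Longrightarrow> y \<in> D \<Longrightarrow> z \<in> D \<Longrightarrow> nrm (x - y) = 0 \<Longrightarrow> h z x = h z y"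
  using Cauchy_Schwarz[of z "x - y"] by (simp add: diff_closed diff_right)

end

locale semi_hilbert = sesquilinear_form sc H ip
  for sc :: "complex \<Rightarrow> 'v::ab_group_add \<Rightarrow> 'v" and H and ip +
  assumes complete: "\<And>X. (\<And>n. X n \<in> H) \<Longrightarrow> (\<And>e. e > 0 \<Longrightarrow> \<exists>N. \<forall>m\<ge>N. \<forall>n\<ge>N. nrm (X m - X n) < e)
     \<Longrightarrow> \<exists>u\<in>H. (\<lambda>n. nrm (X n - u)) \<longlonglongrightarrow> 0"
begin

text \<open>The last two clauses encode an operator on classes: the graph is saturated under null
  modifications and single-valued up to them.\<close>

definition op :: "('v \<times> 'v) set \<Rightarrow> bool" where
  "op T \<longleftrightarrow> T \<subseteq> H \<times> H \<and> (0, 0) \<in> T \<and>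
     (\<forall>x y x' y'. (x, y) \<in> T \<longrightarrow> (x', y') \<in> T \<longrightarrow> (x + x', y + y') \<in> T) \<and>
     (\<forall>x y c. (x, y) \<in> T \<longrightarrow> (sc c x, sc c y) \<in> T) \<and>
     (\<forall>x y x' y'. (x, y) \<in> T \<longrightarrow> x' \<in> H \<longrightarrow> y' \<in> H \<longrightarrow>
                  nrm (x - x') = 0 \<longrightarrow> nrm (y - y') = 0 \<longrightarrow> (x', y') \<in> T) \<and>
     (\<forall>x y x' y'. (x, y) \<in> T \<longrightarrow> (x', y') \<in> T \<longrightarrow> nrm (x - x') = 0 \<longrightarrow> nrm (y - y') = 0)"

definition dense :: "('v \<times> 'v) set \<Rightarrow> bool" where
  "dense T \<longleftrightarrow> (\<forall>u\<in>H. \<forall>\<epsilon>>0. \<exists>x\<in>fst ` T. nrm (x - u) < \<epsilon>)"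

definition adj :: "('v \<times> 'v) set \<Rightarrow> ('v \<times> 'v) set" where
  "adj T = {(v, w). v \<in> H \<and> w \<in> H \<and> (\<forall>(x, y)\<in>T. ip y v = ip x w)}"

definition symm :: "('v \<times> 'v) set \<Rightarrow> bool" where
  "symm T \<longleftrightarrow> (\<forall>(x, y)\<in>T. \<forall>(x', y')\<in>T. ip y x' = ip x y')"

definition lower :: "('v \<times> 'v) set \<Rightarrow> real \<Rightarrow> bool" where
  "lower T m \<longleftrightarrow> (\<forall>(x, y)\<in>T. m * (nrm x)\<^sup>2 \<le> Re (ip y x))"

text \<open>The Cauchy clause contains only the form shifted by \<open>m\<close>; the remaining part
  of the form norm is controlled by convergence to \<open>u\<close> in the seminorm.\<close>

definition fdom :: "('v \<times> 'v) set \<Rightarrow> real \<Rightarrow> 'v set" where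
  "fdom T m = {u \<in> H. \<exists>x y. (\<forall>n. (x n, y n) \<in> T) \<and>
      (\<lambda>n. nrm (x n - u)) \<longlonglongrightarrow> 0 \<and>
      (\<forall>\<epsilon>>0. \<exists>N. \<forall>n\<ge>N. \<forall>k\<ge>N. Re (ip (y n - y k) (x n - x k)) - m * (nrm (x n - x k))\<^sup>2 < \<epsilon>)}"

definition friedrichs :: "('v \<times> 'v) set \<Rightarrow> real \<Rightarrow> ('v \<times> 'v) set" where
  "friedrichs T m = {(v, w) \<in> adj T. v \<in> fdom T m}"

end

locale semibounded = semi_hilbert +
  fixes T and m :: real
  assumes op: "op T" and dense: "dense T" and symm: "symm T" and lower: "lower T m"
begin

lemma T_add: "p \<in> T \<Longrightarrow> q \<in> T \<Longrightarrow> p + q \<in> T"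
  and T_sc: "p \<in> T \<Longrightarrow> (sc c (fst p), sc c (snd p)) \<in> T"
  using op unfolding op_def plus_prod_def by (metis prod.collapse)+

lemma T_in: "p \<in> T \<Longrightarrow> fst p \<in> H" "p \<in> T \<Longrightarrow> snd p \<in> H"
proof -
  have "T \<subseteq> H \<times> H" using op unfolding op_def by (rule conjunct1)
  then show "p \<in> T \<Longrightarrow> fst p \<in> H" "p \<in> T \<Longrightarrow> snd p \<in> H" by auto
qed

lemma T_lower: "p \<in> T \<Longrightarrow> m * qf (fst p) \<le> Re (ip (snd p) (fst p))"
  using lower nrm_sq[OF T_in(1)[of p]] unfolding lower_def by force

definition form :: "'a \<times> 'a \<Rightarrow> 'a \<times> 'a \<Rightarrow> complex" where
  "form p q = ip (snd p) (fst q) + complex_of_real (1 - m) * ip (fst p) (fst q)"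

sublocale F: sesquilinear_form "\<lambda>c p. (sc c (fst p), sc c (snd p))" T form
proof
  show "(sc (- 1) (fst p), sc (- 1) (snd p)) = - p" for p
    by (simp add: sc_minus_one prod_eq_iff)
  show "(sc c (fst (p - q)), sc c (snd (p - q))) = (sc c (fst p), sc c (snd p)) - (sc c (fst q), sc c (snd q))"
    for c p q by (simp add: sc_diff)
  show "(0::'a \<times> 'a) \<in> T" using op unfolding op_def zero_prod_def by blast
  show "x + y \<in> T" if "x \<in> T" "y \<in> T" for x y
    by (rule T_add[OF that])
  show "(sc c (fst p), sc c (snd p)) \<in> T" if "p \<in> T" for p c
    by (rule T_sc[OF that])
  show "form (x + y) z = form x z + form y z" if "x \<in> T" "y \<in> T" "z \<in> T" for x y z
    using that by (simp add: form_def add_left T_in algebra_simps)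
  show "form (sc c (fst x), sc c (snd x)) z = c * form x z" if "x \<in> T" "z \<in> T" for c x z
    using that by (simp add: form_def sc_left T_in algebra_simps)
  show "form x y = cnj (form y x)" if "x \<in> T" "y \<in> T" for x y
  proof -
    have "ip (snd x) (fst y) = ip (fst x) (snd y)"
      using symm that unfolding symm_def by (cases x; cases y) auto
    moreover have "ip (fst x) (snd y) = cnj (ip (snd y) (fst x))" "ip (fst x) (fst y) = cnj (ip (fst y) (fst x))"
      using hermitian[of "fst x" "snd y"] hermitian[of "fst x" "fst y"] that by (auto simp only: T_in)
    ultimately show ?thesis by (simp add: form_def)
  qed
  show "0 \<le> Re (form x x)" if "x \<in> T" for x
  proof -
    show ?thesis using T_lower[OF that] that qf_nonneg[OF T_in(1)[OF that]]
      by (simp add: form_def h_self T_in algebra_simps)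
  qed
qed

lemma qf_form: "p \<in> T \<Longrightarrow> F.qf p = Re (ip (snd p) (fst p)) + (1 - m) * qf (fst p)"
  by (simp add: F.qf_def form_def h_self T_in)

text \<open>This is the purpose of the shift \<open>1 - m\<close>: \<open>T - m + 1\<close> is at
  least 1, so sequences that are Cauchy for the form are Cauchy in \<open>H\<close>.\<close>

lemma qf_le_form: "p \<in> T \<Longrightarrow> qf (fst p) \<le> F.qf p"
  using T_lower[of p] by (simp add: qf_form algebra_simps)

definition approx :: "'a \<Rightarrow> (nat \<Rightarrow> 'a \<times> 'a) \<Rightarrow> bool" where
  "approx u p \<longleftrightarrow> u \<in> H \<and> (\<forall>n. p n \<in> T) \<and> (\<lambda>n. nrm (fst (p n) - u)) \<longlonglongrightarrow> 0 \<and>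
     (\<forall>e>0. \<exists>N. \<forall>n\<ge>N. \<forall>k\<ge>N. F.qf (p n - p k) < e)"

text \<open>The two Cauchy conditions use the shifts \<open>- m\<close> and \<open>1 - m\<close>.
  They differ by the squared seminorm of a difference, which is small because the first components
  converge.\<close>

lemma fdom_iff: "u \<in> fdom T m \<longleftrightarrow> (\<exists>p. approx u p)"
proof
  assume "u \<in> fdom T m"
  then obtain x y where u: "u \<in> H" and T: "\<And>n. (x n, y n) \<in> T" and l: "(\<lambda>n. nrm (x n - u)) \<longlonglongrightarrow> 0"
    and c: "\<And>e. e > 0 \<Longrightarrow> \<exists>N. \<forall>n\<ge>N. \<forall>k\<ge>N. Re (ip (y n - y k) (x n - x k)) - m * (nrm (x n - x k))\<^sup>2 < e"
    unfolding fdom_def by blast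
  have xH: "x n \<in> H" for n using T_in[OF T[of n]] by simp
  have "\<exists>N. \<forall>n\<ge>N. \<forall>k\<ge>N. F.qf ((x n, y n) - (x k, y k)) < e" if "e > 0" for e
  proof -
    obtain N1 where N1: "\<And>n k. n \<ge> N1 \<Longrightarrow> k \<ge> N1 \<Longrightarrow> Re (ip (y n - y k) (x n - x k)) - m * (nrm (x n - x k))\<^sup>2 < e/2"
      using c[of "e/2"] \<open>e > 0\<close> by auto
    \<comment> \<open>Two distances below \<open>d\<close> give a squared distance below
      \<open>e/2\<close>, since \<open>(2 * d)^2 = e/2\<close>; the other \<open>e/2\<close> is
      spent on the form.\<close>
    define d where "d = sqrt (e/2) / 2"
    have d: "d > 0" using that by (simp add: d_def)
    then obtain N2 where N2: "\<And>n. n \<ge> N2 \<Longrightarrow> nrm (x n - u) < d"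
      using order_tendstoD(2)[OF l, of d] unfolding eventually_sequentially by auto
    have "F.qf ((x n, y n) - (x k, y k)) < e" if "n \<ge> max N1 N2" "k \<ge> max N1 N2" for n k
    proof -
      have "nrm (x n - x k) \<le> nrm (x n - u) + nrm (x k - u)"
        using nrm_diff_triangle[of "x n" u "x k"] nrm_minus_commute[of u "x k"] xH u by simp
      also have "\<dots> < 2 * d" using N2[of n] N2[of k] that by simp
      finally have "(nrm (x n - x k))\<^sup>2 < (2*d)\<^sup>2"
        using nrm_nonneg[OF diff_closed[OF xH xH]] by (intro power_strict_mono) auto
      also have "(2*d)\<^sup>2 = e/2" using \<open>e > 0\<close> by (simp add: d_def)
      finally have "(nrm (x n - x k))\<^sup>2 < e/2" .
      then show ?thesis
        using N1[of n k] that F.diff_closed[OF T[of n] T[of k]] qf_form[of "(x n, y n) - (x k, y k)"]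
        by (simp add: nrm_sq diff_closed xH algebra_simps)
    qed
    then show ?thesis by blast
  qed
  then have "approx u (\<lambda>n. (x n, y n))" using u T l by (simp add: approx_def)
  then show "\<exists>p. approx u p" by blast
next
  assume "\<exists>p. approx u p"
  then obtain p where p: "u \<in> H" "\<And>n. p n \<in> T" "(\<lambda>n. nrm (fst (p n) - u)) \<longlonglongrightarrow> 0"
    "\<And>e. e > 0 \<Longrightarrow> \<exists>N. \<forall>n\<ge>N. \<forall>k\<ge>N. F.qf (p n - p k) < e" by (auto simp: approx_def)
  have "Re (ip (snd (p n) - snd (p k)) (fst (p n) - fst (p k))) - m * (nrm (fst (p n) - fst (p k)))\<^sup>2
      \<le> F.qf (p n - p k)" for n k
    using F.diff_closed[OF p(2)[of n] p(2)[of k]] qf_form[of "p n - p k"] p(2)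
      qf_nonneg[of "fst (p n) - fst (p k)"]
    by (simp add: nrm_sq diff_closed T_in algebra_simps)
  then have "\<forall>e>0. \<exists>N. \<forall>n\<ge>N. \<forall>k\<ge>N. Re (ip (snd (p n) - snd (p k)) (fst (p n) - fst (p k)))
      - m * (nrm (fst (p n) - fst (p k)))\<^sup>2 < e"
    using p(4) by (meson le_less_trans)
  then show "u \<in> fdom T m" unfolding fdom_def using p
    by (intro CollectI conjI exI[of _ "\<lambda>n. fst (p n)"] exI[of _ "\<lambda>n. snd (p n)"]) auto
qed

lemma approx_bounded:
  assumes "approx u p"
  obtains B where "\<And>n. F.nrm (p n) \<le> B" "B > 0"
proof -
  have pT: "\<And>n. p n \<in> T" and c: "\<And>e. e > 0 \<Longrightarrow> \<exists>N. \<forall>n\<ge>N. \<forall>k\<ge>N. F.qf (p n - p k) < e"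
    using assms by (auto simp: approx_def)
  obtain N where N: "\<And>n k. n \<ge> N \<Longrightarrow> k \<ge> N \<Longrightarrow> F.qf (p n - p k) < 1" using c[of 1] by auto
  define M where "M = Max ((\<lambda>n. F.nrm (p n)) ` {..N})"
  define B where "B = M + 2"
  have le: "F.nrm (p n) \<le> M" if "n \<le> N" for n
    using that unfolding M_def by (intro Max_ge) auto
  have "F.nrm (p n) \<le> B" for n
  proof (cases "n \<le> N")
    case True then show ?thesis using le[OF True] by (simp add: B_def)
  next
    case False
    have "F.nrm (p n) \<le> F.nrm (p n - p N) + F.nrm (p N)"
      using F.nrm_triangle[of "p n - p N" "p N"] pT by (simp add: F.diff_closed)
    moreover have "F.nrm (p n - p N) \<le> 1" using N[of n N] False by (simp add: F.nrm_def)
    ultimately show ?thesis using le[of N] by (simp add: B_def)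
  qed
  moreover have "B > 0" using le[of N] F.nrm_nonneg[OF pT[of N]] by (simp add: B_def)
  ultimately show thesis using that by blast
qed

text \<open>Both arguments move at once, and convergence in \<open>H\<close> says nothing about the
  second components. With \<open>n\<close> fixed, only \<open>fst (p k)\<close> matters and the
  adjoint relation identifies the limit in \<open>k\<close>. The error is uniform in
  \<open>n\<close>, because \<open>p\<close> is Cauchy for the form and \<open>p'\<close> is bounded
  for it.\<close>

lemma form_limit:
  assumes vw: "(v, w) \<in> adj T" and p: "approx v p" and p': "approx v' p'"
  shows "(\<lambda>n. form (p n) (p' n)) \<longlonglongrightarrow> ip w v' + complex_of_real (1 - m) * ip v v'"
proof -
  let ?c = "complex_of_real (1 - m)"
  have vH: "v \<in> H" "w \<in> H" and vwT: "\<And>q. q \<in> T \<Longrightarrow> ip (snd q) v = ip (fst q) w"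
    using vw by (auto simp: adj_def)
  have pT: "\<And>n. p n \<in> T" "\<And>n. p' n \<in> T" and v'H: "v' \<in> H"
    and lp: "(\<lambda>n. nrm (fst (p n) - v)) \<longlonglongrightarrow> 0" and lp': "(\<lambda>n. nrm (fst (p' n) - v')) \<longlonglongrightarrow> 0"
    and cp: "\<And>e. e > 0 \<Longrightarrow> \<exists>N. \<forall>n\<ge>N. \<forall>k\<ge>N. F.qf (p n - p k) < e"
    using p p' by (auto simp: approx_def)
  obtain B where B: "\<And>n. F.nrm (p' n) \<le> B" "B > 0" using approx_bounded[OF p'] by metis
  define L where "L n = ip w (fst (p' n)) + ?c * ip v (fst (p' n))" for n
  have L: "(\<lambda>k. form (p k) (p' n)) \<longlonglongrightarrow> L n" for n
  proof -
    have "(\<lambda>k. ip (snd (p' n)) (fst (p k)) + ?c * ip (fst (p' n)) (fst (p k)))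
         \<longlonglongrightarrow> ip (snd (p' n)) v + ?c * ip (fst (p' n)) v"
      using pT vH lp by (intro tendsto_intros tendsto_right) (auto simp: T_in)
    then have "(\<lambda>k. form (p' n) (p k)) \<longlonglongrightarrow> ip (fst (p' n)) w + ?c * ip (fst (p' n)) v"
      using vwT[OF pT(2)[of n]] by (simp add: form_def)
    from tendsto_cnj[OF this] have "(\<lambda>k. cnj (form (p' n) (p k))) \<longlonglongrightarrow> cnj (ip (fst (p' n)) w + ?c * ip (fst (p' n)) v)"
      .
    moreover have "cnj (form (p' n) (p k)) = form (p k) (p' n)" for k
      using F.hermitian[of "p k" "p' n"] pT by simp
    moreover have "cnj (ip (fst (p' n)) w + ?c * ip (fst (p' n)) v) = L n"
      using pT vH hermitian[of w "fst (p' n)"] hermitian[of v "fst (p' n)"]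
      by (simp add: L_def T_in)
    ultimately show ?thesis by simp
  qed
  have close: "\<exists>N. \<forall>n\<ge>N. cmod (form (p n) (p' n) - L n) < e" if "e > 0" for e
  proof -
    have "(e/2/B)\<^sup>2 > 0" using that B by simp
    from cp[OF this] obtain N where N: "\<And>n k. n \<ge> N \<Longrightarrow> k \<ge> N \<Longrightarrow> F.qf (p n - p k) < (e/2/B)\<^sup>2"
      by auto
    have "cmod (form (p n) (p' n) - L n) < e" if n: "n \<ge> N" for n
    proof -
      have "cmod (form (p n) (p' n) - form (p k) (p' n)) \<le> e/2" if "k \<ge> N" for k
      proof -
        have "F.nrm (p n - p k) \<le> e/2/B"
          unfolding F.nrm_def using N[OF n that] \<open>e > 0\<close> B real_le_lsqrt by (simp add: less_imp_le)
        then have "F.nrm (p n - p k) * F.nrm (p' n) \<le> e/2/B * B"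
          using B \<open>e > 0\<close> F.nrm_nonneg pT by (intro mult_mono) auto
        then show ?thesis
          using F.Cauchy_Schwarz[of "p n - p k" "p' n"] pT B by (simp add: F.diff_left F.diff_closed)
      qed
      moreover have "(\<lambda>k. cmod (form (p n) (p' n) - form (p k) (p' n))) \<longlonglongrightarrow> cmod (form (p n) (p' n) - L n)"
        by (intro tendsto_intros L)
      ultimately have "cmod (form (p n) (p' n) - L n) \<le> e/2"
        by (intro LIMSEQ_le_const2) auto
      then show ?thesis using \<open>e > 0\<close> by simp
    qed
    then show ?thesis by blast
  qed
  have "(\<lambda>n. form (p n) (p' n) - L n) \<longlonglongrightarrow> 0"
    using close by (intro LIMSEQ_I) auto
  moreover have "L \<longlonglongrightarrow> ip w v' + ?c * ip v v'"
    unfolding L_def using pT v'H vH lp' by (intro tendsto_intros tendsto_right) (auto simp: T_in)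
  ultimately show ?thesis using tendsto_add[of "\<lambda>n. form (p n) (p' n) - L n" 0 sequentially L] by simp
qed

text \<open>The same sequence of form values is computed with the roles of the two elements
  exchanged; hermitian symmetry and uniqueness of limits identify the results.\<close>

lemma friedrichs_symm:
  assumes "(v, w) \<in> friedrichs T m" "(v', w') \<in> friedrichs T m"
  shows "ip w v' = ip v w'"
proof -
  obtain p p' where p: "approx v p" "approx v' p'" and a: "(v, w) \<in> adj T" "(v', w') \<in> adj T"
    using assms by (auto simp: friedrichs_def fdom_iff)
  have H: "v \<in> H" "w \<in> H" "v' \<in> H" "w' \<in> H" using a by (auto simp: adj_def)
  have "form (p n) (p' n) = cnj (form (p' n) (p n))" for n
    using p F.hermitian[of "p n" "p' n"] by (auto simp: approx_def)
  then have "(\<lambda>n. form (p n) (p' n)) \<longlonglongrightarrow> cnj (ip w' v + complex_of_real (1 - m) * ip v' v)"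
    using tendsto_cnj[OF form_limit[OF a(2) p(2,1)]] by simp
  from LIMSEQ_unique[OF this form_limit[OF a(1) p]] show ?thesis
    using H hermitian[of v v'] hermitian[of v w'] by simp
qed

text \<open>The inequality \<open>qf_le_form\<close> passes to the limit along an approximating
  sequence; removing the shift returns the same bound \<open>m\<close>.\<close>

lemma friedrichs_lower: "lower (friedrichs T m) m"
  unfolding lower_def
proof clarify
  fix v w assume vw: "(v, w) \<in> friedrichs T m"
  then obtain p where p: "approx v p" and a: "(v, w) \<in> adj T"
    by (auto simp: friedrichs_def fdom_iff)
  have v: "v \<in> H" using a by (auto simp: adj_def)
  have "(\<lambda>n. F.qf (p n)) \<longlonglongrightarrow> Re (ip w v + complex_of_real (1 - m) * ip v v)"
    unfolding F.qf_def by (intro tendsto_intros form_limit a p)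
  moreover have "(\<lambda>n. qf (fst (p n))) \<longlonglongrightarrow> qf v"
    using p by (intro tendsto_qf) (auto simp: approx_def T_in)
  moreover have "qf (fst (p n)) \<le> F.qf (p n)" for n using p by (simp add: approx_def qf_le_form)
  ultimately have "qf v \<le> Re (ip w v + complex_of_real (1 - m) * ip v v)"
    by (meson LIMSEQ_le)
  then show "m * (nrm v)\<^sup>2 \<le> Re (ip w v)"
    using v by (simp add: nrm_sq h_self algebra_simps)
qed

text \<open>A minimising sequence of \<open>q(x) - 2 Re \<langle>x, f\<rangle>\<close>, where \<open>q\<close> is the shifted form, converges to the
  solution; this replaces completing the form domain and the Riesz representation theorem.\<close>

lemma friedrichs_surj:
  assumes f: "f \<in> H"
  obtains v where "(v, f - sc (complex_of_real (1 - m)) v) \<in> friedrichs T m"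
proof -
  let ?c = "complex_of_real (1 - m)"
  define J where "J p = F.qf p - 2 * Re (ip (fst p) f)" for p
  \<comment> \<open>Completing the square in \<open>H\<close>:
    \<open>qf x - 2 Re (ip x f) = qf (x - f) - qf f\<close>, and the form dominates
    \<open>qf\<close>.\<close>
  have Jlow: "- qf f \<le> J p" if "p \<in> T" for p
    using qf_nonneg[OF diff_closed[OF T_in(1)[OF that] f]] qf_diff[OF T_in(1)[OF that] f] qf_le_form[OF that]
    by (simp add: J_def)
  define I where "I = Inf (J ` T)"
  have bdd: "bdd_below (J ` T)" using Jlow by (auto intro!: bdd_belowI[of _ "- qf f"])
  have Ile: "I \<le> J p" if "p \<in> T" for p unfolding I_def using bdd that by (intro cInf_lower) auto
  have "\<exists>p\<in>T. J p < I + 1 / real (Suc n)" for n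
  proof -
    have "J ` T \<noteq> {}" using F.zero_closed by auto
    from cInf_lessD[OF this, of "I + 1 / real (Suc n)"] show ?thesis by (auto simp: I_def)
  qed
  then obtain p where pT: "\<And>n. p n \<in> T" and pJ': "\<And>n. J (p n) < I + 1 / real (Suc n)"
    by metis
  define \<delta> where "\<delta> n = 1 / real (Suc n)" for n
  have pJ: "J (p n) < I + \<delta> n" for n using pJ'[of n] by (simp add: \<delta>_def)
  have fstH: "fst (p n) \<in> H" for n using T_in pT by blast
  have step: "F.qf (p n - p k) \<le> 2 * \<delta> n + 2 * \<delta> k" for n k
  proof -
    \<comment> \<open>The midpoint of two nearly minimal elements cannot lie below the infimum, so
      the parallelogram law bounds the form of their difference.\<close>
    let ?a = "(sc (1/2) (fst (p n + p k)), sc (1/2) (snd (p n + p k)))"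
    have aT: "?a \<in> T" using F.sc_closed[OF F.add_closed[OF pT pT]] .
    have "F.qf ?a = F.qf (p n + p k) / 4"
      using F.qf_sc[OF F.add_closed[OF pT[of n] pT[of k]], of "1/2"] by (simp add: power2_eq_square)
    moreover have "2 * Re (ip (fst ?a) f) = Re (ip (fst (p n)) f) + Re (ip (fst (p k)) f)"
      using fstH f by (simp add: sc_left add_left add_closed)
    ultimately have "J ?a = F.qf (p n + p k) / 4 - Re (ip (fst (p n)) f) - Re (ip (fst (p k)) f)"
      unfolding J_def by linarith
    then have "I \<le> F.qf (p n + p k) / 4 - Re (ip (fst (p n)) f) - Re (ip (fst (p k)) f)"
      using Ile[OF aT] by simp
    moreover have "F.qf (p n + p k) + F.qf (p n - p k) = 2 * F.qf (p n) + 2 * F.qf (p k)"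
      using F.parallelogram pT by simp
    moreover have "F.qf (p n) - 2 * Re (ip (fst (p n)) f) < I + \<delta> n"
      "F.qf (p k) - 2 * Re (ip (fst (p k)) f) < I + \<delta> k"
      using pJ[of n] pJ[of k] by (auto simp: J_def)
    ultimately show ?thesis by linarith
  qed
  have cauchy: "\<exists>N. \<forall>n\<ge>N. \<forall>k\<ge>N. F.qf (p n - p k) < e" if "e > 0" for e
  proof -
    from that have "e/4 > 0" by simp
    then obtain N where N: "inverse (real (Suc N)) < e/4"
      using reals_Archimedean by blast
    have "F.qf (p n - p k) < e" if "n \<ge> N" "k \<ge> N" for n k
    proof -
      have "\<delta> n \<le> \<delta> N" "\<delta> k \<le> \<delta> N" "\<delta> N < e/4"
        using that N by (auto simp: \<delta>_def divide_simps)
      then show ?thesis using step[of n k] by linarith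
    qed
    then show ?thesis by blast
  qed
  have "\<exists>u\<in>H. (\<lambda>n. nrm (fst (p n) - u)) \<longlonglongrightarrow> 0"
  proof (rule complete)
    show "fst (p n) \<in> H" for n by (rule fstH)
    fix e :: real assume e: "e > 0"
    then obtain N where N: "\<And>n k. n \<ge> N \<Longrightarrow> k \<ge> N \<Longrightarrow> F.qf (p n - p k) < e\<^sup>2"
      using cauchy[of "e\<^sup>2"] by auto
    have "nrm (fst (p n) - fst (p k)) < e" if "n \<ge> N" "k \<ge> N" for n k
    proof -
      have "qf (fst (p n) - fst (p k)) < e\<^sup>2"
        using qf_le_form[OF F.diff_closed[OF pT[of n] pT[of k]]] N[OF that] by simp
      then show ?thesis using e by (simp add: nrm_def real_less_lsqrt)
    qed
    then show "\<exists>N. \<forall>n\<ge>N. \<forall>k\<ge>N. nrm (fst (p n) - fst (p k)) < e" by blast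
  qed
  then obtain v where v: "v \<in> H" and lv: "(\<lambda>n. nrm (fst (p n) - v)) \<longlonglongrightarrow> 0" by blast
  have vf: "v \<in> fdom T m" using v pT lv cauchy by (auto simp: fdom_iff approx_def)
  have "ip (snd q) v = ip (fst q) (f - sc ?c v)" if q: "q \<in> T" for q
  proof -
    define d where "d n = form q (p n) - ip (fst q) f" for n
    \<comment> \<open>First variation along \<open>q\<close> with step
      \<open>- s * cnj (d n)\<close>. Since \<open>s * F.qf q <= 1\<close>, the quadratic term costs
      at most half of the linear gain \<open>2 s |d n|^2\<close>; the 1 in the denominator covers
      \<open>F.qf q = 0\<close>.\<close>
    define s where "s = 1 / (1 + F.qf q)"
    have q0: "F.qf q \<ge> 0" by (rule F.qf_nonneg[OF q])
    have s: "s > 0" "s * F.qf q \<le> 1" using q0 by (auto simp: s_def)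
    have bound: "(cmod (d n))\<^sup>2 * s \<le> \<delta> n" for n
    proof -
      define t where "t = - (complex_of_real s * cnj (d n))"
      let ?tq = "(sc t (fst q), sc t (snd q))"
      have tT: "?tq \<in> T" using F.sc_closed[OF q] .
      have "F.qf (p n + ?tq) = F.qf (p n) + (cmod t)\<^sup>2 * F.qf q + 2 * Re (form (p n) ?tq)"
        using F.qf_add[OF pT tT] F.qf_sc[OF q] by simp
      also have "form (p n) ?tq = cnj (t * form q (p n))"
        using F.hermitian[OF pT tT] F.sc_left[OF q pT] by simp
      finally have "J (p n + ?tq) = J (p n) + (cmod t)\<^sup>2 * F.qf q + 2 * Re (t * d n)"
        using q f pT by (simp add: J_def d_def add_left sc_left sc_closed T_in algebra_simps)
      moreover have "t * d n = - complex_of_real (s * (cmod (d n))\<^sup>2)"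
      proof -
        have "cnj (d n) * d n = complex_of_real ((cmod (d n))\<^sup>2)"
          by (metis complex_norm_square mult.commute)
        then show ?thesis by (simp add: t_def mult.assoc)
      qed
      then have "Re (t * d n) = - (s * (cmod (d n))\<^sup>2)" by (metis Re_complex_of_real uminus_complex.sel(1))
      moreover have "(cmod t)\<^sup>2 * F.qf q \<le> s * (cmod (d n))\<^sup>2"
      proof -
        have "cmod t = s * cmod (d n)" using s by (simp add: t_def norm_mult)
        then have "(cmod t)\<^sup>2 * F.qf q = (s * (cmod (d n))\<^sup>2) * (s * F.qf q)" by (simp add: power2_eq_square)
        also have "\<dots> \<le> (s * (cmod (d n))\<^sup>2) * 1" using s by (intro mult_left_mono) auto
        finally show ?thesis by simp
      qed
      ultimately show ?thesis
        using Ile[OF F.add_closed[OF pT tT], of n] pJ[of n] by (simp add: mult.commute)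
    qed
    have "d \<longlonglongrightarrow> 0"
    proof -
      have "(\<lambda>n. 1 / s * \<delta> n) \<longlonglongrightarrow> 0"
        unfolding \<delta>_def by (intro tendsto_mult_right_zero LIMSEQ_Suc lim_1_over_n)
      moreover have "norm ((cmod (d n))\<^sup>2) \<le> 1 / s * \<delta> n" for n
        using bound[of n] s by (simp add: field_simps)
      ultimately have "(\<lambda>n. (cmod (d n))\<^sup>2) \<longlonglongrightarrow> 0"
        by (rule tendsto_null_bound)
      then have "(\<lambda>n. sqrt ((cmod (d n))\<^sup>2)) \<longlonglongrightarrow> sqrt 0" by (intro tendsto_intros)
      then show ?thesis by (simp add: tendsto_norm_zero_iff)
    qed
    moreover have "d \<longlonglongrightarrow> ip (snd q) v + ?c * ip (fst q) v - ip (fst q) f"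
      unfolding d_def form_def using fstH v q lv by (intro tendsto_intros tendsto_right) (auto simp: T_in)
    ultimately have "ip (snd q) v + ?c * ip (fst q) v - ip (fst q) f = 0"
      using LIMSEQ_unique by blast
    then show ?thesis using v f q by (simp add: diff_right sc_right sc_closed T_in algebra_simps)
  qed
  then have "(v, f - sc ?c v) \<in> adj T"
    using v f by (auto simp: adj_def diff_closed sc_closed)
  then show thesis using that vf by (auto simp: friedrichs_def)
qed

lemma T_subset_friedrichs: "T \<subseteq> friedrichs T m"
proof
  fix q assume q: "q \<in> T"
  have "approx (fst q) (\<lambda>_. q)"
    using q by (simp add: approx_def T_in nrm_zero F.qf_def F.zero_left F.zero_closed)
  moreover have "q \<in> adj T" using symm q T_in[OF q] unfolding adj_def symm_def by (cases q) auto
  ultimately show "q \<in> friedrichs T m" by (cases q) (auto simp: friedrichs_def fdom_iff)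
qed

lemma friedrichs_dense: "dense (friedrichs T m)"
  using dense T_subset_friedrichs unfolding dense_def by (meson image_mono subset_iff)

section \<open>Operator axioms and self-adjointness of the Friedrichs extension\<close>

lemma approx_add: "approx u p \<Longrightarrow> approx u' p' \<Longrightarrow> approx (u + u') (\<lambda>n. p n + p' n)"
proof -
  assume a: "approx u p" "approx u' p'"
  have T: "\<And>n. p n \<in> T" "\<And>n. p' n \<in> T" "u \<in> H" "u' \<in> H"
    and l: "(\<lambda>n. nrm (fst (p n) - u)) \<longlonglongrightarrow> 0" "(\<lambda>n. nrm (fst (p' n) - u')) \<longlonglongrightarrow> 0"
    using a by (auto simp: approx_def)
  have "(\<lambda>n. nrm (fst (p n + p' n) - (u + u'))) \<longlonglongrightarrow> 0"
  proof (rule Lim_null_comparison)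
    have "nrm (fst (p n + p' n) - (u + u')) \<le> nrm (fst (p n) - u) + nrm (fst (p' n) - u')" for n
      using nrm_triangle[of "fst (p n) - u" "fst (p' n) - u'"] T
      by (simp add: diff_closed T_in algebra_simps)
    moreover have "0 \<le> nrm (fst (p n + p' n) - (u + u'))" for n
      using T T_in by (simp add: nrm_nonneg diff_closed add_closed)
    ultimately show "\<forall>\<^sub>F n in sequentially. norm (nrm (fst (p n + p' n) - (u + u')))
        \<le> nrm (fst (p n) - u) + nrm (fst (p' n) - u')"
      by (intro always_eventually allI) simp
    show "(\<lambda>n. nrm (fst (p n) - u) + nrm (fst (p' n) - u')) \<longlonglongrightarrow> 0"
      using tendsto_add[OF l] by simp
  qed
  moreover have "\<exists>N. \<forall>n\<ge>N. \<forall>k\<ge>N. F.qf (p n + p' n - (p k + p' k)) < e" if "e > 0" for e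
  proof -
    have "e/4 > 0" using that by simp
    then have "\<exists>N. \<forall>n\<ge>N. \<forall>k\<ge>N. F.qf (p n - p k) < e/4"
      "\<exists>N. \<forall>n\<ge>N. \<forall>k\<ge>N. F.qf (p' n - p' k) < e/4"
      using a unfolding approx_def by blast+
    then obtain N N' where N: "\<And>n k. n \<ge> N \<Longrightarrow> k \<ge> N \<Longrightarrow> F.qf (p n - p k) < e/4"
      "\<And>n k. n \<ge> N' \<Longrightarrow> k \<ge> N' \<Longrightarrow> F.qf (p' n - p' k) < e/4"
      by blast
    have "F.qf (p n + p' n - (p k + p' k)) < e" if "n \<ge> max N N'" "k \<ge> max N N'" for n k
    proof -
      have "F.qf ((p n - p k) + (p' n - p' k)) \<le> 2 * F.qf (p n - p k) + 2 * F.qf (p' n - p' k)"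
        using F.parallelogram[of "p n - p k" "p' n - p' k"] F.qf_nonneg[of "(p n - p k) - (p' n - p' k)"] T
        by (simp add: F.diff_closed)
      then show ?thesis using N(1)[of n k] N(2)[of n k] that by (simp add: algebra_simps)
    qed
    then show ?thesis by blast
  qed
  ultimately show ?thesis using T by (simp add: approx_def add_closed F.add_closed)
qed

lemma approx_cong: "approx u p \<Longrightarrow> u' \<in> H \<Longrightarrow> nrm (u - u') = 0 \<Longrightarrow> approx u' p"
proof -
  assume a: "approx u p" "u' \<in> H" "nrm (u - u') = 0"
  have T: "\<And>n. p n \<in> T" "u \<in> H" using a by (auto simp: approx_def)
  have "nrm (fst (p n) - u') \<le> nrm (fst (p n) - u)" for n
    using nrm_diff_triangle[of "fst (p n)" u u'] a T by (simp add: T_in)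
  moreover have "0 \<le> nrm (fst (p n) - u')" for n
    using T T_in a by (intro nrm_nonneg diff_closed) auto
  ultimately have "norm (nrm (fst (p n) - u')) \<le> nrm (fst (p n) - u)" for n
    by simp
  moreover have "(\<lambda>n. nrm (fst (p n) - u)) \<longlonglongrightarrow> 0" using a by (simp add: approx_def)
  ultimately have "(\<lambda>n. nrm (fst (p n) - u')) \<longlonglongrightarrow> 0"
    by (rule tendsto_null_bound[rotated])
  then show ?thesis using a by (auto simp: approx_def)
qed

lemma approx_sc:
  assumes a: "approx u p"
  shows "approx (sc c u) (\<lambda>n. (sc c (fst (p n)), sc c (snd (p n))))"
proof -
  have T: "\<And>n. p n \<in> T" "u \<in> H" and l: "(\<lambda>n. nrm (fst (p n) - u)) \<longlonglongrightarrow> 0"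
    using a by (auto simp: approx_def)
  have nsc: "nrm (sc c x) = cmod c * nrm x" if "x \<in> H" for x
    using that by (simp add: nrm_def qf_sc real_sqrt_mult)
  have "(\<lambda>n. cmod c * nrm (fst (p n) - u)) \<longlonglongrightarrow> cmod c * 0" by (intro tendsto_intros l)
  then have "(\<lambda>n. nrm (sc c (fst (p n)) - sc c u)) \<longlonglongrightarrow> 0"
    using T by (simp add: sc_diff[symmetric] nsc T_in diff_closed)
  moreover have "\<exists>N. \<forall>n\<ge>N. \<forall>k\<ge>N. F.qf ((sc c (fst (p n)), sc c (snd (p n))) - (sc c (fst (p k)), sc c (snd (p k)))) < e"
    if e: "e > 0" for e
  proof -
    have "e / (1 + (cmod c)\<^sup>2) > 0" using e by (simp add: add_pos_nonneg)
    then obtain N where N: "\<And>n k. n \<ge> N \<Longrightarrow> k \<ge> N \<Longrightarrow> F.qf (p n - p k) < e / (1 + (cmod c)\<^sup>2)"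
      using a unfolding approx_def by blast
    have "F.qf ((sc c (fst (p n)), sc c (snd (p n))) - (sc c (fst (p k)), sc c (snd (p k)))) < e"
      if "n \<ge> N" "k \<ge> N" for n k
    proof -
      have "F.qf (sc c (fst (p n - p k)), sc c (snd (p n - p k))) = (cmod c)\<^sup>2 * F.qf (p n - p k)"
        using F.qf_sc[OF F.diff_closed[OF T(1)[of n] T(1)[of k]]] by simp
      also have "\<dots> \<le> (1 + (cmod c)\<^sup>2) * F.qf (p n - p k)"
        using F.qf_nonneg[OF F.diff_closed[OF T(1)[of n] T(1)[of k]]] by (intro mult_right_mono) auto
      also have "\<dots> < e" using N[OF that] by (simp add: field_simps add_pos_nonneg)
      finally show ?thesis by (simp add: sc_diff)
    qed
    then show ?thesis by blast
  qed
  ultimately show ?thesis using T F.sc_closed by (auto simp: approx_def sc_closed)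
qed

lemma friedrichsD:
  assumes "(v, w) \<in> friedrichs T m"
  shows "v \<in> H" "w \<in> H" "(s, t) \<in> T \<Longrightarrow> ip t v = ip s w"
  using assms by (auto simp: friedrichs_def adj_def)

lemma adjI: "v \<in> H \<Longrightarrow> w \<in> H \<Longrightarrow> (\<And>s t. (s, t) \<in> T \<Longrightarrow> ip t v = ip s w) \<Longrightarrow> (v, w) \<in> adj T"
  by (auto simp: adj_def)

lemma friedrichs_op:
  shows "op (friedrichs T m)"
  unfolding op_def
proof (intro conjI allI impI)
  show "friedrichs T m \<subseteq> H \<times> H" by (auto simp: friedrichs_def adj_def)
  show "(0, 0) \<in> friedrichs T m"
    using T_subset_friedrichs F.zero_closed by (auto simp: zero_prod_def)
next
  fix x y x' y' assume a: "(x, y) \<in> friedrichs T m" "(x', y') \<in> friedrichs T m"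
  then have "x + x' \<in> fdom T m" using approx_add unfolding friedrichs_def fdom_iff by blast
  moreover have "(x + x', y + y') \<in> adj T"
  proof (rule adjI)
    fix s t assume st: "(s, t) \<in> T"
    show "ip t (x + x') = ip s (y + y')"
      using friedrichsD[OF a(1)] friedrichsD[OF a(2)] T_in[OF st] st by (simp add: add_right)
  qed (use friedrichsD[OF a(1)] friedrichsD[OF a(2)] in \<open>auto intro: add_closed\<close>)
  ultimately show "(x + x', y + y') \<in> friedrichs T m" by (simp add: friedrichs_def)
next
  fix x y c assume a: "(x, y) \<in> friedrichs T m"
  then have "sc c x \<in> fdom T m" using approx_sc unfolding friedrichs_def fdom_iff by blast
  moreover have "(sc c x, sc c y) \<in> adj T"
  proof (rule adjI)
    fix s t assume st: "(s, t) \<in> T"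
    show "ip t (sc c x) = ip s (sc c y)"
      using friedrichsD[OF a] T_in[OF st] st by (simp add: sc_right)
  qed (use friedrichsD[OF a] in \<open>auto intro: sc_closed\<close>)
  ultimately show "(sc c x, sc c y) \<in> friedrichs T m" by (simp add: friedrichs_def)
next
  fix x y x' y' assume a: "(x, y) \<in> friedrichs T m" "x' \<in> H" "y' \<in> H" "nrm (x - x') = 0" "nrm (y - y') = 0"
  then have "x' \<in> fdom T m" using approx_cong unfolding friedrichs_def fdom_iff by blast
  moreover have "(x', y') \<in> adj T"
  proof (rule adjI)
    fix s t assume st: "(s, t) \<in> T"
    show "ip t x' = ip s y'"
      using friedrichsD[OF a(1)] null_diff_right[of x x' t] null_diff_right[of y y' s] T_in[OF st] st a(2-5)
      by simp
  qed (use a in auto)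
  ultimately show "(x', y') \<in> friedrichs T m" by (simp add: friedrichs_def)
next
  fix x y x' y' assume a: "(x, y) \<in> friedrichs T m" "(x', y') \<in> friedrichs T m" "nrm (x - x') = 0"
  have H: "x \<in> H" "x' \<in> H" "y \<in> H" "y' \<in> H" using a by (auto simp: friedrichs_def adj_def)
  \<comment> \<open>Both images define the same functional on the domain of \<open>T\<close>, so
    their difference is orthogonal to it. By Pythagoras no domain element is then closer to the
    difference than 0 is, which density forbids unless the difference is null.\<close>
  have orth: "ip z (y - y') = 0" if z: "z \<in> fst ` T" for z
  proof -
    obtain w where zw: "(z, w) \<in> T" using z by force
    have "ip w x = ip z y" "ip w x' = ip z y'" using a zw by (auto simp: friedrichs_def adj_def)
    moreover have "ip w x = ip w x'" using T_in[OF zw] H a by (intro null_diff_right) auto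
    ultimately show ?thesis using T_in[OF zw] H by (simp add: diff_right)
  qed
  show "nrm (y - y') = 0"
  proof (rule ccontr)
    let ?d = "y - y'"
    assume n: "nrm ?d \<noteq> 0"
    have dH: "?d \<in> H" using H by (simp add: diff_closed)
    then have pos: "nrm ?d > 0" using n nrm_nonneg[of ?d] by simp
    then obtain z where z: "z \<in> fst ` T" "nrm (z - ?d) < nrm ?d"
      using dense dH unfolding dense_def by blast
    have zH: "z \<in> H" using z T_in by auto
    have "qf (z - ?d) = qf z + qf ?d" using orth[OF z(1)] zH dH by (simp add: qf_diff)
    then have "qf ?d \<le> qf (z - ?d)" using qf_nonneg[OF zH] by simp
    then show False using z(2) by (simp add: nrm_def)
  qed
qed

text \<open>The shifted extension \<open>B + (1 - m)\<close> is symmetric and onto. For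
  \<open>(v, w)\<close> in the adjoint, solve for \<open>u\<close> in the domain with the same
  shifted image as \<open>v\<close>; then \<open>v - u\<close> is orthogonal to the range, hence
  null, and saturation of the graph puts \<open>(v, w)\<close> into \<open>B\<close>.\<close>

lemma friedrichs_self_adjoint:
  shows "friedrichs T m = adj (friedrichs T m)"
proof
  let ?B = "friedrichs T m" and ?c = "complex_of_real (1 - m)"
  show "?B \<subseteq> adj ?B"
  proof clarify
    fix v w assume vw: "(v, w) \<in> ?B"
    then have "v \<in> H" "w \<in> H" by (auto simp: friedrichs_def adj_def)
    then show "(v, w) \<in> adj ?B" using vw friedrichs_symm by (auto simp: adj_def)
  qed
  show "adj ?B \<subseteq> ?B"
  proof clarify
    fix v w assume vw: "(v, w) \<in> adj ?B"
    have H: "v \<in> H" "w \<in> H" and eq: "\<And>x y. (x, y) \<in> ?B \<Longrightarrow> ip y v = ip x w"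
      using vw by (auto simp: adj_def)
    have fH: "w + sc ?c v \<in> H" using H by (simp add: add_closed sc_closed)
    obtain u where u: "(u, w + sc ?c v - sc ?c u) \<in> ?B" using friedrichs_surj[OF fH] .
    have uH: "u \<in> H" using u by (auto simp: friedrichs_def adj_def)
    let ?y = "w + sc ?c v - sc ?c u"
    have yH: "?y \<in> H" using fH uH by (simp add: diff_closed sc_closed)
    have d: "v - u \<in> H" using H uH by (simp add: diff_closed)
    \<comment> \<open>Surjectivity a second time, to write \<open>v - u\<close> itself as a shifted
      image of \<open>z\<close>; its pairings with \<open>v\<close> and with \<open>u\<close> then
      agree.\<close>
    obtain z where z: "(z, v - u - sc ?c z) \<in> ?B" using friedrichs_surj[OF d] .
    have zH: "z \<in> H" using z by (auto simp: friedrichs_def adj_def)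
    let ?x = "v - u - sc ?c z"
    have xH: "?x \<in> H" using d zH by (simp add: diff_closed sc_closed)
    have "ip v v - ip u v - ?c * ip z v = ip ?x v" "ip v u - ip u u - ?c * ip z u = ip ?x u"
      using H uH zH by (simp_all add: diff_left sc_left sc_closed diff_closed del: of_real_diff)
    then have "ip v v - ip u v = ip z w + ?c * ip z v" "ip v u - ip u u = ip z ?y + ?c * ip z u"
      unfolding eq[OF z] friedrichs_symm[OF z u] by (metis diff_add_cancel)+
    moreover have "ip z ?y = ip z w + ?c * ip z v - ?c * ip z u"
      using H uH zH by (simp add: diff_right add_right sc_right sc_closed add_closed del: of_real_diff)
    ultimately have "(ip v v - ip u v) - (ip v u - ip u u) = 0" by simp
    then have "ip (v - u) (v - u) = 0"
      using H uH by (simp add: diff_left diff_right diff_closed)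
    then have n: "nrm (u - v) = 0"
      using H uH nrm_minus_commute[of u v] by (simp add: nrm_def qf_def)
    have "nrm (?y - w) = nrm (sc ?c (v - u))" by (simp add: sc_diff)
    also have "\<dots> = 0" using d n nrm_minus_commute[of u v] H uH
      by (simp add: nrm_def qf_sc)
    finally have "nrm (?y - w) = 0" .
    then show "(v, w) \<in> ?B" using friedrichs_op u H n unfolding op_def by blast
  qed
qed

theorem friedrichs_extension:
  "op (friedrichs T m) \<and> dense (friedrichs T m) \<and> friedrichs T m = adj (friedrichs T m)
    \<and> lower (friedrichs T m) m"
  using friedrichs_op friedrichs_dense friedrichs_self_adjoint friedrichs_lower by blast

end

subsection \<open>Continuously differentiable functions\<close>

abbreviation fd :: "('a::real_normed_vector \<Rightarrow> 'b::real_normed_vector) \<Rightarrow> 'a \<Rightarrow> 'a \<Rightarrow> 'b" where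
  "fd f x v \<equiv> frechet_derivative f (at x) v"

text \<open>Continuity is asked for each fixed direction, which on a finite-dimensional space
  amounts to continuity of the derivative. Differentiability refers to full neighbourhoods.\<close>

definition C1_on :: "'a::real_normed_vector set \<Rightarrow> ('a \<Rightarrow> 'b::real_normed_vector) \<Rightarrow> bool" where
  "C1_on S f \<longleftrightarrow> (\<forall>x\<in>S. f differentiable (at x)) \<and> (\<forall>v. continuous_on S (\<lambda>x. fd f x v))"

lemma fd_eq: "(f has_derivative f') (at x) \<Longrightarrow> fd f x v = f' v"
  using frechet_derivative_at by metis

lemma C1_onI:
  assumes "\<And>x. x \<in> S \<Longrightarrow> (f has_derivative f' x) (at x)" "\<And>v. continuous_on S (\<lambda>x. f' x v)"
  shows "C1_on S f"
  unfolding C1_on_def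
proof (intro conjI allI ballI)
  show "f differentiable (at x)" if "x \<in> S" for x
    using assms(1)[OF that] unfolding differentiable_def by blast
  show "continuous_on S (\<lambda>x. fd f x v)" for v
    using continuous_on_cong[of S S "\<lambda>x. fd f x v" "\<lambda>x. f' x v"] fd_eq[OF assms(1)] assms(2) by simp
qed

lemma C1_on_has_derivative: "C1_on S f \<Longrightarrow> x \<in> S \<Longrightarrow> (f has_derivative (\<lambda>v. fd f x v)) (at x)"
  by (simp add: C1_on_def frechet_derivative_works)

lemma C1_on_fd_continuous: "C1_on S f \<Longrightarrow> continuous_on S (\<lambda>x. fd f x v)"
  by (simp add: C1_on_def)

lemma C1_on_continuous: "C1_on S f \<Longrightarrow> continuous_on S f"
  by (meson C1_on_def differentiable_imp_continuous_within continuous_at_imp_continuous_on)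

lemma C1_on_subset: "C1_on T f \<Longrightarrow> S \<subseteq> T \<Longrightarrow> C1_on S f"
  unfolding C1_on_def by (meson continuous_on_subset subsetD)

lemma fd_transform:
  assumes "open S" "f differentiable (at x)" "x \<in> S" "\<And>y. y \<in> S \<Longrightarrow> f y = g y"
  shows "(g has_derivative (\<lambda>v. fd f x v)) (at x)" "fd g x v = fd f x v"
proof -
  have "(f has_derivative (\<lambda>v. fd f x v)) (at x)" using assms(2) by (simp add: frechet_derivative_works)
  from has_derivative_transform_within_open[OF this assms(1,3,4)]
  show "(g has_derivative (\<lambda>v. fd f x v)) (at x)" .
  then show "fd g x v = fd f x v" by (rule fd_eq)
qed

lemma C1_on_transform:
  assumes "open S" "C1_on S f" "\<And>y. y \<in> S \<Longrightarrow> f y = g y"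
  shows "C1_on S g"
  using assms fd_transform(1)[OF assms(1) _ _ assms(3)]
  by (intro C1_onI[where f'="\<lambda>x v. fd f x v"]) (auto simp: C1_on_def)

lemma C1_on_Un: "open S \<Longrightarrow> open T \<Longrightarrow> C1_on S f \<Longrightarrow> C1_on T f \<Longrightarrow> C1_on (S \<union> T) f"
  unfolding C1_on_def by (auto intro!: continuous_on_open_Un)

lemma C1_on_const: "C1_on S (\<lambda>_. c)"
  by (rule C1_onI[where f'="\<lambda>_ _. 0"]) auto

lemma fd_const: "fd (\<lambda>_. c) x v = 0"
  by (rule fd_eq) simp

lemma
  assumes "bounded_linear L" "C1_on S f"
  shows C1_on_linear: "C1_on S (\<lambda>x. L (f x))"
    and fd_linear: "x \<in> S \<Longrightarrow> fd (\<lambda>x. L (f x)) x v = L (fd f x v)"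
proof -
  have d: "((\<lambda>x. L (f x)) has_derivative (\<lambda>v. L (fd f x v))) (at x)" if "x \<in> S" for x
    using bounded_linear.has_derivative[OF assms(1) C1_on_has_derivative[OF assms(2) that]] .
  show "C1_on S (\<lambda>x. L (f x))"
    using bounded_linear.continuous_on[OF assms(1)] assms(2)
    by (intro C1_onI[OF d]) (auto simp: C1_on_def)
  show "x \<in> S \<Longrightarrow> fd (\<lambda>x. L (f x)) x v = L (fd f x v)" by (rule fd_eq[OF d])
qed

lemma
  assumes "C1_on S f" "C1_on S g"
  shows C1_on_add: "C1_on S (\<lambda>x. f x + g x)"
    and fd_add: "x \<in> S \<Longrightarrow> fd (\<lambda>x. f x + g x) x v = fd f x v + fd g x v"
proof -
  have d: "((\<lambda>x. f x + g x) has_derivative (\<lambda>v. fd f x v + fd g x v)) (at x)" if "x \<in> S" for x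
    using assms that by (intro has_derivative_add C1_on_has_derivative) auto
  show "C1_on S (\<lambda>x. f x + g x)"
    using assms by (intro C1_onI[OF d] continuous_intros) (auto simp: C1_on_def)
  show "x \<in> S \<Longrightarrow> fd (\<lambda>x. f x + g x) x v = fd f x v + fd g x v" by (rule fd_eq[OF d])
qed

lemma C1_on_sum:
  assumes "finite I" "\<And>i. i \<in> I \<Longrightarrow> C1_on S (f i)"
  shows "C1_on S (\<lambda>x. \<Sum>i\<in>I. f i x)"
  using assms by (induction I rule: finite_induct) (auto intro: C1_on_const C1_on_add)

lemma
  assumes B: "bounded_bilinear B" and f: "C1_on S f" and g: "C1_on S g"
  shows C1_on_bilinear: "C1_on S (\<lambda>x. B (f x) (g x))"
    and fd_bilinear: "x \<in> S \<Longrightarrow> fd (\<lambda>x. B (f x) (g x)) x v = B (f x) (fd g x v) + B (fd f x v) (g x)"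
proof -
  have d: "((\<lambda>x. B (f x) (g x)) has_derivative (\<lambda>v. B (f x) (fd g x v) + B (fd f x v) (g x))) (at x)"
    if "x \<in> S" for x
    using bounded_bilinear.FDERIV[OF B C1_on_has_derivative[OF f that] C1_on_has_derivative[OF g that]] .
  show "C1_on S (\<lambda>x. B (f x) (g x))"
    using f g by (intro C1_onI[OF d] continuous_intros bounded_bilinear.continuous_on[OF B])
      (auto simp: C1_on_def intro: C1_on_continuous)
  show "x \<in> S \<Longrightarrow> fd (\<lambda>x. B (f x) (g x)) x v = B (f x) (fd g x v) + B (fd f x v) (g x)"
    by (rule fd_eq[OF d])
qed

lemma
  fixes f :: "'a::real_normed_vector \<Rightarrow> real" and \<phi> :: "real \<Rightarrow> real"
  assumes f: "C1_on S f" and fT: "\<And>x. x \<in> S \<Longrightarrow> f x \<in> T"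
    and \<phi>: "\<And>t. t \<in> T \<Longrightarrow> (\<phi> has_real_derivative \<phi>' t) (at t)" and c: "continuous_on T \<phi>'"
  shows C1_on_compose_real: "C1_on S (\<lambda>x. \<phi> (f x))"
    and fd_compose_real: "x \<in> S \<Longrightarrow> fd (\<lambda>x. \<phi> (f x)) x v = \<phi>' (f x) * fd f x v"
proof -
  have d: "((\<lambda>x. \<phi> (f x)) has_derivative (\<lambda>v. \<phi>' (f x) * fd f x v)) (at x)" if "x \<in> S" for x
    using has_derivative_compose[OF C1_on_has_derivative[OF f that] has_field_derivative_imp_has_derivative[OF \<phi>[OF fT[OF that]]]]
    by simp
  show "C1_on S (\<lambda>x. \<phi> (f x))"
    using fT by (intro C1_onI[OF d] continuous_on_mult continuous_on_compose2[OF c]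
        C1_on_continuous[OF f] C1_on_fd_continuous[OF f]) auto
  show "x \<in> S \<Longrightarrow> fd (\<lambda>x. \<phi> (f x)) x v = \<phi>' (f x) * fd f x v" by (rule fd_eq[OF d])
qed

lemma fd_zero_outside:
  assumes "closed K" "\<And>x. x \<notin> K \<Longrightarrow> f x = 0" "x \<notin> K"
  shows "fd f x v = 0"
proof -
  have "(f has_derivative (\<lambda>v. 0)) (at x)"
    using has_derivative_transform_within_open[of "\<lambda>_. 0" "\<lambda>_. 0" x UNIV "- K" f] assms by auto
  then show ?thesis by (rule fd_eq)
qed

text \<open>\<open>S\<close> and the complement of \<open>K\<close> are open and cover the space.
  This is how test functions cut off quantities that are regular only inside the ball.\<close>

lemma C1_on_extend_zero:
  assumes "open S" "C1_on S f" "closed K" "K \<subseteq> S" "\<And>x. x \<notin> K \<Longrightarrow> f x = 0"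
  shows "C1_on UNIV f"
proof -
  have "C1_on (- K) f"
    using assms by (intro C1_on_transform[OF _ C1_on_const[of _ 0]]) auto
  from C1_on_Un[OF assms(1) _ assms(2) this] have "C1_on (S \<union> - K) f" using assms(3) by auto
  moreover have "S \<union> - K = UNIV" using assms(4) by auto
  ultimately show ?thesis by simp
qed

section \<open>Twice continuously differentiable functions\<close>

definition C2_on :: "'a::real_normed_vector set \<Rightarrow> ('a \<Rightarrow> 'b::real_normed_vector) \<Rightarrow> bool" where
  "C2_on S f \<longleftrightarrow> C1_on S f \<and> (\<forall>v. C1_on S (\<lambda>x. fd f x v))"

lemma C2_on_imp_C1_on: "C2_on S f \<Longrightarrow> C1_on S f"
  by (simp add: C2_on_def)

lemma C2_on_subset: "C2_on T f \<Longrightarrow> S \<subseteq> T \<Longrightarrow> C2_on S f"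
  unfolding C2_on_def by (meson C1_on_subset)

lemma C2_on_linear:
  assumes "open S" "bounded_linear L" "C2_on S f"
  shows "C2_on S (\<lambda>x. L (f x))"
  unfolding C2_on_def
proof (intro conjI allI)
  have f: "C1_on S f" "\<And>v. C1_on S (\<lambda>x. fd f x v)" using assms by (auto simp: C2_on_def)
  show "C1_on S (\<lambda>x. L (f x))" by (rule C1_on_linear[OF assms(2) f(1)])
  show "C1_on S (\<lambda>x. fd (\<lambda>x. L (f x)) x v)" for v
    by (rule C1_on_transform[OF \<open>open S\<close> C1_on_linear[OF assms(2) f(2)[of v]]])
      (simp add: fd_linear[OF assms(2) f(1)])
qed

lemma C2_on_bilinear:
  assumes "open S" "bounded_bilinear B" "C2_on S f" "C2_on S g"
  shows "C2_on S (\<lambda>x. B (f x) (g x))"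
  unfolding C2_on_def
proof (intro conjI allI)
  have f: "C1_on S f" "\<And>v. C1_on S (\<lambda>x. fd f x v)" and g: "C1_on S g" "\<And>v. C1_on S (\<lambda>x. fd g x v)"
    using assms by (auto simp: C2_on_def)
  show "C1_on S (\<lambda>x. B (f x) (g x))" using f g by (intro C1_on_bilinear[OF assms(2)])
  fix v
  have "C1_on S (\<lambda>x. B (f x) (fd g x v) + B (fd f x v) (g x))"
    using f g by (intro C1_on_add C1_on_bilinear[OF assms(2)])
  then show "C1_on S (\<lambda>x. fd (\<lambda>x. B (f x) (g x)) x v)"
    by (rule C1_on_transform[OF \<open>open S\<close>]) (simp add: fd_bilinear[OF assms(2) f(1) g(1)])
qed

lemma C2_on_compose_real:
  fixes f :: "'a::real_normed_vector \<Rightarrow> real" and \<phi> :: "real \<Rightarrow> real"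
  assumes "open S" and f: "C2_on S f" and fT: "\<And>x. x \<in> S \<Longrightarrow> f x \<in> T"
    and \<phi>: "\<And>t. t \<in> T \<Longrightarrow> (\<phi> has_real_derivative \<phi>' t) (at t)"
    and \<phi>': "\<And>t. t \<in> T \<Longrightarrow> (\<phi>' has_real_derivative \<phi>'' t) (at t)" and c: "continuous_on T \<phi>''"
  shows "C2_on S (\<lambda>x. \<phi> (f x))"
  unfolding C2_on_def
proof (intro conjI allI)
  have f1: "C1_on S f" and f2: "\<And>v. C1_on S (\<lambda>x. fd f x v)" using f by (auto simp: C2_on_def)
  have c': "continuous_on T \<phi>'"
    using \<phi>' by (meson DERIV_isCont continuous_at_imp_continuous_on)
  show "C1_on S (\<lambda>x. \<phi> (f x))" by (rule C1_on_compose_real[OF f1 fT \<phi> c'])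
  fix v
  have "C1_on S (\<lambda>x. \<phi>' (f x) * fd f x v)"
    by (intro C1_on_bilinear[OF bounded_bilinear_mult] f2 C1_on_compose_real[OF f1 fT \<phi>' c])
  then show "C1_on S (\<lambda>x. fd (\<lambda>x. \<phi> (f x)) x v)"
    by (rule C1_on_transform[OF \<open>open S\<close>]) (simp add: fd_compose_real[OF f1 fT \<phi> c'])
qed

lemma C2_on_extend_zero:
  assumes S: "open S" and f: "C2_on S f" and K: "closed K" "K \<subseteq> S" and 0: "\<And>x. x \<notin> K \<Longrightarrow> f x = 0"
  shows "C2_on UNIV f"
  unfolding C2_on_def
proof (intro conjI allI)
  show "C1_on UNIV f" using C1_on_extend_zero[OF S _ K 0] f by (simp add: C2_on_def)
  show "C1_on UNIV (\<lambda>x. fd f x v)" for v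
    using f fd_zero_outside[OF K(1) 0] by (intro C1_on_extend_zero[OF S _ K]) (auto simp: C2_on_def)
qed

lemma smooth3_C2_on: "smooth3 f \<Longrightarrow> C2_on UNIV f"
proof -
  assume s: "smooth3 f"
  have d: "dirderivs f vs differentiable (at x)" for vs x using s by (simp add: smooth3_def)
  have c: "continuous_on UNIV (dirderivs f vs)" for vs
    using d by (meson continuous_at_imp_continuous_on differentiable_imp_continuous_within)
  have "C1_on UNIV (dirderivs f vs)" for vs
    unfolding C1_on_def using d c[of "_ # vs"] by simp
  from this[of "[]"] this[of "[_]"] show ?thesis by (simp add: C2_on_def)
qed

subsection \<open>Integration by parts for compactly supported functions\<close>

lemma integrable_continuous_compact_support:
  fixes f :: "'a::euclidean_space \<Rightarrow> 'b::{banach, second_countable_topology}"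
  assumes "continuous_on UNIV f" "compact K" "\<And>x. x \<notin> K \<Longrightarrow> f x = 0"
  shows "integrable lborel f"
proof -
  have "integrable lborel (\<lambda>x. indicator K x *\<^sub>R f x)"
    using assms by (intro borel_integrable_compact continuous_on_subset[OF assms(1)]) auto
  moreover have "(\<lambda>x. indicator K x *\<^sub>R f x) = f" using assms(3) by (auto simp: indicator_def)
  ultimately show ?thesis by simp
qed

lemma continuous_compact_support_bounded:
  fixes f :: "'a::topological_space \<Rightarrow> 'b::real_normed_vector"
  assumes "continuous_on UNIV f" "compact K" "\<And>x. x \<notin> K \<Longrightarrow> f x = 0"
  shows "\<exists>B\<ge>0. \<forall>x. norm (f x) \<le> B"
proof -
  have "bounded (f ` K)"
    using assms by (intro compact_imp_bounded compact_continuous_image continuous_on_subset[OF assms(1)]) auto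
  then obtain B where B: "B > 0" "\<And>x. x \<in> K \<Longrightarrow> norm (f x) \<le> B"
    unfolding bounded_pos by auto
  then have "norm (f x) \<le> B" for x using assms(3)[of x] by (cases "x \<in> K") auto
  then show ?thesis using B(1) by (intro exI[of _ B]) auto
qed

text \<open>The common bound for derivative and Lipschitz constant supplies the majorants when
  difference quotients are integrated.\<close>

lemma C1_compact_support_fd_bound:
  fixes f :: "'a::euclidean_space \<Rightarrow> 'b::real_normed_vector"
  assumes f: "C1_on UNIV f" and K: "compact K" "\<And>x. x \<notin> K \<Longrightarrow> f x = 0"
  shows "\<exists>B\<ge>0. (\<forall>x v. norm (fd f x v) \<le> B * norm v) \<and> (\<forall>x y. norm (f y - f x) \<le> B * norm (y - x))"
proof -
  have "\<exists>B\<ge>0. \<forall>x. norm (fd f x b) \<le> B" for b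
    by (rule continuous_compact_support_bounded[OF C1_on_fd_continuous[OF f] K(1)
          fd_zero_outside[OF compact_imp_closed[OF K(1)] K(2)]])
  then have "\<forall>b. \<exists>B. B \<ge> 0 \<and> (\<forall>x. norm (fd f x b) \<le> B)" by auto
  from choice[OF this] obtain C where C: "\<And>b. C b \<ge> 0" "\<And>b x. norm (fd f x b) \<le> C b"
    by auto
  define B where "B = (\<Sum>b\<in>Basis. C b)"
  have lin: "linear (\<lambda>v. fd f x v)" for x
    by (rule has_derivative_linear[OF C1_on_has_derivative[OF f UNIV_I]])
  have b: "norm (fd f x v) \<le> B * norm v" for x v
  proof -
    have "fd f x v = fd f x (\<Sum>b\<in>Basis. (v \<bullet> b) *\<^sub>R b)" by (simp add: euclidean_representation)
    also have "\<dots> = (\<Sum>b\<in>Basis. (v \<bullet> b) *\<^sub>R fd f x b)"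
      using lin[of x] by (simp add: linear_sum linear_scale)
    also have "norm \<dots> \<le> (\<Sum>b\<in>Basis. norm v * C b)"
      using C by (intro sum_norm_le) (auto intro!: mult_mono Basis_le_norm)
    finally show ?thesis by (simp add: B_def sum_distrib_left mult.commute)
  qed
  have B0: "B \<ge> 0" unfolding B_def using C by (intro sum_nonneg) auto
  have "norm (f y - f x) \<le> B * norm (y - x)" for x y
  proof (rule differentiable_bound[where S=UNIV and f'="\<lambda>x v. fd f x v"])
    show "(f has_derivative (\<lambda>v. fd f x v)) (at x)" for x using C1_on_has_derivative[OF f] by simp
    show "onorm (\<lambda>v. fd f x v) \<le> B" for x using b B0 by (intro onorm_bound) auto
  qed auto
  then show ?thesis using B0 b by blast
qed

lemma lborel_integral_shift:
  fixes f :: "'a::euclidean_space \<Rightarrow> 'b::{banach, second_countable_topology}"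
  shows "(\<integral>x. f (c + x) \<partial>lborel) = (\<integral>x. f x \<partial>lborel)"
    and "integrable lborel (\<lambda>x. f (c + x)) \<longleftrightarrow> integrable lborel f"
proof -
  have m: "(\<lambda>x. c + x) \<in> borel_measurable borel" "(\<lambda>x. - c + x) \<in> borel_measurable borel" by auto
  have i: "integrable lborel (\<lambda>x. f (c + x))" if "integrable lborel f" for f :: "'a \<Rightarrow> 'b" and c
    using that integrable_distr[of "(+) c" lborel borel f] by (simp add: lborel_distr_plus)
  show e: "integrable lborel (\<lambda>x. f (c + x)) \<longleftrightarrow> integrable lborel f"
    using i[of f c] i[of "\<lambda>x. f (c + x)" "- c"] by (auto simp: add.assoc[symmetric])
  show "(\<integral>x. f (c + x) \<partial>lborel) = (\<integral>x. f x \<partial>lborel)"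
  proof (cases "integrable lborel f")
    case True
    then have "f \<in> borel_measurable borel" by auto
    then show ?thesis
      using integral_distr[of "(+) c" lborel borel f] by (simp add: lborel_distr_plus)
  next
    case False
    \<comment> \<open>Neither side is integrable, so both integrals take the default value
      0.\<close>
    then show ?thesis using e by (simp add: not_integrable_integral_eq)
  qed
qed

lemma directional_difference_quotient:
  assumes f: "(f has_derivative f') (at x)" and t: "\<And>n. 0 < t n" "t \<longlonglongrightarrow> 0"
  shows "(\<lambda>n. (1 / t n) *\<^sub>R (f (x + t n *\<^sub>R v) - f x)) \<longlonglongrightarrow> f' v"
proof -
  have "((\<lambda>s. f (x + s *\<^sub>R v)) has_derivative (\<lambda>s. f' (s *\<^sub>R v))) (at 0)"
    by (rule has_derivative_compose[where g=f and f="\<lambda>s. x + s *\<^sub>R v", simplified])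
      (auto intro!: derivative_eq_intros simp: f)
  then have l: "((\<lambda>h. norm (f (x + h *\<^sub>R v) - f x - h *\<^sub>R f' v) / norm h) \<longlongrightarrow> 0) (at 0)"
    using has_derivative_linear[OF f] by (simp add: has_derivative_at linear_scale)
  have "filterlim t (at 0) sequentially"
    unfolding filterlim_at using t by (auto simp: less_imp_neq[symmetric])
  from filterlim_compose[OF l this]
  have "(\<lambda>n. norm (f (x + t n *\<^sub>R v) - f x - t n *\<^sub>R f' v) / norm (t n)) \<longlonglongrightarrow> 0" .
  moreover have "norm (f (x + t n *\<^sub>R v) - f x - t n *\<^sub>R f' v) / norm (t n)
      = norm ((1 / t n) *\<^sub>R (f (x + t n *\<^sub>R v) - f x) - f' v)" for n
  proof -
    have "(1 / t n) *\<^sub>R (f (x + t n *\<^sub>R v) - f x) - f' v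
        = (1 / t n) *\<^sub>R (f (x + t n *\<^sub>R v) - f x - t n *\<^sub>R f' v)"
      using t(1)[of n] by (simp add: scaleR_diff_right)
    then show ?thesis using t(1)[of n] by simp
  qed
  ultimately show ?thesis by (simp add: tendsto_norm_zero_iff LIM_zero_iff)
qed

text \<open>Translation invariance makes the integral of every difference quotient vanish, and
  dominated convergence passes this to the derivative; no iterated integration in coordinates is
  involved.\<close>

lemma integral_fd_eq_0:
  fixes f :: "'a::euclidean_space \<Rightarrow> 'b::{banach, second_countable_topology}"
  assumes f: "C1_on UNIV f" and K: "compact K" "\<And>x. x \<notin> K \<Longrightarrow> f x = 0"
  shows "(\<integral>x. fd f x v \<partial>lborel) = 0"
proof -
  obtain B where B: "B \<ge> 0" "\<And>x v. norm (fd f x v) \<le> B * norm v"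
      "\<And>x y. norm (f y - f x) \<le> B * norm (y - x)"
    using C1_compact_support_fd_bound[OF f K] by auto
  obtain r where r: "\<And>x. x \<in> K \<Longrightarrow> norm x \<le> r"
    using compact_imp_bounded[OF K(1)] unfolding bounded_iff by auto
  define t where "t n = 1 / real (Suc n)" for n
  have t: "0 < t n" "t n \<le> 1" for n by (auto simp: t_def)
  have t_lim: "t \<longlonglongrightarrow> 0" unfolding t_def using LIMSEQ_Suc[OF lim_1_over_n] .
  define q where "q n x = (1 / t n) *\<^sub>R (f (t n *\<^sub>R v + x) - f x)" for n x
  have cf: "continuous_on UNIV f" using f by (rule C1_on_continuous)
  have fm: "f \<in> borel_measurable borel" using cf by (rule borel_measurable_continuous_onI)
  have fi: "integrable lborel f" using integrable_continuous_compact_support[OF cf K] .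
  have q0: "(\<integral>x. q n x \<partial>lborel) = 0" for n
    unfolding q_def using fi by (simp add: lborel_integral_shift)
  have "(\<lambda>n. \<integral>x. q n x \<partial>lborel) \<longlonglongrightarrow> (\<integral>x. fd f x v \<partial>lborel)"
  \<comment> \<open>The step lengths are at most 1, so all quotients vanish outside the ball
    enlarged by \<open>norm v\<close>; inside, the Lipschitz constant bounds them.\<close>
  proof (rule integral_dominated_convergence[where w="\<lambda>x. indicator (cball 0 (r + norm v)) x *\<^sub>R (B * norm v)"])
    show "(\<lambda>x. fd f x v) \<in> borel_measurable lborel"
      using borel_measurable_continuous_onI[OF C1_on_fd_continuous[OF f]] by simp
    show "q n \<in> borel_measurable lborel" for n
      unfolding q_def using fm by measurable
    show "integrable lborel (\<lambda>x::'a. indicator (cball 0 (r + norm v)) x *\<^sub>R (B * norm v))"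
      by (rule borel_integrable_compact) auto
    show "AE x in lborel. (\<lambda>n. q n x) \<longlonglongrightarrow> fd f x v"
    proof (intro AE_I2)
      fix x
      have "(f has_derivative (\<lambda>v. fd f x v)) (at x)" using C1_on_has_derivative[OF f] by simp
      then show "(\<lambda>n. q n x) \<longlonglongrightarrow> fd f x v"
        unfolding q_def using directional_difference_quotient[of f "fd f x" x t v] t t_lim
        by (simp add: add.commute)
    qed
    show "AE x in lborel. norm (q n x) \<le> indicator (cball 0 (r + norm v)) x *\<^sub>R (B * norm v)" for n
    proof (intro AE_I2)
      fix x
      have tv: "norm (t n *\<^sub>R v) \<le> norm v" using t[of n] by (simp add: mult_left_le_one_le)
      show "norm (q n x) \<le> indicator (cball 0 (r + norm v)) x *\<^sub>R (B * norm v)"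
      proof (cases "x \<in> cball 0 (r + norm v)")
        case True
        have "norm (f (t n *\<^sub>R v + x) - f x) \<le> B * (t n * norm v)"
          using B(3)[of "t n *\<^sub>R v + x" x] t[of n] by simp
        moreover have "norm (q n x) = norm (f (t n *\<^sub>R v + x) - f x) / t n"
          using t[of n] by (simp only: q_def norm_scaleR) simp
        ultimately have "norm (q n x) \<le> B * norm v" using t[of n] by (simp add: pos_divide_le_eq mult_ac)
        then show ?thesis using True by simp
      next
        case False
        then have n: "norm x > r + norm v" by simp
        then have "x \<notin> K" using r[of x] norm_ge_zero[of v] by linarith
        moreover have "norm (t n *\<^sub>R v + x) > r"
          using norm_diff_ineq[of x "t n *\<^sub>R v"] n tv by (simp add: add.commute)
        then have "t n *\<^sub>R v + x \<notin> K" using r[of "t n *\<^sub>R v + x"] by auto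
        ultimately have "q n x = 0" using K(2) by (simp add: q_def)
        then show ?thesis using False by simp
      qed
    qed
  qed
  then show ?thesis using q0 by (simp add: LIMSEQ_const_iff)
qed

text \<open>Compact support of one factor makes the product compactly supported. The other factor is
  later a regularised kernel or the full potential, and the general bilinear product covers both
  real and complex factors.\<close>

lemma integral_by_parts_fd:
  fixes f :: "'a::euclidean_space \<Rightarrow> 'b::real_normed_vector" and g :: "'a \<Rightarrow> 'c::real_normed_vector"
    and B :: "'b \<Rightarrow> 'c \<Rightarrow> 'd::{banach, second_countable_topology}"
  assumes B: "bounded_bilinear B" and f: "C1_on UNIV f" and g: "C1_on UNIV g"
    and K: "compact K" "\<And>x. x \<notin> K \<Longrightarrow> g x = 0"
  shows "(\<integral>x. B (f x) (fd g x v) \<partial>lborel) = - (\<integral>x. B (fd f x v) (g x) \<partial>lborel)"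
    and "integrable lborel (\<lambda>x. B (f x) (fd g x v))" "integrable lborel (\<lambda>x. B (fd f x v) (g x))"
proof -
  have z: "B a 0 = 0" for a using B by (rule bounded_bilinear.zero_right)
  have g0: "fd g x v = 0" if "x \<notin> K" for x
    using fd_zero_outside[OF compact_imp_closed[OF K(1)] K(2) that] .
  have c: "continuous_on UNIV (\<lambda>x. B (f x) (fd g x v))" "continuous_on UNIV (\<lambda>x. B (fd f x v) (g x))"
    by (intro bounded_bilinear.continuous_on[OF B] C1_on_continuous[OF f] C1_on_fd_continuous[OF g]
        C1_on_continuous[OF g] C1_on_fd_continuous[OF f])+
  show i: "integrable lborel (\<lambda>x. B (f x) (fd g x v))" "integrable lborel (\<lambda>x. B (fd f x v) (g x))"
    using integrable_continuous_compact_support[OF c(1) K(1)] integrable_continuous_compact_support[OF c(2) K(1)]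
      g0 K(2) z by auto
  have "(\<integral>x. fd (\<lambda>x. B (f x) (g x)) x v \<partial>lborel) = 0"
    using K(2) z by (intro integral_fd_eq_0[OF C1_on_bilinear[OF B f g] K(1)]) simp
  then have "(\<integral>x. B (f x) (fd g x v) + B (fd f x v) (g x) \<partial>lborel) = 0"
    by (simp add: fd_bilinear[OF B f g])
  then show "(\<integral>x. B (f x) (fd g x v) \<partial>lborel) = - (\<integral>x. B (fd f x v) (g x) \<partial>lborel)"
    using i by (simp add: eq_neg_iff_add_eq_0)
qed

subsection \<open>The Newtonian potential of a compactly supported function\<close>

text \<open>Dyadic comparison: \<open>1 / |z|\<^sup>2\<close> is at most \<open>4 ^ (k + 1) / r\<^sup>2\<close> on the \<open>k\<close>-th shell of the ball of radius \<open>r\<close>.\<close>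

lemma integrable_inverse_norm_square:
  "integrable lborel (\<lambda>z::real^3. indicator (ball 0 r) z * (1 / (norm z)\<^sup>2))"
proof (cases "r > 0")
  case False
  then have e: "(ball 0 r :: (real^3) set) = {}" by simp
  show ?thesis unfolding e by simp
next
  case r: True
  define c where "c = measure lborel (ball (0::real^3) 1)"
  define a where "a k = 4 ^ Suc k / r\<^sup>2" for k :: nat
  have a: "a k \<ge> 0" for k by (simp add: a_def)
  have em: "emeasure lborel (ball (0::real^3) (r / 2^k)) = ennreal ((r / 2^k)^3 * c)" for k :: nat
    using content_ball_conv_unit_ball[of "r / 2^k" "0::real^3"] r emeasure_lborel_ball_finite[of "0::real^3" "r/2^k"]
    by (subst emeasure_eq_ennreal_measure) (auto simp: c_def top.not_eq_extremum)
  show ?thesis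
  proof (rule integrableI_bounded)
    show "(\<lambda>z::real^3. indicator (ball 0 r) z * (1 / (norm z)\<^sup>2)) \<in> borel_measurable lborel"
      by (intro borel_measurable_times borel_measurable_indicator borel_measurable_divide
          borel_measurable_power borel_measurable_norm) auto
    have pt: "ennreal (norm (indicator (ball 0 r) z * (1 / (norm z)\<^sup>2)))
        \<le> (\<Sum>k. ennreal (a k) * indicator (ball 0 (r / 2^k)) z)" for z :: "real^3"
    proof (cases "z \<in> ball 0 r \<and> z \<noteq> 0")
      case False
      \<comment> \<open>At the origin the quotient is 0 by the convention for division by
        zero.\<close>
      then have "norm (indicator (ball 0 r) z * (1 / (norm z)\<^sup>2)) = 0" by (auto simp: indicator_def)
      then show ?thesis by (simp only: ennreal_0 zero_le)
    next
      case True
      then have z: "norm z < r" "norm z > 0" by auto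
      define Q where "Q k \<longleftrightarrow> r / 2 ^ Suc k \<le> norm z" for k
      have "\<exists>k. Q k"
      proof -
        obtain n where n: "(1/2::real) ^ n < norm z / r"
          using real_arch_pow_inv[of "norm z / r" "1/2"] z r by auto
        have "r / 2 ^ Suc n \<le> r * (1/2) ^ n" using r by (simp add: power_divide field_simps)
        also have "\<dots> \<le> norm z" using n r by (simp add: field_simps)
        finally show ?thesis unfolding Q_def by blast
      qed
      \<comment> \<open>The least such index is the dyadic shell that contains
        \<open>z\<close>.\<close>
      then have Qk: "Q (LEAST k. Q k)" by (rule LeastI_ex)
      define k where "k = (LEAST k. Q k)"
      have k1: "r / 2 ^ Suc k \<le> norm z" using Qk by (simp add: k_def Q_def)
      have k2: "norm z < r / 2 ^ k"
      proof (cases k)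
        case 0 then show ?thesis using z by simp
      next
        case (Suc j)
        then have "\<not> Q j" unfolding k_def using not_less_Least[of j Q] by simp
        then show ?thesis using Suc by (simp add: Q_def)
      qed
      have "(r / 2 ^ Suc k)\<^sup>2 \<le> (norm z)\<^sup>2" using k1 r by (intro power_mono) auto
      moreover have "(r / 2 ^ Suc k)\<^sup>2 = r\<^sup>2 / 4 ^ Suc k"
        by (simp add: power_divide power_mult_distrib power2_eq_square flip: power_mult_distrib)
      ultimately have "1 / (norm z)\<^sup>2 \<le> a k" unfolding a_def using z r by (simp add: divide_simps mult.commute)
      then have "ennreal (norm (indicator (ball 0 r) z * (1 / (norm z)\<^sup>2))) \<le> ennreal (a k) * indicator (ball 0 (r / 2^k)) z"
        using True k2 by (simp add: ennreal_leI)
      also have "\<dots> \<le> (\<Sum>k. ennreal (a k) * indicator (ball 0 (r / 2^k)) z)"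
        using sum_le_suminf[of "\<lambda>k. ennreal (a k) * indicator (ball 0 (r / 2^k)) z" "{k}"]
        by (simp del: sum_mult_indicator)
      finally show ?thesis .
    qed
    have "(\<integral>\<^sup>+z. norm (indicator (ball (0::real^3) r) z * (1 / (norm z)\<^sup>2)) \<partial>lborel)
        \<le> (\<integral>\<^sup>+z. (\<Sum>k. ennreal (a k) * indicator (ball (0::real^3) (r / 2^k)) z) \<partial>lborel)"
      by (intro nn_integral_mono pt)
    also have "\<dots> = (\<Sum>k. \<integral>\<^sup>+z. ennreal (a k) * indicator (ball (0::real^3) (r / 2^k)) z \<partial>lborel)"
      by (intro nn_integral_suminf borel_measurable_times_ennreal borel_measurable_indicator) auto
    also have "\<dots> = (\<Sum>k. ennreal (a k * ((r / 2^k)^3 * c)))"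
      using a by (simp add: nn_integral_cmult_indicator em ennreal_mult')
    \<comment> \<open>The kernel grows like \<open>4^k\<close> while the volume decays like
      \<open>8^(-k)\<close>: dimension 3 exceeds the exponent 2, and a geometric series
      remains.\<close>
    also have "(\<lambda>k. a k * ((r / 2^k)^3 * c)) = (\<lambda>k. (4 * r * c) * (1/2) ^ k)"
    proof
      fix k
      have "(2::real)^k * 2^k = 4^k" by (simp flip: power_mult_distrib)
      then show "a k * ((r / 2^k)^3 * c) = (4 * r * c) * (1/2) ^ k"
        using r by (simp add: a_def power_divide power3_eq_cube power2_eq_square field_simps)
    qed
    also have "(\<Sum>k. ennreal ((4 * r * c) * (1/2) ^ k)) = ennreal (\<Sum>k. (4 * r * c) * (1/2) ^ k)"
      using r by (intro suminf_ennreal2 summable_mult summable_geometric) (auto simp: c_def)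
    also have "\<dots> < \<infinity>" by simp
    finally show "(\<integral>\<^sup>+z. norm (indicator (ball (0::real^3) r) z * (1 / (norm z)\<^sup>2)) \<partial>lborel) < \<infinity>" .
  qed
qed

lemma inverse_norm_le: "1 / norm z \<le> 1 + 1 / (norm z)\<^sup>2"
proof -
  have "t \<le> 1 + t\<^sup>2" if "t \<ge> 0" for t :: real
    using sum_squares_bound[of 1 t] that by simp
  from this[of "1 / norm z"] show ?thesis by (simp add: power_divide)
qed

text \<open>A majorant of the Newtonian kernel on a ball, built from the square kernel so that a
  single integrability result serves both.\<close>

definition wgt :: "real \<Rightarrow> real^3 \<Rightarrow> real" where
  "wgt r z = indicator (ball 0 r) z * (1 + 1 / (norm z)\<^sup>2)"

lemma integrable_wgt: "integrable lborel (wgt r)"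
proof -
  have "integrable lborel (\<lambda>z::real^3. indicator (ball 0 r) z * (1::real))"
    using emeasure_lborel_ball_finite[of "0::real^3" r] by simp
  from Bochner_Integration.integrable_add[OF this integrable_inverse_norm_square[of r]]
  show ?thesis unfolding wgt_def by (simp add: distrib_left)
qed

lemma kernel_le_wgt:
  assumes "norm u \<le> B" "z \<notin> ball 0 r \<Longrightarrow> u = 0"
  shows "norm ((1 / norm z) *\<^sub>R u) \<le> B * wgt r z"
proof (cases "z \<in> ball 0 r")
  case True
  have "1 / norm z * norm u \<le> (1 + 1 / (norm z)\<^sup>2) * B"
    using assms(1) by (intro mult_mono inverse_norm_le) auto
  then show ?thesis using True by (simp add: wgt_def mult.commute)
next
  case False then show ?thesis using assms(2) by (simp add: wgt_def)
qed

text \<open>The potential after the substitution \<open>y = x + z\<close>, without its normalising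
  factor: the singular kernel no longer depends on \<open>x\<close>, so derivatives in
  \<open>x\<close> fall on \<open>f\<close> alone.\<close>

definition newton :: "(real^3 \<Rightarrow> 'b::{banach, second_countable_topology}) \<Rightarrow> real^3 \<Rightarrow> 'b" where
  "newton f x = (\<integral>z. (1 / norm z) *\<^sub>R f (x + z) \<partial>lborel)"

lemma Kop_eq_newton: "Kop f x = (1 / (4 * pi)) *\<^sub>R newton f x"
  unfolding Kop_def newton_def
  using lborel_integral_shift(1)[of "\<lambda>y. (1 / dist x y) *\<^sub>R f y" x] by (simp add: dist_norm)

lemma borel_shift: "f \<in> borel_measurable borel \<Longrightarrow> (\<lambda>z::'a::euclidean_space. f (x + z)) \<in> borel_measurable borel"
  by (rule measurable_compose[of "\<lambda>z. x + z" borel borel f]) auto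

text \<open>One ball of integration for all base points of norm at most \<open>m\<close>; the 1
  turns a closed bound into membership in an open ball.\<close>

lemma support_shift:
  fixes K :: "'a::real_normed_vector set"
  assumes "K \<subseteq> cball 0 r" "norm x \<le> m" "x + z \<in> K"
  shows "z \<in> ball 0 (r + m + 1)"
proof -
  have "norm (x + z) \<le> r" using assms by auto
  then have "norm z \<le> r + norm x" using norm_triangle_ineq4[of "x + z" x] by simp
  then show ?thesis using assms by simp
qed

lemma newton_integrable:
  fixes f :: "real^3 \<Rightarrow> 'b::{banach, second_countable_topology}"
  assumes f: "f \<in> borel_measurable borel" "\<And>x. norm (f x) \<le> B" and K: "K \<subseteq> cball 0 r" "\<And>x. x \<notin> K \<Longrightarrow> f x = 0"
  shows "integrable lborel (\<lambda>z. (1 / norm z) *\<^sub>R f (x + z))"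
proof (rule Bochner_Integration.integrable_bound)
  show "integrable lborel (\<lambda>z. B * wgt (r + norm x + 1) z)" using integrable_wgt by simp
  show "(\<lambda>z. (1 / norm z) *\<^sub>R f (x + z)) \<in> borel_measurable lborel"
    using borel_shift[OF f(1)] by measurable
  have "norm ((1 / norm z) *\<^sub>R f (x + z)) \<le> B * wgt (r + norm x + 1) z" for z
    using K(2)[of "x + z"] support_shift[OF K(1) order_refl, of x z] by (intro kernel_le_wgt f(2)) blast
  then show "AE z in lborel. norm ((1 / norm z) *\<^sub>R f (x + z)) \<le> norm (B * wgt (r + norm x + 1) z)"
    unfolding real_norm_def by (intro AE_I2 order_trans[OF _ abs_ge_self])
qed

text \<open>A uniform bound and a common bounded support suffice, because \<open>B * wgt r\<close>
  is integrable and dominates every kernel integrand.\<close>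

lemma newton_limit:
  fixes F :: "nat \<Rightarrow> real^3 \<Rightarrow> 'b::{banach, second_countable_topology}"
  assumes F: "\<And>n. F n \<in> borel_measurable borel" "\<And>n z. norm (F n z) \<le> B"
    and G: "G \<in> borel_measurable borel" "\<And>z. (\<lambda>n. F n z) \<longlonglongrightarrow> G z"
    and 0: "\<And>n z. z \<notin> ball 0 r \<Longrightarrow> F n z = 0"
  shows "(\<lambda>n. \<integral>z. (1 / norm z) *\<^sub>R F n z \<partial>lborel) \<longlonglongrightarrow> (\<integral>z. (1 / norm z) *\<^sub>R G z \<partial>lborel)"
proof (rule integral_dominated_convergence[where w="\<lambda>z. B * wgt r z"])
  show "(\<lambda>z. (1 / norm z) *\<^sub>R G z) \<in> borel_measurable lborel" using G(1) by measurable
  show "(\<lambda>z. (1 / norm z) *\<^sub>R F n z) \<in> borel_measurable lborel" for n using F(1) by measurable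
  show "integrable lborel (\<lambda>z. B * wgt r z)" using integrable_wgt by simp
  show "AE z in lborel. (\<lambda>n. (1 / norm z) *\<^sub>R F n z) \<longlonglongrightarrow> (1 / norm z) *\<^sub>R G z"
    by (intro AE_I2 tendsto_intros G(2))
  show "AE z in lborel. norm ((1 / norm z) *\<^sub>R F n z) \<le> B * wgt r z" for n
    using F(2) 0 by (intro AE_I2 kernel_le_wgt) auto
qed

lemma compact_subset_cball:
  fixes K :: "'a::real_normed_vector set"
  assumes "compact K" obtains r where "K \<subseteq> cball 0 r" "r \<ge> 0"
proof -
  obtain r where "\<And>x. x \<in> K \<Longrightarrow> norm x \<le> r"
    using compact_imp_bounded[OF assms] unfolding bounded_iff by auto
  then have "K \<subseteq> cball 0 (max r 0)" by (auto simp: le_max_iff_disj)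
  then show thesis using that[of "max r 0"] by simp
qed

lemma newton_continuous:
  fixes f :: "real^3 \<Rightarrow> 'b::{banach, second_countable_topology}"
  assumes f: "continuous_on UNIV f" and K: "compact K" "\<And>x. x \<notin> K \<Longrightarrow> f x = 0"
  shows "continuous_on UNIV (newton f)"
proof -
  obtain B where B: "\<And>x. norm (f x) \<le> B" using continuous_compact_support_bounded[OF f K] by auto
  obtain r where r: "K \<subseteq> cball 0 r" using compact_subset_cball[OF K(1)] by blast
  show ?thesis
  proof (rule continuous_at_imp_continuous_on, intro ballI, rule continuous_within_sequentiallyI)
    fix x :: "real^3" and X assume X: "X \<longlonglongrightarrow> x"
    then have "Bseq X" by (rule convergent_imp_Bseq[OF convergentI])
    then obtain m where m: "\<And>n. norm (X n) \<le> m" unfolding Bseq_def by auto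
    show "(\<lambda>n. newton f (X n)) \<longlonglongrightarrow> newton f x" unfolding newton_def
    proof (rule newton_limit[where B=B and r="r + m + 1"])
      show "(\<lambda>z. f (X n + z)) \<in> borel_measurable borel" for n by (rule borel_shift[OF borel_measurable_continuous_onI[OF f]])
      show "(\<lambda>z. f (x + z)) \<in> borel_measurable borel" by (rule borel_shift[OF borel_measurable_continuous_onI[OF f]])
      show "norm (f (X n + z)) \<le> B" for n z by (rule B)
      show "f (X n + z) = 0" if "z \<notin> ball 0 (r + m + 1)" for n z
        using support_shift[OF r m[of n]] that K(2) by blast
      show "(\<lambda>n. f (X n + z)) \<longlonglongrightarrow> f (x + z)" for z
        using f X by (intro continuous_on_tendsto_compose[OF f] tendsto_intros) auto
    qed
  qed
qed

text \<open>The remainder quotients are bounded by twice the Lipschitz constant and tend to 0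
  pointwise, so \<open>newton_limit\<close> applies along every null sequence of increments.\<close>

lemma newton_has_derivative:
  fixes f :: "real^3 \<Rightarrow> 'b::{banach, second_countable_topology}"
  assumes f: "C1_on UNIV f" and K: "compact K" "\<And>x. x \<notin> K \<Longrightarrow> f x = 0"
  shows "(newton f has_derivative (\<lambda>v. newton (\<lambda>y. fd f y v) x)) (at x)"
proof -
  obtain B where B0: "B \<ge> 0" and B: "\<And>x v. norm (fd f x v) \<le> B * norm v"
      "\<And>x y. norm (f y - f x) \<le> B * norm (y - x)"
    using C1_compact_support_fd_bound[OF f K] by auto
  obtain r where r: "K \<subseteq> cball 0 r" "r \<ge> 0" using compact_subset_cball[OF K(1)] by blast
  have lin: "linear (\<lambda>v. fd f y v)" for y
    by (rule has_derivative_linear[OF C1_on_has_derivative[OF f UNIV_I]])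
  have f0: "fd f y v = 0" if "y \<notin> K" for y v
    by (rule fd_zero_outside[OF compact_imp_closed[OF K(1)] K(2) that])
  have cf: "continuous_on UNIV f" by (rule C1_on_continuous[OF f])
  obtain Bf where Bf: "\<And>x. norm (f x) \<le> Bf" using continuous_compact_support_bounded[OF cf K] by auto
  have fb: "f \<in> borel_measurable borel" by (rule borel_measurable_continuous_onI[OF cf])
  have fdb: "(\<lambda>y. fd f y v) \<in> borel_measurable borel" for v by (rule borel_measurable_continuous_onI[OF C1_on_fd_continuous[OF f]])
  have i1: "integrable lborel (\<lambda>z. (1 / norm z) *\<^sub>R f (y + z))" for y
    by (rule newton_integrable[OF fb Bf r(1) K(2)])
  have i2: "integrable lborel (\<lambda>z. (1 / norm z) *\<^sub>R fd f (y + z) v)" for y v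
    by (rule newton_integrable[OF fdb B(1) r(1) f0])
  let ?D = "\<lambda>v. newton (\<lambda>y. fd f y v) x"
  have bl: "bounded_linear ?D"
  proof (rule bounded_linear_intro[where K="B * (\<integral>z. wgt (r + norm x + 1) z \<partial>lborel)"])
    show "?D (v + w) = ?D v + ?D w" for v w
      unfolding newton_def using i2 by (simp add: linear_add[OF lin] scaleR_add_right)
    show "?D (c *\<^sub>R v) = c *\<^sub>R ?D v" for c v
    proof -
      have "?D (c *\<^sub>R v) = (\<integral>z. c *\<^sub>R ((1 / norm z) *\<^sub>R fd f (x + z) v) \<partial>lborel)"
        unfolding newton_def by (simp add: linear_scale[OF lin] mult.commute)
      then show ?thesis unfolding newton_def by (simp only: integral_scaleR_right)
    qed
    show "norm (?D v) \<le> norm v * (B * (\<integral>z. wgt (r + norm x + 1) z \<partial>lborel))" for v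
    proof -
      have "norm (?D v) \<le> (\<integral>z. (B * norm v) * wgt (r + norm x + 1) z \<partial>lborel)"
        unfolding newton_def
      proof (rule Bochner_Integration.integral_norm_bound_integral[OF i2])
        show "integrable lborel (\<lambda>z. (B * norm v) * wgt (r + norm x + 1) z)" using integrable_wgt by simp
        show "norm ((1 / norm z) *\<^sub>R fd f (x + z) v) \<le> (B * norm v) * wgt (r + norm x + 1) z" for z
          using f0[of "x + z" v] support_shift[OF r(1) order_refl, of x z] by (intro kernel_le_wgt B(1)) blast
      qed
      then show ?thesis by (simp add: mult_ac)
    qed
  qed
  have "((\<lambda>h. norm (newton f (x + h) - newton f x - ?D h) / norm h) \<longlongrightarrow> 0) (at 0)"
    unfolding tendsto_at_iff_sequentially comp_def
  proof (intro allI impI)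
    fix X :: "nat \<Rightarrow> real^3" assume X0: "\<forall>i. X i \<in> UNIV - {0}" and X: "X \<longlonglongrightarrow> 0"
    have Xn: "norm (X n) > 0" for n using X0 by auto
    have "Bseq X" by (rule convergent_imp_Bseq[OF convergentI[OF X]])
    then obtain m where m: "\<And>n. norm (X n) \<le> m" "m > 0" unfolding Bseq_def by auto
    define q where "q n z = (1 / norm (X n)) *\<^sub>R (f (x + X n + z) - f (x + z) - fd f (x + z) (X n))" for n z
    have q: "(1 / norm (X n)) *\<^sub>R (newton f (x + X n) - newton f x - ?D (X n)) = (\<integral>z. (1 / norm z) *\<^sub>R q n z \<partial>lborel)" for n
    proof -
      have "newton f (x + X n) - newton f x - ?D (X n)
          = (\<integral>z. (1 / norm z) *\<^sub>R f (x + X n + z) - (1 / norm z) *\<^sub>R f (x + z) - (1 / norm z) *\<^sub>R fd f (x + z) (X n) \<partial>lborel)"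
        unfolding newton_def using i1 i2 by simp
      moreover have "(1 / norm z) *\<^sub>R q n z = (1 / norm (X n)) *\<^sub>R ((1 / norm z) *\<^sub>R f (x + X n + z)
          - (1 / norm z) *\<^sub>R f (x + z) - (1 / norm z) *\<^sub>R fd f (x + z) (X n))" for z
        by (simp only: q_def scaleR_diff_right scaleR_left_commute[of "1 / norm (X n)"])
      ultimately show ?thesis by (simp only: integral_scaleR_right)
    qed
    have "(\<lambda>n. \<integral>z. (1 / norm z) *\<^sub>R q n z \<partial>lborel) \<longlonglongrightarrow> (\<integral>z. (1 / norm (z::real^3)) *\<^sub>R 0 \<partial>lborel)"
    proof (rule newton_limit[where B="2 * B" and r="r + (norm x + m) + 1"])
      show "q n \<in> borel_measurable borel" for n
        unfolding q_def using borel_shift[OF fb, of "x + X n"] borel_shift[OF fb, of x] borel_shift[OF fdb[of "X n"], of x]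
        by measurable
      show "norm (q n z) \<le> 2 * B" for n z
      proof -
        have "norm (f (x + X n + z) - f (x + z) - fd f (x + z) (X n)) \<le> B * norm (X n) + B * norm (X n)"
          using B(2)[of "x + X n + z" "x + z"] B(1)[of "x + z" "X n"]
            norm_triangle_ineq4[of "f (x + X n + z) - f (x + z)" "fd f (x + z) (X n)"] by simp
        then have "norm (f (x + X n + z) - f (x + z) - fd f (x + z) (X n)) / norm (X n) \<le> 2 * B"
          using Xn[of n] by (simp add: pos_divide_le_eq)
        then show ?thesis unfolding q_def norm_scaleR by simp
      qed
      show "(\<lambda>n. q n z) \<longlonglongrightarrow> 0" for z
      proof -
        have "((\<lambda>h. norm (f (x + z + h) - f (x + z) - fd f (x + z) h) / norm h) \<longlongrightarrow> 0) (at 0)"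
          using C1_on_has_derivative[OF f UNIV_I, of "x + z"] by (simp add: has_derivative_at)
        then have "(\<lambda>n. norm (f (x + z + X n) - f (x + z) - fd f (x + z) (X n)) / norm (X n)) \<longlonglongrightarrow> 0"
          using X0 X unfolding tendsto_at_iff_sequentially comp_def by blast
        then have "(\<lambda>n. norm (q n z)) \<longlonglongrightarrow> 0" unfolding q_def norm_scaleR by (simp add: add_ac)
        then show ?thesis by (simp add: tendsto_norm_zero_iff)
      qed
      show "q n z = 0" if z: "z \<notin> ball 0 (r + (norm x + m) + 1)" for n z
      proof -
        have "norm (x + X n) \<le> norm x + m" using norm_triangle_ineq[of x "X n"] m(1)[of n] by linarith
        moreover have "norm x \<le> norm x + m" using m by simp
        ultimately have "x + X n + z \<notin> K" "x + z \<notin> K" using support_shift[OF r(1)] z by blast+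
        then show ?thesis using K(2) f0 by (simp add: q_def)
      qed
    qed simp
    then have "(\<lambda>n. norm ((1 / norm (X n)) *\<^sub>R (newton f (x + X n) - newton f x - ?D (X n)))) \<longlonglongrightarrow> norm (0::'b)"
      unfolding q by (intro tendsto_norm) simp
    then show "(\<lambda>n. norm (newton f (x + X n) - newton f x - ?D (X n)) / norm (X n)) \<longlonglongrightarrow> 0"
      by simp
  qed
  then show ?thesis using bl by (simp add: has_derivative_at)
qed

lemma newton_C1:
  fixes f :: "real^3 \<Rightarrow> 'b::{banach, second_countable_topology}"
  assumes f: "C1_on UNIV f" and K: "compact K" "\<And>x. x \<notin> K \<Longrightarrow> f x = 0"
  shows "C1_on UNIV (newton f)"
proof (rule C1_onI[OF newton_has_derivative[OF f K]])
  show "continuous_on UNIV (\<lambda>x. newton (\<lambda>y. fd f y v) x)" for v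
    using newton_continuous[OF C1_on_fd_continuous[OF f] K(1)]
      fd_zero_outside[OF compact_imp_closed[OF K(1)] K(2)] by auto
qed

text \<open>Absolute integrability for Fubini. Integrating out \<open>y\<close> leaves
  \<open>norm (g x)\<close> times the potential of the norm of \<open>f\<close>, which is
  continuous, and \<open>g\<close> has compact support.\<close>

lemma newton_pairing_integrable:
  fixes f g :: "real^3 \<Rightarrow> complex"
  assumes f: "continuous_on UNIV f" and g: "continuous_on UNIV g"
    and K: "compact K" "\<And>x. x \<notin> K \<Longrightarrow> f x = 0" and L: "compact L" "\<And>x. x \<notin> L \<Longrightarrow> g x = 0"
  shows "integrable (lborel \<Otimes>\<^sub>M lborel) (\<lambda>(x, y). (1 / dist x y) *\<^sub>R (f y * g x))"
proof (rule lborel_pair.Fubini_integrable)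
  have fg: "f \<in> borel_measurable borel" "g \<in> borel_measurable borel"
    using f g by (auto intro: borel_measurable_continuous_onI)
  show "(\<lambda>(x, y). (1 / dist x y) *\<^sub>R (f y * g x)) \<in> borel_measurable (lborel \<Otimes>\<^sub>M lborel)"
    unfolding split_beta using fg by measurable
  obtain B where B: "\<And>x. norm (f x) \<le> B" using continuous_compact_support_bounded[OF f K] by auto
  obtain r where r: "K \<subseteq> cball 0 r" using compact_subset_cball[OF K(1)] by blast
  have sh: "integrable lborel (\<lambda>y. (1 / dist x y) *\<^sub>R f y)" for x
    using newton_integrable[OF fg(1) B r K(2), of x]
      lborel_integral_shift(2)[of "\<lambda>y. (1 / dist x y) *\<^sub>R f y" x] by (simp add: dist_norm)
  show "AE x in lborel. integrable lborel (\<lambda>y. case (x, y) of (x, y) \<Rightarrow> (1 / dist x y) *\<^sub>R (f y * g x))"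
    using integrable_mult_left[OF sh] by (intro AE_I2) simp
  have cN: "continuous_on UNIV (newton (\<lambda>y. norm (f y)))"
    using K by (intro newton_continuous[OF _ K(1)] continuous_intros f) auto
  have "(\<integral>y. norm (case (x, y) of (x, y) \<Rightarrow> (1 / dist x y) *\<^sub>R (f y * g x)) \<partial>lborel)
      = norm (g x) * newton (\<lambda>y. norm (f y)) x" for x
  proof -
    have "(\<integral>y. norm ((1 / dist x y) *\<^sub>R (f y * g x)) \<partial>lborel) = (\<integral>y. norm (g x) * ((1 / dist x y) * norm (f y)) \<partial>lborel)"
      by (intro Bochner_Integration.integral_cong) (simp_all add: norm_mult)
    also have "\<dots> = norm (g x) * (\<integral>y. (1 / dist x y) * norm (f y) \<partial>lborel)" by (rule integral_mult_right_zero)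
    also have "(\<integral>y. (1 / dist x y) * norm (f y) \<partial>lborel) = newton (\<lambda>y. norm (f y)) x"
      using lborel_integral_shift(1)[of "\<lambda>y. (1 / dist x y) * norm (f y)" x] by (simp add: newton_def dist_norm)
    finally show ?thesis by simp
  qed
  moreover have "integrable lborel (\<lambda>x. norm (g x) * newton (\<lambda>y. norm (f y)) x)"
    using L(2) by (intro integrable_continuous_compact_support[OF _ L(1)] continuous_intros cN g) auto
  ultimately show "integrable lborel (\<lambda>x. \<integral>y. norm (case (x, y) of (x, y) \<Rightarrow> (1 / dist x y) *\<^sub>R (f y * g x)) \<partial>lborel)"
    by simp
qed

text \<open>The kernel is real and symmetric in its two points, so exchanging the integrations moves
  it from \<open>f\<close> to \<open>g\<close>.\<close>

lemma Kop_symmetric: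
  fixes f g :: "real^3 \<Rightarrow> complex"
  assumes f: "continuous_on UNIV f" and g: "continuous_on UNIV g"
    and K: "compact K" "\<And>x. x \<notin> K \<Longrightarrow> f x = 0" and L: "compact L" "\<And>x. x \<notin> L \<Longrightarrow> g x = 0"
  shows "(\<integral>x. Kop f x * cnj (g x) \<partial>lborel) = (\<integral>x. f x * cnj (Kop g x) \<partial>lborel)"
proof -
  let ?h = "\<lambda>x. cnj (g x)"
  let ?c = "1 / (4 * pi)"
  have h: "continuous_on UNIV ?h" "\<And>x. x \<notin> L \<Longrightarrow> ?h x = 0" using L g by (auto intro!: continuous_intros)
  have 1: "Kop f x * ?h x = ?c *\<^sub>R (\<integral>y. (1 / dist x y) *\<^sub>R (f y * ?h x) \<partial>lborel)" for x
    unfolding Kop_def by (simp add: mult_scaleR_left[symmetric] del: mult_scaleR_left)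
  have 2: "f y * cnj (Kop g y) = ?c *\<^sub>R (\<integral>x. (1 / dist x y) *\<^sub>R (f y * ?h x) \<partial>lborel)" for y
  proof -
    have "cnj (Kop g y) = ?c *\<^sub>R (\<integral>x. (1 / dist x y) *\<^sub>R ?h x \<partial>lborel)"
    proof -
      have "cnj (\<integral>x. (1 / dist y x) *\<^sub>R g x \<partial>lborel) = (\<integral>x. cnj ((1 / dist y x) *\<^sub>R g x) \<partial>lborel)"
        by (rule Bochner_Integration.integral_cnj[symmetric])
      also have "\<dots> = (\<integral>x. (1 / dist x y) *\<^sub>R ?h x \<partial>lborel)"
        by (intro Bochner_Integration.integral_cong) (simp_all add: dist_commute)
      finally show ?thesis unfolding Kop_def by simp
    qed
    moreover have "f y * (\<integral>x. (1 / dist x y) *\<^sub>R ?h x \<partial>lborel) = (\<integral>x. (1 / dist x y) *\<^sub>R (f y * ?h x) \<partial>lborel)"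
      by (subst integral_mult_right_zero[symmetric]) (simp add: mult.left_commute scaleR_conv_of_real)
    ultimately show ?thesis by simp
  qed
  have "(\<integral>y. (\<integral>x. (1 / dist x y) *\<^sub>R (f y * ?h x) \<partial>lborel) \<partial>lborel) = (\<integral>x. (\<integral>y. (1 / dist x y) *\<^sub>R (f y * ?h x) \<partial>lborel) \<partial>lborel)"
    by (rule lborel_pair.Fubini_integral[OF newton_pairing_integrable[OF f h(1) K L(1) h(2)]])
  then show ?thesis unfolding 1 2 by simp
qed

section \<open>Pairing a divergence with its own potential\<close>

lemma C1_inner_sq: "C1_on UNIV (\<lambda>y::'a::real_inner. (norm (y - x))\<^sup>2 + c)"
  and fd_inner_sq: "fd (\<lambda>y::'a::real_inner. (norm (y - x))\<^sup>2 + c) y v = 2 * ((y - x) \<bullet> v)"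
proof -
  have d: "((\<lambda>y::'a. (norm (y - x))\<^sup>2 + c) has_derivative (\<lambda>v. 2 * ((y - x) \<bullet> v))) (at y)" for y
    unfolding power2_norm_eq_inner
    by (auto intro!: derivative_eq_intros simp: inner_commute algebra_simps)
  show "C1_on UNIV (\<lambda>y::'a::real_inner. (norm (y - x))\<^sup>2 + c)"
    by (intro C1_onI[OF d] continuous_intros)
  show "fd (\<lambda>y::'a::real_inner. (norm (y - x))\<^sup>2 + c) y v = 2 * ((y - x) \<bullet> v)"
    by (rule fd_eq[OF d])
qed

text \<open>The gradient is \<open>- (y - x) / (|y - x|^2 + e)^(3/2)\<close> and dropping
  \<open>e\<close> only enlarges its norm. At \<open>y = x\<close> both sides are 0, the right one
  by the convention for division.\<close>

lemma regularised_kernel: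
  fixes x :: "'a::real_inner"
  assumes e: "e > 0"
  defines "k \<equiv> \<lambda>y. 1 / sqrt ((norm (y - x))\<^sup>2 + e)"
  shows "C1_on UNIV k" and "\<bar>fd k y v\<bar> \<le> norm v / (norm (y - x))\<^sup>2"
proof -
  define \<phi>' where "\<phi>' t = - 1 / (2 * t * sqrt t)" for t :: real
  have pos: "(norm (y - x))\<^sup>2 + e \<in> {0<..}" for y using e by (simp add: add_nonneg_pos)
  have d: "((\<lambda>t. 1 / sqrt t) has_real_derivative \<phi>' t) (at t)" if "t \<in> {0<..}" for t
    using that unfolding \<phi>'_def
    by (auto intro!: derivative_eq_intros simp: field_simps power2_eq_square)
  have c: "continuous_on {0<..} \<phi>'"
    unfolding \<phi>'_def by (intro continuous_intros) auto
  show "C1_on UNIV k" unfolding k_def by (rule C1_on_compose_real[OF C1_inner_sq pos d c])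
  have eq: "fd k y v = \<phi>' ((norm (y - x))\<^sup>2 + e) * (2 * ((y - x) \<bullet> v))"
    unfolding k_def by (subst fd_compose_real[OF C1_inner_sq pos d c]) (auto simp: fd_inner_sq)
  show "\<bar>fd k y v\<bar> \<le> norm v / (norm (y - x))\<^sup>2"
  proof (cases "y = x")
    case True then show ?thesis unfolding eq by simp
  next
    case False
    define s where "s = norm (y - x)"
    define t where "t = s\<^sup>2 + e"
    have s: "s > 0" using False by (simp add: s_def)
    have t: "s\<^sup>2 \<le> t" "t > 0" using e s by (auto simp: t_def add_nonneg_pos)
    have st: "s \<le> sqrt t" using t s by (simp add: real_le_rsqrt)
    have "s * s\<^sup>2 \<le> sqrt t * t" using st t s by (intro mult_mono) auto
    then have "1 / (sqrt t * t) \<le> 1 / (s * s\<^sup>2)"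
      using s by (intro divide_left_mono) (auto intro!: mult_pos_pos t(2))
    have "fd k y v = \<phi>' t * (2 * ((y - x) \<bullet> v))" unfolding eq t_def s_def ..
    then have "\<bar>fd k y v\<bar> = 1 / (sqrt t * t) * \<bar>(y - x) \<bullet> v\<bar>"
      using t by (simp add: \<phi>'_def abs_mult)
    also have "\<dots> \<le> 1 / (s * s\<^sup>2) * (s * norm v)"
      using \<open>1 / (sqrt t * t) \<le> 1 / (s * s\<^sup>2)\<close> s t Cauchy_Schwarz_ineq2[of "y - x" v]
      by (intro mult_mono) (auto simp: s_def)
    also have "\<dots> = norm v / s\<^sup>2" using s by (simp add: field_simps)
    finally show ?thesis by (simp add: s_def)
  qed
qed

text \<open>Integration by parts against \<open>1 / sqrt (|y - x|\<^sup>2 + \<epsilon>)\<close>, whose gradient is dominated by \<open>1 / |y - x|\<^sup>2\<close>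
  uniformly in \<open>\<epsilon>\<close>.\<close>

lemma Kop_div_pointwise:
  fixes F :: "real^3 \<Rightarrow> complex^3"
  assumes F: "\<And>i. C1_on UNIV (\<lambda>y. F y $ i)" and K: "compact K" "\<And>x. x \<notin> K \<Longrightarrow> F x = 0"
  shows "ennreal (norm (\<integral>y. (1 / dist x y) *\<^sub>R cdiv F y \<partial>lborel))
      \<le> (\<integral>\<^sup>+y. ennreal ((\<Sum>i\<in>UNIV. norm (F y $ i)) / (dist x y)\<^sup>2) \<partial>lborel)"
proof -
  let ?R = "(\<integral>\<^sup>+y. ennreal ((\<Sum>i\<in>UNIV. norm (F y $ i)) / (dist x y)\<^sup>2) \<partial>lborel)"
  have Fi0: "F y $ i = 0" if "y \<notin> K" for y i using K(2)[OF that] by simp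
  have clK: "closed K" using K(1) by (rule compact_imp_closed)
  have f0: "fd (\<lambda>y. F y $ i) y v = 0" if "y \<notin> K" for y i v
    by (rule fd_zero_outside[OF clK Fi0 that])
  have div0: "cdiv F y = 0" if "y \<notin> K" for y unfolding cdiv_def using f0[OF that] by simp
  have cdivc: "continuous_on UNIV (cdiv F)"
    unfolding cdiv_def by (intro continuous_intros C1_on_fd_continuous[OF F])
  obtain B where B: "\<And>y. norm (cdiv F y) \<le> B" using continuous_compact_support_bounded[OF cdivc K(1) div0] by auto
  obtain r where r: "K \<subseteq> cball 0 r" using compact_subset_cball[OF K(1)] by blast
  define e where "e n = 1 / real (Suc n)" for n
  have e: "e n > 0" for n by (simp add: e_def)
  have e0: "e \<longlonglongrightarrow> 0" unfolding e_def using LIMSEQ_Suc[OF lim_1_over_n] .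
  define k where "k n y = 1 / sqrt ((norm (y - x))\<^sup>2 + e n)" for n y
  have kC1: "C1_on UNIV (k n)" and kb: "\<bar>fd (k n) y v\<bar> \<le> norm v / (norm (y - x))\<^sup>2" for n y v
    unfolding k_def using regularised_kernel[OF e[of n], of x] by auto
  have Fm: "(\<lambda>y. F y $ i) \<in> borel_measurable borel" for i by (rule borel_measurable_continuous_onI[OF C1_on_continuous[OF F]])
  \<comment> \<open>The right-hand side is a nonnegative integral, meaningful without integrability,
    and it does not involve \<open>n\<close>.\<close>
  have bound: "ennreal (norm (\<integral>y. k n y *\<^sub>R cdiv F y \<partial>lborel)) \<le> ?R" for n
  proof -
    have int: "integrable lborel (\<lambda>y. k n y *\<^sub>R fd (\<lambda>y. F y $ i) y (axis i 1))"
      "integrable lborel (\<lambda>y. fd (k n) y (axis i 1) *\<^sub>R (F y $ i))"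
      "(\<integral>y. k n y *\<^sub>R fd (\<lambda>y. F y $ i) y (axis i 1) \<partial>lborel) = - (\<integral>y. fd (k n) y (axis i 1) *\<^sub>R (F y $ i) \<partial>lborel)"
      for i
      using integral_by_parts_fd[OF bounded_bilinear_scaleR kC1 F K(1) Fi0] by auto
    have "(\<integral>y. k n y *\<^sub>R cdiv F y \<partial>lborel) = (\<Sum>i\<in>UNIV. \<integral>y. k n y *\<^sub>R fd (\<lambda>y. F y $ i) y (axis i 1) \<partial>lborel)"
      unfolding cdiv_def scaleR_sum_right using int(1) by (intro Bochner_Integration.integral_sum) auto
    also have "\<dots> = - (\<integral>y. (\<Sum>i\<in>UNIV. fd (k n) y (axis i 1) *\<^sub>R (F y $ i)) \<partial>lborel)"
      using int by (simp add: sum_negf Bochner_Integration.integral_sum)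
    finally have "norm (\<integral>y. k n y *\<^sub>R cdiv F y \<partial>lborel) = norm (\<integral>y. (\<Sum>i\<in>UNIV. fd (k n) y (axis i 1) *\<^sub>R (F y $ i)) \<partial>lborel)"
      by simp
    also have "ennreal \<dots> \<le> (\<integral>\<^sup>+y. norm (\<Sum>i\<in>UNIV. fd (k n) y (axis i 1) *\<^sub>R (F y $ i)) \<partial>lborel)"
      using int(2) by (intro integral_norm_bound_ennreal Bochner_Integration.integrable_sum) auto
    also have "\<dots> \<le> ?R"
    proof (intro nn_integral_mono ennreal_leI)
      fix y
      have "norm (\<Sum>i\<in>UNIV. fd (k n) y (axis i 1) *\<^sub>R (F y $ i)) \<le> (\<Sum>i\<in>UNIV. norm (F y $ i) / (dist x y)\<^sup>2)"
      proof (rule sum_norm_le)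
        fix i :: 3
        have "\<bar>fd (k n) y (axis i 1)\<bar> \<le> 1 / (dist x y)\<^sup>2"
          using kb[of n y "axis i 1"] by (simp add: dist_norm norm_minus_commute norm_axis_1)
        then have "\<bar>fd (k n) y (axis i 1)\<bar> * norm (F y $ i) \<le> 1 / (dist x y)\<^sup>2 * norm (F y $ i)"
          by (intro mult_right_mono) auto
        then show "norm (fd (k n) y (axis i 1) *\<^sub>R (F y $ i)) \<le> norm (F y $ i) / (dist x y)\<^sup>2" by simp
      qed
      then show "norm (\<Sum>i\<in>UNIV. fd (k n) y (axis i 1) *\<^sub>R (F y $ i)) \<le> (\<Sum>i\<in>UNIV. norm (F y $ i)) / (dist x y)\<^sup>2"
        by (simp add: sum_divide_distrib)
    qed
    finally show ?thesis .
  qed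
  have "(\<lambda>n. \<integral>y. k n y *\<^sub>R cdiv F y \<partial>lborel) \<longlonglongrightarrow> (\<integral>y. (1 / dist x y) *\<^sub>R cdiv F y \<partial>lborel)"
  \<comment> \<open>Regularisation lowers the kernel, so the unregularised integrand is itself the
    majorant.\<close>
  proof (rule integral_dominated_convergence[where w="\<lambda>y. norm ((1 / dist x y) *\<^sub>R cdiv F y)"])
    have cm: "cdiv F \<in> borel_measurable borel" by (rule borel_measurable_continuous_onI[OF cdivc])
    show "(\<lambda>y. (1 / dist x y) *\<^sub>R cdiv F y) \<in> borel_measurable lborel" using cm by measurable
    show "(\<lambda>y. k n y *\<^sub>R cdiv F y) \<in> borel_measurable lborel" for n
      using cm borel_measurable_continuous_onI[OF C1_on_continuous[OF kC1]] by measurable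
    have "integrable lborel (\<lambda>y. (1 / dist x y) *\<^sub>R cdiv F y)"
      using newton_integrable[OF cm B r div0, of x]
        lborel_integral_shift(2)[of "\<lambda>y. (1 / dist x y) *\<^sub>R cdiv F y" x] by (simp add: dist_norm)
    then show "integrable lborel (\<lambda>y. norm ((1 / dist x y) *\<^sub>R cdiv F y))" by (rule Bochner_Integration.integrable_norm)
    have ne: "AE y in lborel. y \<noteq> x" by (rule AE_lborel_singleton)
    show "AE y in lborel. (\<lambda>n. k n y *\<^sub>R cdiv F y) \<longlonglongrightarrow> (1 / dist x y) *\<^sub>R cdiv F y"
      using ne
    proof (rule AE_mp, intro AE_I2 impI)
      fix y assume "y \<noteq> x"
      then have "(\<lambda>n. 1 / sqrt ((norm (y - x))\<^sup>2 + e n)) \<longlonglongrightarrow> 1 / sqrt ((norm (y - x))\<^sup>2 + 0)"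
        by (intro tendsto_intros e0) auto
      then have "(\<lambda>n. k n y) \<longlonglongrightarrow> 1 / dist x y" by (simp add: k_def dist_norm norm_minus_commute)
      then show "(\<lambda>n. k n y *\<^sub>R cdiv F y) \<longlonglongrightarrow> (1 / dist x y) *\<^sub>R cdiv F y" by (intro tendsto_intros)
    qed
    show "AE y in lborel. norm (k n y *\<^sub>R cdiv F y) \<le> norm ((1 / dist x y) *\<^sub>R cdiv F y)" for n
      using ne
    proof (rule AE_mp, intro AE_I2 impI)
      fix y assume y: "y \<noteq> x"
      have "dist x y \<le> sqrt ((norm (y - x))\<^sup>2 + e n)"
        using e[of n] by (intro real_le_rsqrt) (simp add: dist_norm norm_minus_commute)
      then have "k n y \<le> 1 / dist x y" using y unfolding k_def by (intro frac_le) auto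
      moreover have "k n y \<ge> 0" using e[of n] by (simp add: k_def)
      ultimately show "norm (k n y *\<^sub>R cdiv F y) \<le> norm ((1 / dist x y) *\<^sub>R cdiv F y)"
        unfolding norm_scaleR by (intro mult_right_mono) auto
    qed
  qed
  then have "(\<lambda>n. ennreal (norm (\<integral>y. k n y *\<^sub>R cdiv F y \<partial>lborel))) \<longlonglongrightarrow> ennreal (norm (\<integral>y. (1 / dist x y) *\<^sub>R cdiv F y \<partial>lborel))"
    by (intro tendsto_ennrealI tendsto_norm)
  from LIMSEQ_le_const2[OF this] show ?thesis using bound by blast
qed

text \<open>Schur test for the kernel \<open>1 / |x - y|\<^sup>2\<close>, with the weighted arithmetic-geometric mean inequality in place of
  the Cauchy-Schwarz inequality.\<close>

lemma nn_integral_schur: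
  fixes a b :: "real^3 \<Rightarrow> real"
  assumes a: "a \<in> borel_measurable borel" "\<And>x. a x \<ge> 0" and b: "b \<in> borel_measurable borel" "\<And>x. b x \<ge> 0"
    and supp: "\<And>x. x \<notin> ball 0 R \<Longrightarrow> a x = 0" "\<And>x. x \<notin> ball 0 R \<Longrightarrow> b x = 0" and l: "l > 0"
  defines "M \<equiv> \<integral>\<^sup>+z. ennreal (indicator (ball 0 (2 * R)) (z::real^3) * (1 / (norm z)\<^sup>2)) \<partial>lborel"
  shows "(\<integral>\<^sup>+x. \<integral>\<^sup>+y. ennreal (a y * b x / (dist x y)\<^sup>2) \<partial>lborel \<partial>lborel)
     \<le> M * (ennreal l * (\<integral>\<^sup>+y. ennreal ((a y)\<^sup>2) \<partial>lborel) + ennreal (1 / l) * (\<integral>\<^sup>+x. ennreal ((b x)\<^sup>2) \<partial>lborel))"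
proof -
  define w where "w z = indicator (ball 0 (2 * R)) (z::real^3) * (1 / (norm z)\<^sup>2)" for z
  have w0: "w z \<ge> 0" for z by (simp add: w_def)
  have wm: "w \<in> borel_measurable borel"
    unfolding w_def by (intro borel_measurable_times borel_measurable_indicator borel_measurable_divide
          borel_measurable_power borel_measurable_norm) auto
  have s: "(\<lambda>y. w (x - y)) \<in> borel_measurable borel" "(\<lambda>y. w (y - x)) \<in> borel_measurable borel" for x
    by (rule measurable_compose[OF _ wm], simp)+
  have wM: "(\<integral>\<^sup>+y. ennreal (w (y - x)) \<partial>lborel) = M" for x
  proof -
    have "(\<integral>\<^sup>+y. ennreal (w (y - x)) \<partial>lborel) = (\<integral>\<^sup>+y. ennreal (w (y - x)) \<partial>(distr lborel borel ((+) x)))"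
      by (simp add: lborel_distr_plus)
    also have "\<dots> = (\<integral>\<^sup>+z. ennreal (w (x + z - x)) \<partial>lborel)"
      using s by (intro nn_integral_distr) auto
    finally show ?thesis by (simp add: M_def w_def)
  qed
  have w_sym: "w (x - y) = w (y - x)" for x y by (simp add: w_def norm_minus_commute indicator_def)
  have pt: "ennreal (a y * b x / (dist x y)\<^sup>2)
      \<le> ennreal l * ennreal ((a y)\<^sup>2) * ennreal (w (x - y)) + ennreal (1 / l) * ennreal ((b x)\<^sup>2) * ennreal (w (y - x))" for x y
  proof (cases "x \<in> ball 0 R \<and> y \<in> ball 0 R")
    case False
    then have "a y * b x = 0" using supp by auto
    then have z: "a y * b x / (dist x y)\<^sup>2 = 0" by (simp only: div_0)
    show ?thesis unfolding z by simp
  next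
    case True
    then have "norm (x - y) < 2 * R" using norm_triangle_ineq4[of x y] by simp
    \<comment> \<open>Points of the ball are less than \<open>2 * R\<close> apart, so the kernel may
      be replaced by the truncation \<open>w\<close>, whose total mass is \<open>M\<close> around
      any centre.\<close>
    then have weq: "1 / (dist x y)\<^sup>2 = w (x - y)" by (simp add: w_def dist_norm indicator_def norm_minus_commute)
    have "2 * (sqrt l * a y) * (b x / sqrt l) \<le> (sqrt l * a y)\<^sup>2 + (b x / sqrt l)\<^sup>2"
      using sum_squares_bound by blast
    then have "2 * (a y * b x) \<le> l * (a y)\<^sup>2 + (1 / l) * (b x)\<^sup>2"
      using l by (simp add: power_mult_distrib power_divide)
    moreover have "0 \<le> a y * b x" using a b by simp
    ultimately have "a y * b x \<le> l * (a y)\<^sup>2 + (1 / l) * (b x)\<^sup>2" by linarith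
    then have "a y * b x * w (x - y) \<le> (l * (a y)\<^sup>2 + (1 / l) * (b x)\<^sup>2) * w (x - y)"
      by (intro mult_right_mono w0)
    then have "a y * b x / (dist x y)\<^sup>2 \<le> l * (a y)\<^sup>2 * w (x - y) + (1 / l) * (b x)\<^sup>2 * w (y - x)"
      using weq w_sym[of x y] by (simp add: algebra_simps divide_inverse)
    then have "ennreal (a y * b x / (dist x y)\<^sup>2) \<le> ennreal (l * (a y)\<^sup>2 * w (x - y) + (1 / l) * (b x)\<^sup>2 * w (y - x))"
      by (rule ennreal_leI)
    also have "\<dots> = ennreal l * ennreal ((a y)\<^sup>2) * ennreal (w (x - y)) + ennreal (1 / l) * ennreal ((b x)\<^sup>2) * ennreal (w (y - x))"
    proof -
      have gen: "ennreal (p * A * W + c * B * W') = ennreal p * ennreal A * ennreal W + ennreal c * ennreal B * ennreal W'"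
        if "p \<ge> 0" "A \<ge> 0" "W \<ge> 0" "c \<ge> 0" "B \<ge> 0" "W' \<ge> 0" for p A W c B W' :: real
        using that by (simp add: ennreal_plus ennreal_mult)
      show ?thesis by (rule gen) (use l w0 in auto)
    qed
    finally show ?thesis .
  qed
  have m1: "(\<lambda>(x, y). ennreal l * ennreal ((a y)\<^sup>2) * ennreal (w (x - y))) \<in> borel_measurable (lborel \<Otimes>\<^sub>M lborel)"
    and m2: "(\<lambda>(x, y). ennreal (1 / l) * ennreal ((b x)\<^sup>2) * ennreal (w (y - x))) \<in> borel_measurable (lborel \<Otimes>\<^sub>M lborel)"
    unfolding split_beta using a(1) b(1) wm by measurable
  have "(\<integral>\<^sup>+x. \<integral>\<^sup>+y. ennreal (a y * b x / (dist x y)\<^sup>2) \<partial>lborel \<partial>lborel)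
     \<le> (\<integral>\<^sup>+x. \<integral>\<^sup>+y. ennreal l * ennreal ((a y)\<^sup>2) * ennreal (w (x - y)) + ennreal (1 / l) * ennreal ((b x)\<^sup>2) * ennreal (w (y - x)) \<partial>lborel \<partial>lborel)"
    by (intro nn_integral_mono pt)
  also have "\<dots> = (\<integral>\<^sup>+x. (\<integral>\<^sup>+y. ennreal l * ennreal ((a y)\<^sup>2) * ennreal (w (x - y)) \<partial>lborel)
       + (\<integral>\<^sup>+y. ennreal (1 / l) * ennreal ((b x)\<^sup>2) * ennreal (w (y - x)) \<partial>lborel) \<partial>lborel)"
    using a(1) b(1) s
    by (intro nn_integral_cong nn_integral_add borel_measurable_times_ennreal borel_measurable_const
        measurable_compose[OF _ measurable_ennreal] borel_measurable_power) auto
  also have "\<dots> = (\<integral>\<^sup>+x. \<integral>\<^sup>+y. ennreal l * ennreal ((a y)\<^sup>2) * ennreal (w (x - y)) \<partial>lborel \<partial>lborel)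
       + (\<integral>\<^sup>+x. \<integral>\<^sup>+y. ennreal (1 / l) * ennreal ((b x)\<^sup>2) * ennreal (w (y - x)) \<partial>lborel \<partial>lborel)"
    using lborel.borel_measurable_nn_integral_fst[OF m1] lborel.borel_measurable_nn_integral_fst[OF m2]
    by (intro nn_integral_add) auto
  also have "(\<integral>\<^sup>+x. \<integral>\<^sup>+y. ennreal (1 / l) * ennreal ((b x)\<^sup>2) * ennreal (w (y - x)) \<partial>lborel \<partial>lborel)
      = ennreal (1 / l) * (\<integral>\<^sup>+x. ennreal ((b x)\<^sup>2) \<partial>lborel) * M"
    using b(1) s by (simp add: nn_integral_cmult wM nn_integral_multc)
  \<comment> \<open>In the \<open>a\<close>-part the kernel has to be integrated over
    \<open>x\<close> first, hence the exchange of order.\<close>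
  also have "(\<integral>\<^sup>+x. \<integral>\<^sup>+y. ennreal l * ennreal ((a y)\<^sup>2) * ennreal (w (x - y)) \<partial>lborel \<partial>lborel)
      = (\<integral>\<^sup>+y. \<integral>\<^sup>+x. ennreal l * ennreal ((a y)\<^sup>2) * ennreal (w (x - y)) \<partial>lborel \<partial>lborel)"
    by (rule lborel_pair.Fubini'[OF m1, symmetric])
  also have "\<dots> = ennreal l * (\<integral>\<^sup>+y. ennreal ((a y)\<^sup>2) \<partial>lborel) * M"
    using a(1) s by (simp add: nn_integral_cmult wM nn_integral_multc)
  finally show ?thesis by (simp add: distrib_left mult_ac)
qed

text \<open>The constant depends on \<open>R\<close> alone while \<open>l\<close> stays free, so the
  share of the divergence can be made as small as required, uniformly in \<open>F\<close>.\<close>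

lemma Kop_div_pairing_bound:
  assumes R: "R > 0"
  shows "\<exists>C\<ge>0. \<forall>F :: real^3 \<Rightarrow> complex^3. \<forall>K l. (\<forall>i. C1_on UNIV (\<lambda>y. F y $ i)) \<longrightarrow> compact K \<longrightarrow> K \<subseteq> ball 0 R \<longrightarrow>
     (\<forall>x. x \<notin> K \<longrightarrow> F x = 0) \<longrightarrow> l > 0 \<longrightarrow>
     norm (\<integral>x. Kop (cdiv F) x * cnj (cdiv F x) \<partial>lborel)
       \<le> C * (l * (\<integral>y. (norm (F y))\<^sup>2 \<partial>lborel) + (1 / l) * (\<integral>x. (norm (cdiv F x))\<^sup>2 \<partial>lborel))"
proof -
  define m where "m = (\<integral>z. indicator (ball 0 (2 * R)) (z::real^3) * (1 / (norm z)\<^sup>2) \<partial>lborel)"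
  have M: "(\<integral>\<^sup>+z. ennreal (indicator (ball 0 (2 * R)) (z::real^3) * (1 / (norm z)\<^sup>2)) \<partial>lborel) = ennreal m"
    unfolding m_def by (intro nn_integral_eq_integral integrable_inverse_norm_square) auto
  have m0: "m \<ge> 0" unfolding m_def by (intro integral_nonneg_AE) auto
  show ?thesis
  \<comment> \<open>The 9 is the square of 3: the sum of the three component norms is at most
    \<open>3 * norm (F y)\<close>. It is put on both terms to have a common constant.\<close>
  proof (intro exI[of _ "9 * m"] conjI allI impI)
    show "0 \<le> 9 * m" using m0 by simp
    fix F :: "real^3 \<Rightarrow> complex^3" and K and l :: real
    assume F: "\<forall>i. C1_on UNIV (\<lambda>y. F y $ i)" and K: "compact K" "K \<subseteq> ball 0 R" and F0: "\<forall>x. x \<notin> K \<longrightarrow> F x = 0" and l: "l > 0"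
    define g where "g = cdiv F"
    define a where "a y = (\<Sum>i\<in>UNIV. norm (F y $ i))" for y
    define b where "b x = norm (g x)" for x
    have Fc: "continuous_on UNIV (\<lambda>y. F y $ i)" for i using F by (auto intro: C1_on_continuous)
    have Fcc: "continuous_on UNIV F"
    proof -
      have "continuous_on UNIV (\<lambda>y. \<chi> i. F y $ i)" by (intro continuous_on_vec_lambda Fc)
      then show ?thesis by simp
    qed
    have gc: "continuous_on UNIV g"
      unfolding g_def cdiv_def using F by (intro continuous_intros C1_on_fd_continuous) auto
    have g0: "g y = 0" if "y \<notin> K" for y
    proof -
      have "fd (\<lambda>y. F y $ i) y v = 0" for i v
        using F0 by (intro fd_zero_outside[OF compact_imp_closed[OF K(1)] _ that]) auto
      then show ?thesis by (simp add: g_def cdiv_def)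
    qed
    have ac: "continuous_on UNIV a" unfolding a_def by (intro continuous_intros Fc)
    have bc: "continuous_on UNIV b" unfolding b_def by (intro continuous_intros gc)
    have a0: "a y = 0" if "y \<notin> K" for y using F0 that by (simp add: a_def)
    have int: "integrable lborel (\<lambda>y. (norm (F y))\<^sup>2)" "integrable lborel (\<lambda>y. (b y)\<^sup>2)"
      using F0 g0 by (auto intro!: integrable_continuous_compact_support[OF _ K(1)] continuous_intros Fcc gc simp: b_def)
    have anorm: "a y \<le> 3 * norm (F y)" for y
      unfolding a_def using sum_bounded_above[of UNIV "\<lambda>i. norm (F y $ i)" "norm (F y)"] Finite_Cartesian_Product.norm_nth_le[of "F y"]
      by simp
    have "(\<integral>\<^sup>+y. ennreal ((a y)\<^sup>2) \<partial>lborel) \<le> (\<integral>\<^sup>+y. ennreal (9 * (norm (F y))\<^sup>2) \<partial>lborel)"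
    proof (intro nn_integral_mono ennreal_leI)
      fix y
      have "(a y)\<^sup>2 \<le> (3 * norm (F y))\<^sup>2"
        using anorm[of y] by (intro power_mono) (auto simp: a_def intro!: sum_nonneg)
      then show "(a y)\<^sup>2 \<le> 9 * (norm (F y))\<^sup>2" by (simp add: power_mult_distrib)
    qed
    also have "\<dots> = ennreal (9 * (\<integral>y. (norm (F y))\<^sup>2 \<partial>lborel))"
      using int(1) by (subst nn_integral_eq_integral) auto
    finally have A: "(\<integral>\<^sup>+y. ennreal ((a y)\<^sup>2) \<partial>lborel) \<le> ennreal (9 * (\<integral>y. (norm (F y))\<^sup>2 \<partial>lborel))" .
    have Bq: "(\<integral>\<^sup>+y. ennreal ((b y)\<^sup>2) \<partial>lborel) = ennreal (\<integral>y. (b y)\<^sup>2 \<partial>lborel)"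
      using int(2) by (intro nn_integral_eq_integral) auto
    have KC: "continuous_on UNIV (Kop g)"
      unfolding Kop_eq_newton[abs_def] by (intro continuous_intros newton_continuous[OF gc K(1) g0])
    have "ennreal (norm (\<integral>x. Kop g x * cnj (g x) \<partial>lborel)) \<le> (\<integral>\<^sup>+x. norm (Kop g x * cnj (g x)) \<partial>lborel)"
      using g0 by (intro integral_norm_bound_ennreal integrable_continuous_compact_support[OF _ K(1)] continuous_intros KC gc) auto
    also have "\<dots> \<le> (\<integral>\<^sup>+x. \<integral>\<^sup>+y. ennreal (a y * b x / (dist x y)\<^sup>2) \<partial>lborel \<partial>lborel)"
    proof (intro nn_integral_mono)
      fix x
      let ?I = "\<integral>y. (1 / dist x y) *\<^sub>R g y \<partial>lborel"
      \<comment> \<open>The normalising factor \<open>1 / (4 * pi)\<close> of \<open>Kop\<close> is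
        at most 1 and is estimated away.\<close>
      have "1 \<le> 4 * pi" using pi_gt3 by simp
      then have "norm (Kop g x) \<le> norm ?I" unfolding Kop_def
        using mult_left_mono[OF \<open>1 \<le> 4 * pi\<close>, of "norm ?I"] by (simp add: divide_le_eq)
      then have "ennreal (norm (Kop g x * cnj (g x))) \<le> ennreal (norm ?I) * ennreal (b x)"
        by (simp add: norm_mult b_def mult_right_mono ennreal_leI flip: ennreal_mult)
      also have "\<dots> \<le> (\<integral>\<^sup>+y. ennreal (a y / (dist x y)\<^sup>2) \<partial>lborel) * ennreal (b x)"
        using Kop_div_pointwise[of F K x] F K F0 by (intro mult_right_mono) (auto simp: g_def a_def)
      also have "\<dots> = (\<integral>\<^sup>+y. ennreal (a y / (dist x y)\<^sup>2) * ennreal (b x) \<partial>lborel)"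
        using borel_measurable_continuous_onI[OF ac]
        by (intro nn_integral_multc[symmetric] measurable_compose[OF _ measurable_ennreal]
            borel_measurable_divide borel_measurable_power borel_measurable_dist) auto
      also have "\<dots> = (\<integral>\<^sup>+y. ennreal (a y * b x / (dist x y)\<^sup>2) \<partial>lborel)"
      proof (rule nn_integral_cong)
        fix y
        have "a y \<ge> 0" "b x \<ge> 0" by (auto simp: a_def b_def intro!: sum_nonneg)
        then show "ennreal (a y / (dist x y)\<^sup>2) * ennreal (b x) = ennreal (a y * b x / (dist x y)\<^sup>2)"
          by (subst ennreal_mult[symmetric]) auto
      qed
      finally show "ennreal (norm (Kop g x * cnj (g x))) \<le> (\<integral>\<^sup>+y. ennreal (a y * b x / (dist x y)\<^sup>2) \<partial>lborel)" .
    qed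
    also have "\<dots> \<le> ennreal m * (ennreal l * (\<integral>\<^sup>+y. ennreal ((a y)\<^sup>2) \<partial>lborel) + ennreal (1 / l) * (\<integral>\<^sup>+x. ennreal ((b x)\<^sup>2) \<partial>lborel))"
      unfolding M[symmetric]
    proof (rule nn_integral_schur)
      show "a \<in> borel_measurable borel" "b \<in> borel_measurable borel" using ac bc by (auto intro: borel_measurable_continuous_onI)
      show "a x \<ge> 0" "b x \<ge> 0" for x by (auto simp: a_def b_def intro!: sum_nonneg)
      show "a x = 0" "b x = 0" if "x \<notin> ball 0 R" for x
      proof -
        have "x \<notin> K" using K(2) that by blast
        then show "a x = 0" "b x = 0" using a0 g0 by (auto simp: b_def)
      qed
    qed (rule l)
    also have "\<dots> \<le> ennreal m * (ennreal l * ennreal (9 * (\<integral>y. (norm (F y))\<^sup>2 \<partial>lborel)) + ennreal (1 / l) * ennreal (\<integral>y. (b y)\<^sup>2 \<partial>lborel))"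
      unfolding Bq by (intro mult_left_mono add_right_mono A) auto
    also have "\<dots> = ennreal (m * (l * (9 * (\<integral>y. (norm (F y))\<^sup>2 \<partial>lborel)) + (1 / l) * (\<integral>y. (b y)\<^sup>2 \<partial>lborel)))"
    proof -
      have gen: "ennreal m * (ennreal l * ennreal A + ennreal c * ennreal B') = ennreal (m * (l * A + c * B'))"
        if "A \<ge> 0" "c \<ge> 0" "B' \<ge> 0" for A c B'
        using that l m0 by (simp add: ennreal_mult ennreal_plus)
      show ?thesis by (rule gen) (use l in \<open>auto intro!: mult_nonneg_nonneg integral_nonneg_AE\<close>)
    qed
    finally have "norm (\<integral>x. Kop g x * cnj (g x) \<partial>lborel) \<le> m * (l * (9 * (\<integral>y. (norm (F y))\<^sup>2 \<partial>lborel)) + (1 / l) * (\<integral>y. (b y)\<^sup>2 \<partial>lborel))"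
      using l m0 by (subst (asm) ennreal_le_iff) (auto intro!: mult_nonneg_nonneg add_nonneg_nonneg integral_nonneg_AE)
    also have "\<dots> \<le> m * (l * (9 * (\<integral>y. (norm (F y))\<^sup>2 \<partial>lborel)) + 9 * ((1 / l) * (\<integral>y. (b y)\<^sup>2 \<partial>lborel)))"
    proof -
      have "0 \<le> (1 / l) * (\<integral>y. (b y)\<^sup>2 \<partial>lborel)" using l by (intro mult_nonneg_nonneg integral_nonneg_AE) auto
      then show ?thesis using m0 by (intro mult_left_mono add_left_mono) auto
    qed
    also have "\<dots> = 9 * m * (l * (\<integral>y. (norm (F y))\<^sup>2 \<partial>lborel) + (1 / l) * (\<integral>y. (b y)\<^sup>2 \<partial>lborel))"
      by (simp add: algebra_simps)
    finally show "norm (\<integral>x. Kop (cdiv F) x * cnj (cdiv F x) \<partial>lborel)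
       \<le> 9 * m * (l * (\<integral>y. (norm (F y))\<^sup>2 \<partial>lborel) + (1 / l) * (\<integral>x. (norm (cdiv F x))\<^sup>2 \<partial>lborel))"
      by (simp add: g_def b_def)
  qed
qed

subsection \<open>Square-integrable functions\<close>

lemma norm_add_sq_le: "(norm (a + b))\<^sup>2 \<le> 2 * (norm a)\<^sup>2 + 2 * (norm b)\<^sup>2"
proof -
  have "(norm (a + b))\<^sup>2 \<le> (norm a + norm b)\<^sup>2" by (intro power_mono norm_triangle_ineq) auto
  also have "\<dots> \<le> 2 * (norm a)\<^sup>2 + 2 * (norm b)\<^sup>2"
    using sum_squares_bound[of "norm a" "norm b"] by (simp add: power2_sum)
  finally show ?thesis .
qed

text \<open>The squared norm with values in \<open>ennreal\<close>, so that membership is finiteness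
  and limits need no integrability conditions; \<open>l2_add\<close> with its factors 2 stands in
  for the triangle inequality.\<close>

definition l2 :: "'a measure \<Rightarrow> ('a \<Rightarrow> 'b::real_normed_vector) \<Rightarrow> ennreal" where
  "l2 M f = (\<integral>\<^sup>+x. ennreal ((norm (f x))\<^sup>2) \<partial>M)"

lemma l2_cong_AE: "AE x in M. f x = g x \<Longrightarrow> l2 M f = l2 M g"
  unfolding l2_def by (intro nn_integral_cong_AE) auto

lemma l2_mono: "(\<And>x. x \<in> space M \<Longrightarrow> norm (f x) \<le> norm (g x)) \<Longrightarrow> l2 M f \<le> l2 M g"
  unfolding l2_def by (intro nn_integral_mono ennreal_leI power_mono) auto

lemma l2_add:
  fixes f g :: "'a \<Rightarrow> 'b::{real_normed_vector, second_countable_topology}"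
  assumes [measurable]: "f \<in> borel_measurable M" "g \<in> borel_measurable M"
  shows "l2 M (\<lambda>x. f x + g x) \<le> 2 * l2 M f + 2 * l2 M g"
proof -
  have "l2 M (\<lambda>x. f x + g x) \<le> (\<integral>\<^sup>+x. 2 * ennreal ((norm (f x))\<^sup>2) + 2 * ennreal ((norm (g x))\<^sup>2) \<partial>M)"
    unfolding l2_def
  proof (intro nn_integral_mono)
    fix x
    have "ennreal ((norm (f x + g x))\<^sup>2) \<le> ennreal (2 * (norm (f x))\<^sup>2 + 2 * (norm (g x))\<^sup>2)"
      by (intro ennreal_leI norm_add_sq_le)
    also have "\<dots> = 2 * ennreal ((norm (f x))\<^sup>2) + 2 * ennreal ((norm (g x))\<^sup>2)"
      by (simp add: ennreal_plus ennreal_mult)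
    finally show "ennreal ((norm (f x + g x))\<^sup>2) \<le> 2 * ennreal ((norm (f x))\<^sup>2) + 2 * ennreal ((norm (g x))\<^sup>2)" .
  qed
  also have "\<dots> = 2 * l2 M f + 2 * l2 M g"
    unfolding l2_def by (simp add: nn_integral_add nn_integral_cmult)
  finally show ?thesis .
qed

lemma l2_minus_commute: "l2 M (\<lambda>x. f x - g x) = l2 M (\<lambda>x. g x - f x)"
  unfolding l2_def by (simp add: norm_minus_commute)

lemma ennreal_le_suminf: "F k \<le> (\<Sum>k. F k)" for F :: "nat \<Rightarrow> ennreal"
  using sum_le_suminf[of F "{k}"] by simp

text \<open>Along a subsequence with \<open>\<parallel>f\<^sub>k\<^sub>+\<^sub>1 - f\<^sub>k\<parallel>\<^sup>2 \<le> 16\<^sup>-\<^sup>k\<close> the function \<open>\<Sum>k. 4\<^sup>k |f\<^sub>k\<^sub>+\<^sub>1 - f\<^sub>k|\<^sup>2\<close> is integrable,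
  so the increments are pointwise a.e. bounded by a constant times \<open>2\<^sup>-\<^sup>k\<close>.\<close>

lemma l2_complete:
  fixes f :: "nat \<Rightarrow> 'a \<Rightarrow> 'b::{banach, second_countable_topology}"
  assumes m: "\<And>n. f n \<in> borel_measurable M"
    and C: "\<And>e. e > 0 \<Longrightarrow> \<exists>N. \<forall>m\<ge>N. \<forall>n\<ge>N. l2 M (\<lambda>x. f m x - f n x) \<le> ennreal e"
  shows "\<exists>g\<in>borel_measurable M. \<forall>e>0. \<exists>N. \<forall>n\<ge>N. l2 M (\<lambda>x. f n x - g x) \<le> ennreal e"
proof -
  have "\<forall>k. \<exists>N. \<forall>m\<ge>N. \<forall>n\<ge>N. l2 M (\<lambda>x. f m x - f n x) \<le> ennreal ((1/16) ^ k)"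
    using C by simp
  from choice[OF this] obtain N where N: "\<And>k m n. m \<ge> N k \<Longrightarrow> n \<ge> N k \<Longrightarrow> l2 M (\<lambda>x. f m x - f n x) \<le> ennreal ((1/16) ^ k)"
    by auto
  \<comment> \<open>Yields \<open>s k >= N k\<close>, \<open>s (Suc k) >= N k\<close> and
    \<open>s k >= k\<close> at once.\<close>
  define s where "s k = k + Max (N ` {..k})" for k
  have Max_le: "N k \<le> Max (N ` {..k})" for k by (intro Max_ge) auto
  have sN: "s k \<ge> N k" for k unfolding s_def using Max_le[of k] by linarith
  have Maxmono: "Max (N ` {..k}) \<le> Max (N ` {..Suc k})" for k by (intro Max_mono) auto
  have s_k: "s k \<ge> k" for k by (simp add: s_def)
  have sSN: "s (Suc k) \<ge> N k" for k using Max_le[of k] Maxmono[of k] unfolding s_def by linarith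
  define d where "d k x = f (s (Suc k)) x - f (s k) x" for k x
  have dm[measurable]: "d k \<in> borel_measurable M" for k unfolding d_def using m by measurable
  have dl: "l2 M (d k) \<le> ennreal ((1/16) ^ k)" for k
    unfolding d_def using N[OF sSN sN] .
  have "(\<integral>\<^sup>+x. (\<Sum>k. ennreal (4^k * (norm (d k x))\<^sup>2)) \<partial>M) = (\<Sum>k. \<integral>\<^sup>+x. ennreal (4^k * (norm (d k x))\<^sup>2) \<partial>M)"
    by (intro nn_integral_suminf) measurable
  also have "\<dots> \<le> (\<Sum>k. ennreal ((1/4) ^ k))"
  proof (intro suminf_le allI)
    fix k
    have "(\<integral>\<^sup>+x. ennreal (4^k * (norm (d k x))\<^sup>2) \<partial>M) = ennreal (4^k) * l2 M (d k)"
      unfolding l2_def by (subst nn_integral_cmult[symmetric]) (auto simp: ennreal_mult)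
    also have "\<dots> \<le> ennreal (4^k) * ennreal ((1/16) ^ k)" by (intro mult_left_mono dl) auto
    also have "\<dots> = ennreal ((1/4) ^ k)"
    proof -
      have "(4::real)^k * (1/16)^k = (1/4)^k" by (simp flip: power_mult_distrib)
      then show ?thesis by (simp flip: ennreal_mult)
    qed
    finally show "(\<integral>\<^sup>+x. ennreal (4^k * (norm (d k x))\<^sup>2) \<partial>M) \<le> ennreal ((1/4) ^ k)" .
  qed auto
  also have "\<dots> = ennreal (\<Sum>k. (1/4) ^ k)"
    by (intro suminf_ennreal2 summable_geometric) auto
  also have "\<dots> < \<infinity>" by simp
  finally have "(\<integral>\<^sup>+x. (\<Sum>k. ennreal (4^k * (norm (d k x))\<^sup>2)) \<partial>M) \<noteq> \<infinity>" by simp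
  then have "AE x in M. (\<Sum>k. ennreal (4^k * (norm (d k x))\<^sup>2)) \<noteq> \<infinity>"
    by (intro nn_integral_PInf_AE) measurable
  then have conv: "AE x in M. convergent (\<lambda>k. f (s k) x)"
  proof (rule AE_mp, intro AE_I2 impI)
    fix x assume fin: "(\<Sum>k. ennreal (4^k * (norm (d k x))\<^sup>2)) \<noteq> \<infinity>"
    define c where "c = enn2real (\<Sum>k. ennreal (4^k * (norm (d k x))\<^sup>2))"
    have c: "(\<Sum>k. ennreal (4^k * (norm (d k x))\<^sup>2)) = ennreal c" "c \<ge> 0"
      using fin by (auto simp: c_def top.not_eq_extremum)
    have b: "norm (d k x) \<le> sqrt c * (1/2) ^ k" for k
    proof -
      have "ennreal (4^k * (norm (d k x))\<^sup>2) \<le> (\<Sum>k. ennreal (4^k * (norm (d k x))\<^sup>2))"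
        by (rule ennreal_le_suminf)
      then have "4^k * (norm (d k x))\<^sup>2 \<le> c" unfolding c(1) using c(2) by (simp add: ennreal_le_iff)
      moreover have "((2::real)^k)\<^sup>2 = 4^k" by (simp add: power2_eq_square flip: power_mult_distrib)
      ultimately have "(2^k * norm (d k x))\<^sup>2 \<le> c" by (simp add: power_mult_distrib)
      then have "2^k * norm (d k x) \<le> sqrt c" by (rule real_le_rsqrt)
      then show ?thesis by (simp add: power_divide field_simps)
    qed
    have "summable (\<lambda>k. d k x)"
    proof (rule summable_comparison_test)
      show "\<exists>N. \<forall>n\<ge>N. norm (d n x) \<le> sqrt c * (1/2) ^ n" using b by blast
      show "summable (\<lambda>n. sqrt c * (1/2) ^ n)" by (intro summable_mult summable_geometric) auto
    qed
    then have "convergent (\<lambda>n. \<Sum>k<n. d k x)" by (simp add: summable_iff_convergent)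
    moreover have "(\<Sum>k<n. d k x) = f (s n) x - f (s 0) x" for n
      unfolding d_def by (rule sum_lessThan_telescope)
    ultimately have "convergent (\<lambda>n. (f (s n) x - f (s 0) x) + f (s 0) x)"
      by (intro convergent_add convergent_const) simp
    then show "convergent (\<lambda>k. f (s k) x)" by simp
  qed
  define g where "g x = lim (\<lambda>k. f (s k) x)" for x
  have gm: "g \<in> borel_measurable M"
    unfolding g_def using m by (intro borel_measurable_lim_metric)
  have lim: "AE x in M. (\<lambda>k. f (s k) x) \<longlonglongrightarrow> g x"
    using conv by (rule AE_mp) (auto simp: g_def convergent_LIMSEQ_iff)
  have "\<exists>N. \<forall>n\<ge>N. l2 M (\<lambda>x. f n x - g x) \<le> ennreal e" if "e > 0" for e
  proof -
    obtain N0 where N0: "\<And>m n. m \<ge> N0 \<Longrightarrow> n \<ge> N0 \<Longrightarrow> l2 M (\<lambda>x. f m x - f n x) \<le> ennreal e"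
      using C[OF \<open>e > 0\<close>] by auto
    have "l2 M (\<lambda>x. f n x - g x) \<le> ennreal e" if n: "n \<ge> N0" for n
    proof -
      \<comment> \<open>Fatou's lemma along the subsequence converts the Cauchy bound into a bound
        on the distance to the limit, for every late term of the full sequence.\<close>
      have "l2 M (\<lambda>x. f n x - g x) = (\<integral>\<^sup>+x. liminf (\<lambda>k. ennreal ((norm (f n x - f (s k) x))\<^sup>2)) \<partial>M)"
        unfolding l2_def
      proof (rule nn_integral_cong_AE, use lim in \<open>rule AE_mp\<close>, intro AE_I2 impI)
        fix x assume "(\<lambda>k. f (s k) x) \<longlonglongrightarrow> g x"
        then have "(\<lambda>k. ennreal ((norm (f n x - f (s k) x))\<^sup>2)) \<longlonglongrightarrow> ennreal ((norm (f n x - g x))\<^sup>2)"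
          by (intro tendsto_ennrealI tendsto_intros)
        then show "ennreal ((norm (f n x - g x))\<^sup>2) = liminf (\<lambda>k. ennreal ((norm (f n x - f (s k) x))\<^sup>2))"
          by (rule lim_imp_Liminf[OF sequentially_bot, symmetric])
      qed
      also have "\<dots> \<le> liminf (\<lambda>k. \<integral>\<^sup>+x. ennreal ((norm (f n x - f (s k) x))\<^sup>2) \<partial>M)"
        using m by (intro nn_integral_liminf) measurable
      also have "\<dots> \<le> ennreal e"
      proof (rule Liminf_le)
        show "\<forall>\<^sub>F k in sequentially. (\<integral>\<^sup>+x. ennreal ((norm (f n x - f (s k) x))\<^sup>2) \<partial>M) \<le> ennreal e"
          unfolding eventually_sequentially using N0[OF n] s_k unfolding l2_def
          by (intro exI[of _ N0]) (meson order_trans)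
      qed simp
      finally show ?thesis .
    qed
    then show ?thesis by blast
  qed
  then show ?thesis using gm by blast
qed

subsection \<open>Smooth bump functions\<close>

text \<open>\<open>bump_deriv k\<close> is the \<open>k\<close>-th derivative of \<open>exp (- 1 / t)\<close>, in the form \<open>p\<^sub>k (1 / t) exp (- 1 / t)\<close> with
  \<open>p\<^sub>k\<^sub>+\<^sub>1 (s) = s\<^sup>2 (p\<^sub>k (s) - p\<^sub>k' (s))\<close>.\<close>

fun bump_poly :: "nat \<Rightarrow> real poly" where
  "bump_poly 0 = 1"
| "bump_poly (Suc k) = [:0, 0, 1:] * (bump_poly k - pderiv (bump_poly k))"

definition bump_deriv :: "nat \<Rightarrow> real \<Rightarrow> real" where
  "bump_deriv k t = (if t > 0 then poly (bump_poly k) (1 / t) * exp (- (1 / t)) else 0)"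

lemma poly_mult_exp_minus_tendsto_0:
  fixes p :: "real poly"
  shows "((\<lambda>s. poly p s * exp (- s)) \<longlongrightarrow> 0) at_top"
proof -
  have "((\<lambda>s. \<Sum>i\<le>degree p. coeff p i * (s ^ i / exp s)) \<longlongrightarrow> (\<Sum>i\<le>degree p. coeff p i * 0)) at_top"
    by (intro tendsto_intros tendsto_power_div_exp_0)
  then show ?thesis
    by (simp add: poly_altdef sum_distrib_right exp_minus divide_inverse mult.assoc)
qed

lemma bump_deriv_has_derivative: "(bump_deriv k has_real_derivative bump_deriv (Suc k) t) (at t)"
proof -
  consider "t > 0" | "t < 0" | "t = 0" by linarith
  then show ?thesis
  proof cases
    case 1
    have "((\<lambda>t. poly (bump_poly k) (1 / t) * exp (- (1 / t))) has_real_derivative bump_deriv (Suc k) t) (at t)"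
      using 1
      by (auto intro!: derivative_eq_intros DERIV_chain2[OF poly_DERIV] simp: bump_deriv_def field_simps power2_eq_square)
    then show ?thesis
      by (rule has_field_derivative_transform_within_open[where S="{0<..}"]) (use 1 in \<open>auto simp: bump_deriv_def\<close>)
  next
    case 2
    have "((\<lambda>_. 0::real) has_real_derivative bump_deriv (Suc k) t) (at t)"
      using 2 by (simp add: bump_deriv_def)
    then show ?thesis
      by (rule has_field_derivative_transform_within_open[where S="{..<0}"]) (use 2 in \<open>auto simp: bump_deriv_def\<close>)
  next
    case 3
    have "((\<lambda>h. bump_deriv k h / h) \<longlongrightarrow> 0) (at_right 0)"
    proof -
      \<comment> \<open>The difference quotient at 0 has one more factor \<open>1 / h\<close>, which
        is the factor \<open>[:0, 1:]\<close> in the variable \<open>s = 1 / h\<close>.\<close>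
      have "((\<lambda>s. poly ([:0, 1:] * bump_poly k) s * exp (- s)) \<longlongrightarrow> 0) at_top"
        by (rule poly_mult_exp_minus_tendsto_0)
      from filterlim_compose[OF this filterlim_inverse_at_top_right]
      have "((\<lambda>h::real. poly ([:0, 1:] * bump_poly k) (inverse h) * exp (- inverse h)) \<longlongrightarrow> 0) (at_right 0)" .
      then show ?thesis
        by (rule Lim_transform_eventually)
          (auto simp: eventually_at_right_field bump_deriv_def field_simps intro!: exI[of _ 1])
    qed
    moreover have "((\<lambda>h. bump_deriv k h / h) \<longlongrightarrow> 0) (at_left 0)"
      by (rule Lim_transform_eventually[OF tendsto_const[of 0]])
        (auto simp: eventually_at_left_field bump_deriv_def intro!: exI[of _ "-1"])
    ultimately have "((\<lambda>h. bump_deriv k h / h) \<longlongrightarrow> 0) (at 0)" by (simp add: filterlim_split_at)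
    then show ?thesis using 3 by (simp add: has_field_derivative_iff bump_deriv_def)
  qed
qed

text \<open>A coinduction principle: iterated derivatives never leave a class that is closed under
  directional derivatives.\<close>

lemma smooth3_class:
  assumes c: "\<And>f. f \<in> A \<Longrightarrow> (\<forall>x. f differentiable (at x)) \<and> (\<forall>v. (\<lambda>x. fd f x v) \<in> A)" and f: "f \<in> A"
  shows "smooth3 f"
proof -
  have "dirderivs f vs \<in> A" for vs
    by (induction vs) (use f c in auto)
  then show ?thesis using c unfolding smooth3_def by blast
qed

lemma smooth3_linear:
  assumes L: "bounded_linear L" and f: "smooth3 f"
  shows "smooth3 (\<lambda>x. L (f x))"
proof -
  have d: "dirderivs f vs differentiable (at x)" for vs x using f by (simp add: smooth3_def)
  have LD: "((\<lambda>x. L (dirderivs f vs x)) has_derivative (\<lambda>v. L (fd (dirderivs f vs) x v))) (at x)" for vs x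
    by (rule bounded_linear.has_derivative[OF L]) (use d in \<open>simp add: frechet_derivative_works\<close>)
  have e: "dirderivs (\<lambda>x. L (f x)) vs = (\<lambda>x. L (dirderivs f vs x))" for vs
    by (induction vs) (simp_all add: fd_eq[OF LD])
  show ?thesis unfolding smooth3_def e using LD differentiable_def by blast
qed

lemma smooth3_add:
  assumes f: "smooth3 f" and g: "smooth3 g"
  shows "smooth3 (\<lambda>x. f x + g x)"
proof -
  have d: "dirderivs f vs differentiable (at x)" "dirderivs g vs differentiable (at x)" for vs x
    using f g by (auto simp: smooth3_def)
  have D: "((\<lambda>x. dirderivs f vs x + dirderivs g vs x) has_derivative
      (\<lambda>v. fd (dirderivs f vs) x v + fd (dirderivs g vs) x v)) (at x)" for vs x
    by (rule has_derivative_add) (use d in \<open>simp_all add: frechet_derivative_works\<close>)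
  have e: "dirderivs (\<lambda>x. f x + g x) vs = (\<lambda>x. dirderivs f vs x + dirderivs g vs x)" for vs
    by (induction vs) (simp_all add: fd_eq[OF D])
  show ?thesis unfolding smooth3_def e using D differentiable_def by blast
qed

lemma smooth3_const: "smooth3 (\<lambda>_. c)"
  by (rule smooth3_class[of "range (\<lambda>c _. c)"]) (auto simp: fd_const)

text \<open>Closed under differentiation because \<open>bump_deriv k\<close> differentiates to
  \<open>bump_deriv (Suc k)\<close>; smoothness then follows without computing any iterated
  derivative.\<close>

inductive_set bump_alg :: "(real^3 \<Rightarrow> real) set" where
  const: "(\<lambda>_. c) \<in> bump_alg"
| inner: "(\<lambda>x. x \<bullet> a) \<in> bump_alg"
| add: "f \<in> bump_alg \<Longrightarrow> g \<in> bump_alg \<Longrightarrow> (\<lambda>x. f x + g x) \<in> bump_alg"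
| mult: "f \<in> bump_alg \<Longrightarrow> g \<in> bump_alg \<Longrightarrow> (\<lambda>x. f x * g x) \<in> bump_alg"
| bump: "f \<in> bump_alg \<Longrightarrow> (\<lambda>x. bump_deriv k (f x)) \<in> bump_alg"

lemma bump_alg_derivative:
  "f \<in> bump_alg \<Longrightarrow> (\<exists>f'. (\<forall>x. (f has_derivative f' x) (at x)) \<and> (\<forall>v. (\<lambda>x. f' x v) \<in> bump_alg))"
proof (induction rule: bump_alg.induct)
  case (const c)
  show ?case by (intro exI[of _ "\<lambda>_ _. 0"]) (auto intro: bump_alg.const)
next
  case (inner a)
  show ?case by (intro exI[of _ "\<lambda>_ v. v \<bullet> a"]) (auto intro!: derivative_eq_intros bump_alg.const)
next
  case (add f g)
  then obtain f' g' where "\<And>x. (f has_derivative f' x) (at x)" "\<And>v. (\<lambda>x. f' x v) \<in> bump_alg"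
    "\<And>x. (g has_derivative g' x) (at x)" "\<And>v. (\<lambda>x. g' x v) \<in> bump_alg" by blast
  then show ?case by (intro exI[of _ "\<lambda>x v. f' x v + g' x v"]) (auto intro: has_derivative_add bump_alg.add)
next
  case (mult f g)
  then obtain f' g' where "\<And>x. (f has_derivative f' x) (at x)" "\<And>v. (\<lambda>x. f' x v) \<in> bump_alg"
    "\<And>x. (g has_derivative g' x) (at x)" "\<And>v. (\<lambda>x. g' x v) \<in> bump_alg" by blast
  then show ?case using mult.hyps
    by (intro exI[of _ "\<lambda>x v. f x * g' x v + f' x v * g x"])
      (auto intro!: has_derivative_mult bump_alg.add bump_alg.mult)
next
  case (bump f k)
  then obtain f' where f': "\<And>x. (f has_derivative f' x) (at x)" "\<And>v. (\<lambda>x. f' x v) \<in> bump_alg" by blast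
  have "((\<lambda>x. bump_deriv k (f x)) has_derivative (\<lambda>v. bump_deriv (Suc k) (f x) * f' x v)) (at x)" for x
    using has_derivative_compose[OF f'(1) has_field_derivative_imp_has_derivative[OF bump_deriv_has_derivative]] .
  then show ?case using bump.hyps f'(2)
    by (intro exI[of _ "\<lambda>x v. bump_deriv (Suc k) (f x) * f' x v"]) (auto intro: bump_alg.mult bump_alg.bump)
qed

lemma bump_alg_smooth3: "f \<in> bump_alg \<Longrightarrow> smooth3 f"
proof (rule smooth3_class[of bump_alg])
  fix f assume "f \<in> bump_alg"
  then obtain f' where f': "\<And>x. (f has_derivative f' x) (at x)" "\<And>v. (\<lambda>x. f' x v) \<in> bump_alg"
    using bump_alg_derivative by blast
  have "(\<lambda>x. fd f x v) = (\<lambda>x. f' x v)" for v using fd_eq[OF f'(1)] by auto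
  then show "(\<forall>x. f differentiable (at x)) \<and> (\<forall>v. (\<lambda>x. fd f x v) \<in> bump_alg)"
    using f' unfolding differentiable_def by auto
qed

lemma bump_alg_sum: "finite I \<Longrightarrow> (\<And>i. i \<in> I \<Longrightarrow> f i \<in> bump_alg) \<Longrightarrow> (\<lambda>x. \<Sum>i\<in>I. f i x) \<in> bump_alg"
  by (induction I rule: finite_induct) (auto intro: bump_alg.const bump_alg.add)

lemma bump_alg_prod: "finite I \<Longrightarrow> (\<And>i. i \<in> I \<Longrightarrow> f i \<in> bump_alg) \<Longrightarrow> (\<lambda>x. \<Prod>i\<in>I. f i x) \<in> bump_alg"
  by (induction I rule: finite_induct) (auto intro: bump_alg.const bump_alg.mult)

lemma bump_range: "0 \<le> bump_deriv 0 t" "bump_deriv 0 t \<le> 1"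
  by (auto simp: bump_deriv_def)

lemma bump_tendsto:
  assumes "t > 0" shows "(\<lambda>n. bump_deriv 0 (real (Suc n) * t - c)) \<longlonglongrightarrow> 1"
proof -
  have l: "filterlim (\<lambda>n. real (Suc n) * t - c) at_top sequentially"
    using assms by real_asymp
  have "((\<lambda>s::real. exp (- (1 / s))) \<longlongrightarrow> 1) at_top" by real_asymp
  from filterlim_compose[OF this l]
  have "(\<lambda>n. exp (- (1 / (real (Suc n) * t - c)))) \<longlonglongrightarrow> 1" .
  moreover have "\<forall>\<^sub>F n in sequentially. exp (- (1 / (real (Suc n) * t - c))) = bump_deriv 0 (real (Suc n) * t - c)"
    using filterlim_at_top_dense[THEN iffD1, OF l, rule_format, of 0]
    by eventually_elim (simp add: bump_deriv_def)
  ultimately show ?thesis by (rule Lim_transform_eventually)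
qed

text \<open>A smooth approximation of the indicator of ball and box. The \<open>- 1\<close> in the
  first factor keeps the support inside \<open>|x|^2 <= R^2 - 1 / (n + 1)\<close>, hence compact in
  the open ball. The box factors need no such margin; their \<open>- 0\<close> matches the shape of
  \<open>bump_tendsto\<close>.\<close>

definition box_bump :: "real \<Rightarrow> real^3 \<Rightarrow> real^3 \<Rightarrow> nat \<Rightarrow> real^3 \<Rightarrow> real" where
  "box_bump R a b n x = bump_deriv 0 (real (Suc n) * (R\<^sup>2 - (norm x)\<^sup>2) - 1) *
     (\<Prod>i\<in>Basis. bump_deriv 0 (real (Suc n) * (x \<bullet> i - a \<bullet> i) - 0) * bump_deriv 0 (real (Suc n) * (b \<bullet> i - x \<bullet> i) - 0))"

lemma box_bump_range: "0 \<le> box_bump R a b n x" "box_bump R a b n x \<le> 1"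
  unfolding box_bump_def
  by (auto intro!: mult_nonneg_nonneg prod_nonneg mult_le_one prod_le_1 bump_range)

lemma box_bump_smooth: "smooth3 (box_bump R a b n)"
proof -
  have e: "box_bump R a b n = (\<lambda>x. bump_deriv 0 ((real (Suc n) * R\<^sup>2 - 1) + (- real (Suc n)) * (\<Sum>i\<in>Basis. (x \<bullet> i) * (x \<bullet> i))) *
     (\<Prod>i\<in>Basis. bump_deriv 0 (real (Suc n) * (x \<bullet> i) + (- (real (Suc n) * (a \<bullet> i)))) *
        bump_deriv 0 (real (Suc n) * (b \<bullet> i) + (- real (Suc n)) * (x \<bullet> i))))"
    unfolding box_bump_def power2_norm_eq_inner
    by (rule ext, subst euclidean_inner) (simp add: algebra_simps)
  show ?thesis unfolding e
    by (intro bump_alg_smooth3 bump_alg.mult bump_alg.add bump_alg.bump bump_alg.const bump_alg.inner bump_alg_sum bump_alg_prod) auto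
qed

lemma box_bump_support:
  assumes R: "R > 0"
  shows "\<exists>K. compact K \<and> K \<subseteq> ball 0 R \<and> (\<forall>x. x \<notin> K \<longrightarrow> box_bump R a b n x = 0)"
proof (intro exI conjI allI impI)
  let ?K = "{x::real^3. (norm x)\<^sup>2 \<le> R\<^sup>2 - 1 / real (Suc n)}"
  have sub: "?K \<subseteq> ball 0 R"
  proof clarsimp
    fix x :: "real^3" assume "(norm x)\<^sup>2 \<le> R\<^sup>2 - 1 / (1 + real n)"
    moreover have "1 / (1 + real n) > 0" by simp
    ultimately have "(norm x)\<^sup>2 < R\<^sup>2" by linarith
    then show "norm x < R" using R by (simp add: power2_less_imp_less)
  qed
  have "closed ?K" by (intro closed_Collect_le continuous_intros)
  then show "compact ?K" using sub bounded_subset[OF bounded_ball] compact_eq_bounded_closed by blast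
  show "?K \<subseteq> ball 0 R" by (rule sub)
  fix x assume "x \<notin> ?K"
  then have "real (Suc n) * (R\<^sup>2 - (norm x)\<^sup>2) < real (Suc n) * (1 / real (Suc n))"
    by (intro mult_strict_left_mono) auto
  then have "bump_deriv 0 (real (Suc n) * (R\<^sup>2 - (norm x)\<^sup>2) - 1) = 0"
    unfolding bump_deriv_def by simp
  then show "box_bump R a b n x = 0" by (simp add: box_bump_def)
qed

lemma box_bump_tendsto:
  assumes R: "R > 0"
  shows "(\<lambda>n. box_bump R a b n x) \<longlonglongrightarrow> indicator (ball 0 R \<inter> box a b) x"
proof (cases "x \<in> ball 0 R \<inter> box a b")
  case True
  have "norm x < R" using True by simp
  then have "(norm x)\<^sup>2 < R\<^sup>2" by (intro power_strict_mono) auto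
  then have "(\<lambda>n. box_bump R a b n x) \<longlonglongrightarrow> 1 * (\<Prod>i\<in>(Basis::(real^3) set). 1 * 1)"
    unfolding box_bump_def using True
    by (intro tendsto_mult tendsto_prod bump_tendsto) (auto simp: mem_box)
  then show ?thesis using True by simp
next
  case False
  have "box_bump R a b n x = 0" for n
  proof (cases "x \<in> ball 0 R")
    case False
    then have "R \<le> norm x" by simp
    then have "R\<^sup>2 \<le> (norm x)\<^sup>2" using R by (intro power_mono) auto
    then have "real (Suc n) * (R\<^sup>2 - (norm x)\<^sup>2) \<le> 0" by (intro mult_nonneg_nonpos) auto
    then show ?thesis unfolding box_bump_def bump_deriv_def by simp
  next
    case True
    then obtain i where i: "i \<in> Basis" "x \<bullet> i \<le> a \<bullet> i \<or> b \<bullet> i \<le> x \<bullet> i"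
      using \<open>x \<notin> ball 0 R \<inter> box a b\<close> by (auto simp: mem_box not_less)
    then have "real (Suc n) * (x \<bullet> i - a \<bullet> i) - 0 \<le> 0 \<or> real (Suc n) * (b \<bullet> i - x \<bullet> i) - 0 \<le> 0"
      by (auto simp: mult_nonneg_nonpos)
    then have "bump_deriv 0 (real (Suc n) * (x \<bullet> i - a \<bullet> i) - 0) * bump_deriv 0 (real (Suc n) * (b \<bullet> i - x \<bullet> i) - 0) = 0"
      unfolding bump_deriv_def by auto
    then show ?thesis unfolding box_bump_def using i(1) by (metis (no_types, lifting) finite_Basis mult_eq_0_iff prod_zero_iff)
  qed
  moreover have "indicator (ball 0 R \<inter> box a b) x = (0::real)" using False by (rule indicator_simps)
  ultimately show ?thesis by simp
qed

subsection \<open>Density of the test functions\<close>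

lemma Ccinf_supp:
  "\<xi> \<in> Ccinf R \<Longrightarrow> \<exists>K. compact K \<and> K \<subseteq> ball 0 R \<and> (\<forall>x. x \<notin> K \<longrightarrow> \<xi> x = 0)"
  unfolding Ccinf_def by blast

lemma Ccinf_add: assumes \<xi>: "\<xi> \<in> Ccinf R" and \<eta>: "\<eta> \<in> Ccinf R" shows "(\<lambda>x. \<xi> x + \<eta> x) \<in> Ccinf R"
proof -
  obtain K where K: "compact K" "K \<subseteq> ball 0 R" "\<And>x. x \<notin> K \<Longrightarrow> \<xi> x = 0" using Ccinf_supp[OF \<xi>] by auto
  obtain L where L: "compact L" "L \<subseteq> ball 0 R" "\<And>x. x \<notin> L \<Longrightarrow> \<eta> x = 0" using Ccinf_supp[OF \<eta>] by auto
  have "compact (K \<union> L) \<and> K \<union> L \<subseteq> ball 0 R \<and> (\<forall>x. x \<notin> K \<union> L \<longrightarrow> \<xi> x + \<eta> x = 0)" using K L by auto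
  moreover have "smooth3 (\<lambda>x. \<xi> x + \<eta> x)" using \<xi> \<eta> by (intro smooth3_add) (auto simp: Ccinf_def)
  ultimately show ?thesis unfolding Ccinf_def by blast
qed

lemma Ccinf_continuous: "\<xi> \<in> Ccinf R \<Longrightarrow> continuous_on UNIV \<xi>"
  by (auto simp: Ccinf_def intro!: C1_on_continuous C2_on_imp_C1_on smooth3_C2_on)

section \<open>Closure of the test functions in the weighted space\<close>

locale weighted_ball =
  fixes R :: real and w :: "real^3 \<Rightarrow> real"
  assumes R: "R > 0" and w_meas: "w \<in> borel_measurable lebesgue"
    and w_nonneg: "\<And>x. 0 \<le> w x" and w_bounded: "\<exists>B. \<forall>x. w x \<le> B"
    and w_zero: "\<And>x. x \<notin> ball 0 R \<Longrightarrow> w x = 0"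
begin

definition M :: "(real^3) measure" where "M = density lebesgue (\<lambda>x. ennreal (w x))"

lemma sets_M[simp, measurable_cong]: "sets M = sets lebesgue" by (simp add: M_def)
lemma space_M[simp]: "space M = UNIV" by (simp add: M_def)

lemma borel_M: "f \<in> borel_measurable borel \<Longrightarrow> f \<in> borel_measurable M"
  unfolding measurable_cong_sets[OF sets_M refl] by (rule measurable_completion) simp

lemma AE_M: "AE x in lebesgue. x \<in> ball 0 R \<longrightarrow> P x \<Longrightarrow> AE x in M. P x"
proof -
  assume ae: "AE x in lebesgue. x \<in> ball 0 R \<longrightarrow> P x"
  have "AE x in lebesgue. 0 < ennreal (w x) \<longrightarrow> P x"
    using ae
  proof (rule AE_mp, intro AE_I2 impI)
    fix x assume "x \<in> ball 0 R \<longrightarrow> P x" "0 < ennreal (w x)"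
    then show "P x" using w_zero[of x] by (cases "x \<in> ball 0 R") auto
  qed
  then show "AE x in M. P x" unfolding M_def using w_meas by (subst AE_density) auto
qed

lemma finite_M: "finite_measure M"
proof
  obtain B where B: "\<And>x. w x \<le> B" using w_bounded by auto
  have "emeasure M (space M) = (\<integral>\<^sup>+x. ennreal (w x) \<partial>lebesgue)"
    unfolding M_def using w_meas by (subst emeasure_density) auto
  also have "\<dots> \<le> (\<integral>\<^sup>+x. ennreal B * indicator (ball 0 R) (x::real^3) \<partial>lebesgue)"
  proof (rule nn_integral_mono)
    show "ennreal (w x) \<le> ennreal B * indicator (ball 0 R) x" for x
      using B[of x] w_zero[of x] by (cases "x \<in> ball 0 R") (simp_all add: ennreal_leI)
  qed
  also have "\<dots> = ennreal B * emeasure lebesgue (ball (0::real^3) R)"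
    by (rule nn_integral_cmult_indicator) auto
  also have "\<dots> < \<infinity>"
    using emeasure_lborel_ball_finite[of "0::real^3" R] by (simp add: ennreal_mult_less_top)
  finally show "emeasure M (space M) \<noteq> \<infinity>" by simp
qed

text \<open>The closure of the test functions in the weighted space. It is stable under sums and
  limits, so density reduces to indicators of boxes.\<close>

definition approximable :: "(real^3 \<Rightarrow> complex^3) \<Rightarrow> bool" where
  "approximable f \<longleftrightarrow> f \<in> borel_measurable M \<and> (\<forall>e>0. \<exists>\<xi>\<in>Ccinf R. l2 M (\<lambda>x. \<xi> x - f x) \<le> ennreal e)"

lemma approximableD:
  assumes "approximable f" "e > 0"
  obtains \<xi> where "\<xi> \<in> Ccinf R" "l2 M (\<lambda>x. \<xi> x - f x) \<le> ennreal e"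
  using assms unfolding approximable_def by blast

lemma smooth3_measurable: "smooth3 (\<xi> :: real^3 \<Rightarrow> complex^3) \<Longrightarrow> \<xi> \<in> borel_measurable M"
  by (intro borel_M borel_measurable_continuous_onI C1_on_continuous C2_on_imp_C1_on smooth3_C2_on)

lemma Ccinf_measurable: "\<xi> \<in> Ccinf R \<Longrightarrow> \<xi> \<in> borel_measurable M"
  by (auto simp: Ccinf_def intro: smooth3_measurable)

lemma approximable_add:
  assumes "approximable f" "approximable g"
  shows "approximable (\<lambda>x. f x + g x)"
  unfolding approximable_def
proof (intro conjI allI impI)
  have m: "f \<in> borel_measurable M" "g \<in> borel_measurable M" using assms by (auto simp: approximable_def)
  then show "(\<lambda>x. f x + g x) \<in> borel_measurable M" by measurable
  fix e :: real assume e: "e > 0"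
  then have e4: "e/4 > 0" by simp
  obtain \<xi> where x1: "\<xi> \<in> Ccinf R" "l2 M (\<lambda>x. \<xi> x - f x) \<le> ennreal (e/4)"
    by (rule approximableD[OF assms(1) e4])
  obtain \<eta> where x2: "\<eta> \<in> Ccinf R" "l2 M (\<lambda>x. \<eta> x - g x) \<le> ennreal (e/4)"
    by (rule approximableD[OF assms(2) e4])
  note x = x1 x2
  have "l2 M (\<lambda>x. \<xi> x + \<eta> x - (f x + g x)) = l2 M (\<lambda>x. (\<xi> x - f x) + (\<eta> x - g x))"
    by (simp add: algebra_simps)
  also have "\<dots> \<le> 2 * l2 M (\<lambda>x. \<xi> x - f x) + 2 * l2 M (\<lambda>x. \<eta> x - g x)"
    using Ccinf_measurable[OF x(1)] Ccinf_measurable[OF x(3)] m by (intro l2_add borel_measurable_diff)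
  also have "\<dots> \<le> 2 * ennreal (e/4) + 2 * ennreal (e/4)" by (intro add_mono mult_left_mono x) auto
  also have "\<dots> = ennreal e" using e by (simp flip: ennreal_plus ennreal_numeral ennreal_mult)
  finally have "l2 M (\<lambda>x. \<xi> x + \<eta> x - (f x + g x)) \<le> ennreal e" .
  moreover have "(\<lambda>x. \<xi> x + \<eta> x) \<in> Ccinf R" by (rule Ccinf_add[OF x(1,3)])
  ultimately show "\<exists>\<xi>\<in>Ccinf R. l2 M (\<lambda>x. \<xi> x - (f x + g x)) \<le> ennreal e" by (rule bexI)
qed

lemma approximable_sum: "finite I \<Longrightarrow> (\<And>i. i \<in> I \<Longrightarrow> approximable (f i)) \<Longrightarrow> approximable (\<lambda>x. \<Sum>i\<in>I. f i x)"
proof (induction I rule: finite_induct)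
  case empty
  have "(\<lambda>_. 0) \<in> Ccinf R" by (auto simp: Ccinf_def smooth3_const intro: exI[of _ "{}"])
  then show ?case unfolding approximable_def by (auto intro!: bexI[of _ "\<lambda>_. 0"] simp: l2_def)
next
  case (insert i I)
  then show ?case by (simp add: approximable_add)
qed

lemma approximable_limit:
  assumes f: "\<And>e. e > 0 \<Longrightarrow> \<exists>g. approximable g \<and> l2 M (\<lambda>x. g x - f x) \<le> ennreal e" and m: "f \<in> borel_measurable M"
  shows "approximable f"
  unfolding approximable_def
proof (intro conjI allI impI m)
  fix e :: real assume e: "e > 0"
  then obtain g where g: "approximable g" "l2 M (\<lambda>x. g x - f x) \<le> ennreal (e/4)" using f[of "e/4"] by auto
  have e4: "e/4 > 0" using e by simp
  obtain \<xi> where x: "\<xi> \<in> Ccinf R" "l2 M (\<lambda>x. \<xi> x - g x) \<le> ennreal (e/4)"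
    by (rule approximableD[OF g(1) e4])
  have gm: "g \<in> borel_measurable M" using g by (simp add: approximable_def)
  have "l2 M (\<lambda>x. \<xi> x - f x) = l2 M (\<lambda>x. (\<xi> x - g x) + (g x - f x))" by simp
  also have "\<dots> \<le> 2 * l2 M (\<lambda>x. \<xi> x - g x) + 2 * l2 M (\<lambda>x. g x - f x)"
    using Ccinf_measurable[OF x(1)] gm m by (intro l2_add borel_measurable_diff)
  also have "\<dots> \<le> 2 * ennreal (e/4) + 2 * ennreal (e/4)" by (intro add_mono mult_left_mono x g) auto
  also have "\<dots> = ennreal e" using e by (simp flip: ennreal_plus ennreal_numeral ennreal_mult)
  finally show "\<exists>\<xi>\<in>Ccinf R. l2 M (\<lambda>x. \<xi> x - f x) \<le> ennreal e" using x(1) by blast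
qed

lemma l2_dominated:
  fixes f :: "nat \<Rightarrow> real^3 \<Rightarrow> complex^3"
  assumes m: "\<And>n. f n \<in> borel_measurable M" "g \<in> borel_measurable M" "h \<in> borel_measurable M"
    and lim: "AE x in M. (\<lambda>n. f n x) \<longlonglongrightarrow> g x"
    and b: "\<And>n. AE x in M. norm (f n x - g x) \<le> norm (h x)" and h: "l2 M (h :: real^3 \<Rightarrow> real) < \<infinity>" and e: "e > 0"
  shows "\<exists>n. l2 M (\<lambda>x. f n x - g x) \<le> ennreal e"
proof -
  have "(\<lambda>n. \<integral>\<^sup>+x. ennreal ((norm (f n x - g x))\<^sup>2) \<partial>M) \<longlonglongrightarrow> (\<integral>\<^sup>+x. 0 \<partial>M)"
  proof (rule nn_integral_dominated_convergence[where w="\<lambda>x. ennreal ((norm (h x))\<^sup>2)"])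
    show "(\<integral>\<^sup>+x. ennreal ((norm (h x))\<^sup>2) \<partial>M) < \<infinity>" using h by (simp add: l2_def)
    show "AE x in M. ennreal ((norm (f n x - g x))\<^sup>2) \<le> ennreal ((norm (h x))\<^sup>2)" for n
      using b[of n]
    proof (rule AE_mp, intro AE_I2 impI)
      fix x assume "norm (f n x - g x) \<le> norm (h x)"
      then have "(norm (f n x - g x))\<^sup>2 \<le> (norm (h x))\<^sup>2" by (rule power_mono) simp
      then show "ennreal ((norm (f n x - g x))\<^sup>2) \<le> ennreal ((norm (h x))\<^sup>2)" by (rule ennreal_leI)
    qed
    show "AE x in M. (\<lambda>n. ennreal ((norm (f n x - g x))\<^sup>2)) \<longlonglongrightarrow> 0"
      using lim
    proof (rule AE_mp, intro AE_I2 impI)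
      fix x assume "(\<lambda>n. f n x) \<longlonglongrightarrow> g x"
      then have "(\<lambda>n. ennreal ((norm (f n x - g x))\<^sup>2)) \<longlonglongrightarrow> ennreal ((norm (g x - g x))\<^sup>2)"
        by (intro tendsto_ennrealI tendsto_intros)
      then show "(\<lambda>n. ennreal ((norm (f n x - g x))\<^sup>2)) \<longlonglongrightarrow> 0" by simp
    qed
  qed (use m in measurable)
  then have "(\<lambda>n. l2 M (\<lambda>x. f n x - g x)) \<longlonglongrightarrow> 0" by (simp add: l2_def)
  then have "\<forall>\<^sub>F n in sequentially. l2 M (\<lambda>x. f n x - g x) < ennreal e"
    using e by (intro order_tendstoD) auto
  then obtain n where "l2 M (\<lambda>x. f n x - g x) < ennreal e" by (auto simp: eventually_sequentially)
  then show ?thesis by (intro exI[of _ n]) simp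
qed

lemma l2_const: "l2 M (\<lambda>_. c :: 'b::real_normed_vector) < \<infinity>"
  using finite_measure.emeasure_finite[OF finite_M, of UNIV]
  by (simp add: l2_def ennreal_mult_less_top top.not_eq_extremum)

text \<open>The bumps converge to the indicator of the box only inside the ball, which is enough
  since the weight vanishes outside.\<close>

lemma approximable_box: "approximable (\<lambda>x. indicator (box a b) x *\<^sub>R c)"
proof -
  have bm: "(\<lambda>x. indicator (box a b) x *\<^sub>R c) \<in> borel_measurable M" by (intro borel_M) auto
  have Cc: "(\<lambda>x. box_bump R a b n x *\<^sub>R c) \<in> Ccinf R" for n
  proof -
    have "smooth3 (\<lambda>x. box_bump R a b n x *\<^sub>R c)"
      by (rule smooth3_linear[OF bounded_linear_scaleR_left box_bump_smooth])
    moreover have "\<exists>K. compact K \<and> K \<subseteq> ball 0 R \<and> (\<forall>x. x \<notin> K \<longrightarrow> box_bump R a b n x *\<^sub>R c = 0)"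
      by (rule ex_forward[OF box_bump_support[OF R, of a b n]]) simp
    ultimately show ?thesis unfolding Ccinf_def by (intro CollectI conjI)
  qed
  show ?thesis
    unfolding approximable_def
  proof (intro conjI allI impI bm)
    fix e :: real assume e: "e > 0"
    have "\<exists>n. l2 M (\<lambda>x. box_bump R a b n x *\<^sub>R c - indicator (box a b) x *\<^sub>R c) \<le> ennreal e"
    proof (rule l2_dominated[where h="\<lambda>_. norm c", OF Ccinf_measurable[OF Cc] bm _ _ _ l2_const e])
      have "(\<lambda>n. box_bump R a b n x *\<^sub>R c) \<longlonglongrightarrow> indicator (box a b) x *\<^sub>R c" if "x \<in> ball 0 R" for x
        using box_bump_tendsto[OF R, of a b x] that by (intro tendsto_intros) (simp add: indicator_def)
      then show "AE x in M. (\<lambda>n. box_bump R a b n x *\<^sub>R c) \<longlonglongrightarrow> indicator (box a b) x *\<^sub>R c"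
        by (intro AE_M AE_I2) auto
      show "AE x in M. norm (box_bump R a b n x *\<^sub>R c - indicator (box a b) x *\<^sub>R c) \<le> norm (norm c)" for n
      proof (intro AE_I2)
        fix x
        have "\<bar>box_bump R a b n x - indicator (box a b) x\<bar> \<le> 1"
          using box_bump_range[of R a b n x] by (auto simp: indicator_def)
        then show "norm (box_bump R a b n x *\<^sub>R c - indicator (box a b) x *\<^sub>R c) \<le> norm (norm c)"
          by (simp add: mult_left_le_one_le flip: scaleR_diff_left)
      qed
    qed auto
    then obtain n where n: "l2 M (\<lambda>x. box_bump R a b n x *\<^sub>R c - indicator (box a b) x *\<^sub>R c) \<le> ennreal e" ..
    show "\<exists>\<xi>\<in>Ccinf R. l2 M (\<lambda>x. \<xi> x - indicator (box a b) x *\<^sub>R c) \<le> ennreal e"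
      by (rule bexI, rule n, rule Cc)
  qed
qed

text \<open>The measure is finite, so a constant is a square integrable majorant.\<close>

lemma approximable_indicator_limit:
  assumes E: "\<And>n. approximable (\<lambda>x. indicator (E n) x *\<^sub>R c)" and F: "F \<in> sets borel"
    and lim: "\<And>x. (\<lambda>n. indicator (E n) x :: real) \<longlonglongrightarrow> indicator F x"
  shows "approximable (\<lambda>x. indicator F x *\<^sub>R c)"
proof (rule approximable_limit)
  show bm: "(\<lambda>x. indicator F x *\<^sub>R c) \<in> borel_measurable M" using F by (intro borel_M) auto
  fix e :: real assume e: "e > 0"
  have "\<exists>n. l2 M (\<lambda>x. indicator (E n) x *\<^sub>R c - indicator F x *\<^sub>R c) \<le> ennreal e"
  proof (rule l2_dominated[where h="\<lambda>_. norm c", OF _ bm _ _ _ l2_const e])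
    show "(\<lambda>x. indicator (E n) x *\<^sub>R c) \<in> borel_measurable M" for n using E by (simp add: approximable_def)
    show "AE x in M. (\<lambda>n. indicator (E n) x *\<^sub>R c) \<longlonglongrightarrow> indicator F x *\<^sub>R c"
      by (intro AE_I2 tendsto_intros lim)
    show "AE x in M. norm (indicator (E n) x *\<^sub>R c - indicator F x *\<^sub>R c) \<le> norm (norm c)" for n
      by (intro AE_I2) (simp add: indicator_def)
  qed auto
  then obtain n where n: "l2 M (\<lambda>x. indicator (E n) x *\<^sub>R c - indicator F x *\<^sub>R c) \<le> ennreal e" ..
  show "\<exists>g. approximable g \<and> l2 M (\<lambda>x. g x - indicator F x *\<^sub>R c) \<le> ennreal e"
    by (rule exI, rule conjI[OF E n])
qed

lemma approximable_scaleR_minus: "approximable f \<Longrightarrow> approximable (\<lambda>x. - f x)"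
proof -
  assume f: "approximable f"
  have m: "(\<lambda>x. - \<xi> x) \<in> Ccinf R" if "\<xi> \<in> Ccinf R" for \<xi>
  proof -
    have "smooth3 (\<lambda>x. - \<xi> x)"
      using that by (intro smooth3_linear[OF bounded_linear_minus[OF bounded_linear_ident]]) (simp add: Ccinf_def)
    then show ?thesis using that unfolding Ccinf_def by auto
  qed
  show ?thesis unfolding approximable_def
  proof (intro conjI allI impI)
    show "(\<lambda>x. - f x) \<in> borel_measurable M" using f by (simp add: approximable_def)
    fix e :: real assume "e > 0"
    then obtain \<xi> where x: "\<xi> \<in> Ccinf R" "l2 M (\<lambda>x. \<xi> x - f x) \<le> ennreal e"
      by (rule approximableD[OF f])
    have "l2 M (\<lambda>x. - \<xi> x - - f x) = l2 M (\<lambda>x. \<xi> x - f x)"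
      by (simp add: l2_def norm_minus_commute)
    then show "\<exists>\<xi>\<in>Ccinf R. l2 M (\<lambda>x. \<xi> x - - f x) \<le> ennreal e" using x m by force
  qed
qed

text \<open>Boxes form an intersection-stable generator, so Dynkin's induction applies. It produces
  only complements and disjoint unions, whose indicators are linear combinations and monotone
  limits.\<close>

lemma approximable_borel_indicator:
  assumes "E \<in> sets borel" shows "approximable (\<lambda>x. indicator E x *\<^sub>R c)"
proof -
  let ?G = "range (\<lambda>(a, b). box a b :: (real^3) set)"
  have borelG: "sets borel = sigma_sets UNIV ?G" unfolding borel_eq_box by (rule sets_measure_of) simp
  \<comment> \<open>Complements are subtracted from the whole space, which must first be exhausted
    by boxes.\<close>
  have U: "approximable (\<lambda>x. indicator (UNIV::(real^3) set) x *\<^sub>R c)"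
  proof (rule approximable_indicator_limit[where E="\<lambda>n. box (- (real n *\<^sub>R One)) (real n *\<^sub>R One)"])
    fix x :: "real^3"
    have "x \<in> (\<Union>n::nat. box (- (real n *\<^sub>R One)) (real n *\<^sub>R One))"
      unfolding UN_box_eq_UNIV by (rule UNIV_I)
    then obtain N where N: "x \<in> box (- (real N *\<^sub>R One)) (real N *\<^sub>R One)" by blast
    have "x \<in> box (- (real n *\<^sub>R One)) (real n *\<^sub>R One)" if "n \<ge> N" for n
      using N that unfolding mem_box by (force simp: algebra_simps intro: less_le_trans le_less_trans)
    then have "\<forall>\<^sub>F n in sequentially. indicator (box (- (real n *\<^sub>R One)) (real n *\<^sub>R One)) x = (1::real)"
      unfolding eventually_sequentially by (intro exI[of _ N]) auto
    then show "(\<lambda>n. indicator (box (- (real n *\<^sub>R One)) (real n *\<^sub>R One)) x :: real) \<longlonglongrightarrow> indicator UNIV x"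
      by (simp add: tendsto_eventually)
  qed (auto intro: approximable_box)
  have "Int_stable ?G" by (auto simp: Int_stable_def box_Int_box)
  moreover have "?G \<subseteq> Pow UNIV" by simp
  moreover have "E \<in> sigma_sets UNIV ?G" using assms borelG by simp
  ultimately show ?thesis
  proof (induction rule: sigma_sets_induct_disjoint)
    case (basic A)
    then show ?case using approximable_box by auto
  next
    case empty
    then show ?case using approximable_sum[of "{}"] by simp
  next
    case (compl A)
    have "(\<lambda>x. indicator (UNIV - A) x *\<^sub>R c) = (\<lambda>x. indicator UNIV x *\<^sub>R c + - (indicator A x *\<^sub>R c))"
      by (auto simp: indicator_def)
    then show ?case using approximable_add[OF U approximable_scaleR_minus[OF compl(2)]] by simp
  next
    case (union A)
    show ?case
    proof (rule approximable_indicator_limit[where E="\<lambda>n. \<Union>i<n. A i"])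
      have "(\<lambda>x. indicator (\<Union>i<n. A i) x *\<^sub>R c) = (\<lambda>x. \<Sum>i<n. indicator (A i) x *\<^sub>R c)" for n
        using union(1) by (subst indicator_UN_disjoint) (auto simp: scaleR_sum_left disjoint_family_on_def)
      then show "approximable (\<lambda>x. indicator (\<Union>i<n. A i) x *\<^sub>R c)" for n
        using approximable_sum[of "{..<n}" "\<lambda>i x. indicator (A i) x *\<^sub>R c"] union(3) by simp
      show "(\<Union>i. A i) \<in> sets borel" using union(2) borelG by blast
      show "(\<lambda>n. indicator (\<Union>i<n. A i) x :: real) \<longlonglongrightarrow> indicator (\<Union>i. A i) x" for x
        by (rule LIMSEQ_indicator_UN)
    qed
  qed
qed

text \<open>A Lebesgue set is a Borel set up to a null set, which the weighted seminorm does not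
  see.\<close>

lemma approximable_indicator:
  assumes "E \<in> sets lebesgue" shows "approximable (\<lambda>x. indicator E x *\<^sub>R c)"
proof -
  obtain S N N' where E: "E = S \<union> N" "S \<in> sets borel" "N' \<in> null_sets lborel" "N \<subseteq> N'"
    using assms unfolding sets_completion by auto
  have "AE x in lebesgue. x \<notin> N'" using AE_completion[OF AE_not_in[OF E(3)]] .
  then have "AE x in lebesgue. x \<in> ball 0 R \<longrightarrow> (indicator S x :: real) = indicator E x"
    by (rule AE_mp) (use E in \<open>auto intro!: AE_I2 simp: indicator_def\<close>)
  then have ae: "AE x in M. (indicator S x :: real) = indicator E x" by (rule AE_M)
  have s: "approximable (\<lambda>x. indicator S x *\<^sub>R c)" by (rule approximable_borel_indicator[OF E(2)])
  have "l2 M (\<lambda>x. indicator S x *\<^sub>R c - indicator E x *\<^sub>R c) = l2 M (\<lambda>x. 0 :: complex^3)"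
    using ae by (intro l2_cong_AE) (auto elim!: AE_mp intro!: AE_I2)
  then have z: "l2 M (\<lambda>x. indicator S x *\<^sub>R c - indicator E x *\<^sub>R c) = 0" by (simp add: l2_def)
  show ?thesis
  proof (rule approximable_limit)
    show "(\<lambda>x. indicator E x *\<^sub>R c) \<in> borel_measurable M" using assms by measurable
    show "\<exists>g. approximable g \<and> l2 M (\<lambda>x. g x - indicator E x *\<^sub>R c) \<le> ennreal e" for e
      using s z by (intro exI[of _ "\<lambda>x. indicator S x *\<^sub>R c"]) auto
  qed
qed

theorem approximable_l2:
  assumes m: "f \<in> borel_measurable M" and f: "l2 M f < \<infinity>"
  shows "approximable f"
proof -
  obtain s where s: "\<And>i. simple_function M (s i)" "\<And>x. x \<in> space M \<Longrightarrow> (\<lambda>i. s i x) \<longlonglongrightarrow> f x"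
     "\<And>i x. x \<in> space M \<Longrightarrow> dist (s i x) 0 \<le> 2 * dist (f x) 0"
    using borel_measurable_implies_sequence_metric[OF m, of 0] by blast
  have sa: "approximable (s i)" for i
  proof -
    have e: "s i = (\<lambda>x. \<Sum>y\<in>s i ` space M. indicator (s i -` {y} \<inter> space M) x *\<^sub>R y)"
      by (rule ext, rule simple_function_indicator_representation_banach[OF s(1)]) simp
    have "s i -` {y} \<inter> space M \<in> sets lebesgue" if "y \<in> s i ` space M" for y
      using simple_functionD(2)[OF s(1)[of i], of "{y}"] sets_M by blast
    then have "approximable (\<lambda>x. \<Sum>y\<in>s i ` space M. indicator (s i -` {y} \<inter> space M) x *\<^sub>R y)"
      using simple_functionD(1)[OF s(1)[of i]] by (intro approximable_sum approximable_indicator) auto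
    then show ?thesis by (subst e)
  qed
  show ?thesis
  proof (rule approximable_limit[OF _ m])
    fix e :: real assume e: "e > 0"
    have "\<exists>n. l2 M (\<lambda>x. s n x - f x) \<le> ennreal e"
    \<comment> \<open>The simple functions are bounded by \<open>2 * norm (f x)\<close>, so their
      distance to \<open>f\<close> is at most \<open>3 * norm (f x)\<close>.\<close>
    proof (rule l2_dominated[where h="\<lambda>x. 3 * norm (f x)", OF _ m _ _ _ _ e])
      show "s n \<in> borel_measurable M" for n by (rule borel_measurable_simple_function[OF s(1)])
      show "(\<lambda>x. 3 * norm (f x)) \<in> borel_measurable M" using m by measurable
      show "AE x in M. (\<lambda>n. s n x) \<longlonglongrightarrow> f x" using s(2) by (intro AE_I2)
      show "AE x in M. norm (s n x - f x) \<le> norm (3 * norm (f x))" for n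
      proof (intro AE_I2)
        fix x assume "x \<in> space M"
        then have "norm (s n x) \<le> 2 * norm (f x)" using s(3)[of x n] by simp
        then show "norm (s n x - f x) \<le> norm (3 * norm (f x))" using norm_triangle_ineq4[of "s n x" "f x"] by simp
      qed
      have "l2 M (\<lambda>x. 3 * norm (f x)) = 9 * l2 M f"
        unfolding l2_def using m by (subst nn_integral_cmult[symmetric]) (auto simp: power_mult_distrib ennreal_mult)
      then show "l2 M (\<lambda>x. 3 * norm (f x)) < \<infinity>" using f by (simp add: ennreal_mult_less_top)
    qed
    then obtain n where n: "l2 M (\<lambda>x. s n x - f x) \<le> ennreal e" ..
    show "\<exists>g. approximable g \<and> l2 M (\<lambda>x. g x - f x) \<le> ennreal e"
      by (rule exI, rule conjI[OF sa n])
  qed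
qed

end

subsection \<open>The pressure law and the enthalpy\<close>

locale pressure_law =
  fixes A \<gamma> :: real and \<Lambda> P :: "real \<Rightarrow> real"
  assumes A_pos: "A > 0" and gamma: "1 < \<gamma>" "\<gamma> < 2"
    and Lambda_smooth: "smooth_on_real UNIV \<Lambda>" and Lambda0: "\<Lambda> 0 = 0"
    and P_law: "\<forall>\<rho>>0. P \<rho> = A * \<rho> powr \<gamma> * (1 + \<Lambda> (\<rho> powr (\<gamma> - 1)))"
    and dP_pos: "\<forall>\<rho>>0. P differentiable (at \<rho>) \<and> deriv P \<rho> > 0"
begin

definition D :: "nat \<Rightarrow> real \<Rightarrow> real" where
  "D = (SOME D. (\<forall>x. D 0 x = \<Lambda> x) \<and> (\<forall>k x. (D k has_real_derivative D (Suc k) x) (at x)))"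

lemma D: "D 0 x = \<Lambda> x" "(D k has_real_derivative D (Suc k) x) (at x)"
proof -
  have "\<exists>D. (\<forall>x. D 0 x = \<Lambda> x) \<and> (\<forall>k x. (D k has_real_derivative D (Suc k) x) (at x))"
    using Lambda_smooth unfolding smooth_on_real_def by simp
  from someI_ex[OF this] show "D 0 x = \<Lambda> x" "(D k has_real_derivative D (Suc k) x) (at x)"
    unfolding D_def by auto
qed

lemma D_cont: "continuous_on S (D k)"
  using D(2) DERIV_isCont continuous_at_imp_continuous_on by blast

text \<open>With \<open>w = s powr (\<gamma> - 1)\<close> one has
  \<open>dP/ds = A * s powr (\<gamma> - 1) * q w\<close>. The factor \<open>q\<close> is smooth
  across the vacuum \<open>w = 0\<close>; the whole singularity of \<open>W\<close>, which is
  \<open>dP/ds / s\<close>, sits in the power \<open>\<gamma> - 2\<close>.\<close>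

definition q :: "real \<Rightarrow> real" where "q w = \<gamma> * (1 + D 0 w) + (\<gamma> - 1) * w * D 1 w"
definition q' :: "real \<Rightarrow> real" where "q' w = \<gamma> * D 1 w + (\<gamma> - 1) * (D 1 w + w * D 2 w)"
definition W :: "real \<Rightarrow> real" where "W s = A * s powr (\<gamma> - 2) * q (s powr (\<gamma> - 1))"
definition W' :: "real \<Rightarrow> real" where
  "W' s = A * ((\<gamma> - 2) * s powr (\<gamma> - 3) * q (s powr (\<gamma> - 1)) +
     s powr (\<gamma> - 2) * (q' (s powr (\<gamma> - 1)) * ((\<gamma> - 1) * s powr (\<gamma> - 2))))"

lemma q_deriv: "(q has_real_derivative q' w) (at w)"
proof -
  have "(D 1 has_real_derivative D 2 w) (at w)" using D(2)[of 1 w] by (simp add: numeral_2_eq_2)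
  moreover have "(D 0 has_real_derivative D 1 w) (at w)" using D(2)[of 0 w] by simp
  ultimately show ?thesis unfolding q_def[abs_def] q'_def
    by (auto intro!: derivative_eq_intros simp: algebra_simps)
qed

lemma q_cont: "continuous_on S q" "continuous_on S q'"
  unfolding q_def[abs_def] q'_def[abs_def] by (intro continuous_intros D_cont)+

lemma powr_deriv: "s > 0 \<Longrightarrow> ((\<lambda>s. s powr a) has_real_derivative a * s powr (a - 1)) (at s)"
  by (rule has_real_derivative_powr)

lemma P_deriv: assumes s: "s > 0" shows "(P has_real_derivative s * W s) (at s)"
proof -
  let ?w = "s powr (\<gamma> - 1)"
  have d: "((\<lambda>s. A * s powr \<gamma> * (1 + D 0 (s powr (\<gamma> - 1)))) has_real_derivative
     (A * (\<gamma> * s powr (\<gamma> - 1)) * (1 + D 0 ?w) + D 1 ?w * ((\<gamma> - 1) * s powr (\<gamma> - 1 - 1)) * (A * s powr \<gamma>))) (at s)"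
  proof -
    have 1: "((\<lambda>s. D 0 (s powr (\<gamma> - 1))) has_real_derivative D 1 ?w * ((\<gamma> - 1) * s powr (\<gamma> - 1 - 1))) (at s)"
      using DERIV_chain2[OF D(2)[of 0] powr_deriv[OF s, of "\<gamma> - 1"]] by simp
    have 2: "((\<lambda>s. A * s powr \<gamma>) has_real_derivative A * (\<gamma> * s powr (\<gamma> - 1))) (at s)"
      by (intro DERIV_cmult powr_deriv s)
    have 3: "((\<lambda>s. 1 + D 0 (s powr (\<gamma> - 1))) has_real_derivative D 1 ?w * ((\<gamma> - 1) * s powr (\<gamma> - 1 - 1))) (at s)"
      using DERIV_add[OF DERIV_const[of 1] 1] by simp
    show ?thesis by (rule DERIV_mult[OF 2 3])
  qed
  have e1: "s * s powr (\<gamma> - 2) = s powr (\<gamma> - 1)" using s powr_mult_base[of s "\<gamma> - 2"] by simp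
  have e2: "s powr (\<gamma> - 1 - 1) * s powr \<gamma> = s powr (\<gamma> - 1) * s powr (\<gamma> - 1)"
    by (simp flip: powr_add)
  have "s * W s = A * (s * s powr (\<gamma> - 2)) * q ?w" by (simp add: W_def)
  also have "\<dots> = A * (\<gamma> * s powr (\<gamma> - 1)) * (1 + D 0 ?w) + A * D 1 ?w * (\<gamma> - 1) * (s powr (\<gamma> - 1) * s powr (\<gamma> - 1))"
    unfolding e1 by (simp add: q_def algebra_simps)
  also have "\<dots> = A * (\<gamma> * s powr (\<gamma> - 1)) * (1 + D 0 ?w) + D 1 ?w * ((\<gamma> - 1) * s powr (\<gamma> - 1 - 1)) * (A * s powr \<gamma>)"
    unfolding e2[symmetric] by (simp add: mult_ac)
  finally have "((\<lambda>s. A * s powr \<gamma> * (1 + D 0 (s powr (\<gamma> - 1)))) has_real_derivative s * W s) (at s)"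
    using d by simp
  then show ?thesis
    by (rule has_field_derivative_transform_within_open[where S="{0<..}"]) (use s P_law D(1) in auto)
qed

lemma W_eq: "s > 0 \<Longrightarrow> deriv P s / s = W s"
  using DERIV_imp_deriv[OF P_deriv] by simp

lemma W_pos: "s > 0 \<Longrightarrow> W s > 0"
  using dP_pos W_eq by (metis divide_pos_pos)

lemma W_deriv: assumes s: "s > 0" shows "(W has_real_derivative W' s) (at s)"
proof -
  have 1: "((\<lambda>s. q (s powr (\<gamma> - 1))) has_real_derivative q' (s powr (\<gamma> - 1)) * ((\<gamma> - 1) * s powr (\<gamma> - 2))) (at s)"
    using DERIV_chain2[OF q_deriv powr_deriv[OF s, of "\<gamma> - 1"]] by (simp add: algebra_simps)
  have 2: "((\<lambda>s. A * s powr (\<gamma> - 2)) has_real_derivative A * ((\<gamma> - 2) * s powr (\<gamma> - 3))) (at s)"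
    using DERIV_cmult[OF powr_deriv[OF s, of "\<gamma> - 2"], of A] by (simp add: algebra_simps)
  show ?thesis unfolding W_def[abs_def]
    by (rule DERIV_cong[OF DERIV_mult[OF 2 1]]) (simp add: W'_def algebra_simps)
qed

lemma W_cont: "continuous_on {0<..} W" "continuous_on {0<..} W'"
proof -
  show "continuous_on {0<..} W"
    using W_deriv by (intro continuous_at_imp_continuous_on ballI) (auto intro: DERIV_isCont)
  have p: "continuous_on {0<..} (\<lambda>s. s powr a)" for a :: real by (intro continuous_intros) auto
  show "continuous_on {0<..} W'" unfolding W'_def[abs_def]
    by (intro continuous_on_mult continuous_on_add continuous_on_const p
        continuous_on_compose2[OF q_cont(1)[of UNIV] p] continuous_on_compose2[OF q_cont(2)[of UNIV] p]) auto
qed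

text \<open>This is where \<open>\<gamma> < 2\<close> enters: \<open>P'(s) / s\<close> grows like \<open>s\<close> to the power \<open>\<gamma> - 2\<close> at the vacuum boundary.\<close>

lemma W_lower_bound:
  assumes m: "m > 0" shows "\<exists>c>0. \<forall>s. 0 < s \<longrightarrow> s \<le> m \<longrightarrow> c \<le> W s"
proof -
  \<comment> \<open>Every \<open>w > 0\<close> equals \<open>s powr (\<gamma> - 1)\<close> for some
    density \<open>s\<close>, so positivity of the pressure derivative gives \<open>q w > 0\<close>;
    at the vacuum \<open>q 0 = \<gamma>\<close>, since \<open>\<Lambda>\<close> vanishes
    there.\<close>
  have qpos: "q w > 0" if w: "0 \<le> w" for w
  proof (cases "w = 0")
    case True then show ?thesis using gamma by (simp add: q_def D(1) Lambda0)
  next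
    case False
    define s where "s = w powr (1 / (\<gamma> - 1))"
    have s: "s > 0" using False by (simp add: s_def)
    have "s powr (\<gamma> - 1) = w" using False w gamma by (simp add: s_def powr_powr)
    then have "W s = A * s powr (\<gamma> - 2) * q w" by (simp add: W_def)
    then show ?thesis using W_pos[OF s] A_pos s zero_less_mult_pos[of "A * s powr (\<gamma> - 2)" "q w"] by simp
  qed
  have "\<exists>w0\<in>{0..m powr (\<gamma> - 1)}. \<forall>w\<in>{0..m powr (\<gamma> - 1)}. q w0 \<le> q w"
    by (intro continuous_attains_inf q_cont) auto
  then obtain w0 where w0: "w0 \<in> {0..m powr (\<gamma> - 1)}" "\<And>w. w \<in> {0..m powr (\<gamma> - 1)} \<Longrightarrow> q w0 \<le> q w" by blast
  show ?thesis
  \<comment> \<open>The power factor is smallest at the largest density \<open>m\<close>, and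
    \<open>q w0\<close> is the minimum of \<open>q\<close> over the compact range of
    \<open>w\<close>.\<close>
  proof (intro exI[of _ "A * m powr (\<gamma> - 2) * q w0"] conjI allI impI)
    show "A * m powr (\<gamma> - 2) * q w0 > 0" using A_pos m qpos w0(1) by simp
    fix s assume s: "0 < s" "s \<le> m"
    have "m powr (\<gamma> - 2) \<le> s powr (\<gamma> - 2)" using s gamma by (intro powr_mono2') auto
    moreover have "s powr (\<gamma> - 1) \<le> m powr (\<gamma> - 1)" using s gamma by (intro powr_mono2) auto
    then have "q w0 \<le> q (s powr (\<gamma> - 1))" by (intro w0(2)) auto
    ultimately show "A * m powr (\<gamma> - 2) * q w0 \<le> W s"
      unfolding W_def using A_pos qpos[of w0] w0(1) by (intro mult_mono) auto
  qed
qed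

text \<open>The substitution \<open>w = s powr (\<gamma> - 1)\<close> turns \<open>W ds\<close> into
  \<open>A / (\<gamma> - 1) * q w dw\<close>, whose antiderivative is regular at 0. As
  \<open>\<gamma> > 1\<close>, the integral with singular lower endpoint has the limit
  \<open>F 0\<close> there, and nonnegativity of the integrand gives the fundamental
  theorem.\<close>

lemma enthalpy_antiderivative:
  "\<exists>F. (\<forall>s>0. (F has_real_derivative W s) (at s)) \<and> (\<forall>s>0. enthalpy P s = F s - F 0)"
proof -
  have "\<exists>F. \<forall>x::real. -\<infinity> < ereal x \<longrightarrow> ereal x < \<infinity> \<longrightarrow> (F has_vector_derivative q x) (at x)"
  proof (rule einterval_antiderivative)
    show "isCont q x" for x using q_deriv DERIV_isCont by blast
  qed simp
  then obtain F0 where F0: "(F0 has_real_derivative q x) (at x)" for x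
    by (auto simp: has_real_derivative_iff_has_vector_derivative)
  define F where "F s = A / (\<gamma> - 1) * F0 (s powr (\<gamma> - 1))" for s
  have F: "(F has_real_derivative W s) (at s)" if s: "s > 0" for s
  proof -
    have "(F has_real_derivative A / (\<gamma> - 1) * (q (s powr (\<gamma> - 1)) * ((\<gamma> - 1) * s powr (\<gamma> - 1 - 1)))) (at s)"
      unfolding F_def[abs_def] by (intro DERIV_cmult DERIV_chain2[OF F0 powr_deriv[OF s]])
    moreover have "A / (\<gamma> - 1) * (q (s powr (\<gamma> - 1)) * ((\<gamma> - 1) * s powr (\<gamma> - 1 - 1))) = W s"
      using gamma by (simp add: W_def)
    ultimately show ?thesis by simp
  qed
  have "enthalpy P s = F s - F 0" if s: "s > 0" for s
    unfolding enthalpy_def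
  proof (rule interval_integral_FTC_nonneg(2))
    show "(0::ereal) < ereal s" using s by simp
    show "DERIV F x :> deriv P x / x" if "0 < ereal x" "ereal x < ereal s" for x
      using F[of x] W_eq[of x] that by simp
    show "isCont (\<lambda>x. deriv P x / x) x" if x: "0 < ereal x" "ereal x < ereal s" for x
    proof -
      have "isCont W x" using W_deriv[of x] x DERIV_isCont by auto
      moreover have "\<forall>\<^sub>F y in nhds x. deriv P y / y = W y"
        using x W_eq by (auto simp: eventually_nhds intro!: exI[of _ "{0<..}"])
      ultimately show ?thesis by (simp add: isCont_cong)
    qed
    show "AE x in lborel. 0 < ereal x \<longrightarrow> ereal x < ereal s \<longrightarrow> 0 \<le> deriv P x / x"
      using W_eq W_pos by (intro AE_I2) (auto simp: less_imp_le)
    have "((\<lambda>x. x powr (\<gamma> - 1)) \<longlongrightarrow> 0) (at_right 0)"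
      using gamma by real_asymp
    then have "(F \<longlongrightarrow> A / (\<gamma> - 1) * F0 0) (at_right 0)"
      unfolding F_def[abs_def] by (intro tendsto_intros isCont_tendsto_compose[OF DERIV_isCont[OF F0]])
    then show "((F \<circ> real_of_ereal) \<longlongrightarrow> F 0) (at_right 0)"
      using gamma unfolding zero_ereal_def by (simp add: ereal_tendsto_simps F_def)
    have "(F \<longlongrightarrow> F s) (at_left s)"
      using DERIV_isCont[OF F[OF s]] by (simp add: isCont_def filterlim_at_split)
    then show "((F \<circ> real_of_ereal) \<longlongrightarrow> F s) (at_left (ereal s))" by (simp add: ereal_tendsto_simps)
  qed
  then show ?thesis using F by blast
qed

lemma enthalpy_deriv: assumes s: "s > 0" shows "(enthalpy P has_real_derivative W s) (at s)"
proof -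
  obtain F where F: "\<And>s. s > 0 \<Longrightarrow> (F has_real_derivative W s) (at s)" "\<And>s. s > 0 \<Longrightarrow> enthalpy P s = F s - F 0"
    using enthalpy_antiderivative by auto
  have "((\<lambda>s. F s - F 0) has_real_derivative W s) (at s)"
    using DERIV_diff[OF F(1)[OF s] DERIV_const[of "F 0"]] by simp
  then show ?thesis
    by (rule has_field_derivative_transform_within_open[where S="{0<..}"]) (use s F(2) in auto)
qed

lemma enthalpy_less: assumes "0 < s" "s < t" shows "enthalpy P s < enthalpy P t"
proof (rule DERIV_pos_imp_increasing[OF assms(2)])
  fix x assume "s \<le> x" "x \<le> t"
  then have "0 < x" using assms by simp
  then show "\<exists>y. (enthalpy P has_real_derivative y) (at x) \<and> 0 < y"
    using enthalpy_deriv W_pos by (intro exI[of _ "W x"] conjI)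
qed

lemma enthalpy_le_iff: "0 < s \<Longrightarrow> 0 < t \<Longrightarrow> enthalpy P s \<le> enthalpy P t \<longleftrightarrow> s \<le> t"
  using enthalpy_less[of s t] enthalpy_less[of t s] by (cases s t rule: linorder_cases) auto

lemma ff_enthalpy: assumes "s > 0" "enthalpy P s > 0" shows "ff P (enthalpy P s) = s"
proof -
  have "(THE \<rho>. \<rho> > 0 \<and> enthalpy P \<rho> = enthalpy P s) = s"
  proof (rule the_equality)
    show "\<rho> = s" if "\<rho> > 0 \<and> enthalpy P \<rho> = enthalpy P s" for \<rho>
      using enthalpy_le_iff[of \<rho> s] enthalpy_le_iff[of s \<rho>] that assms by simp
  qed (use assms in simp)
  then show ?thesis using assms by (simp add: ff_def)
qed

text \<open>\<open>ff\<close> is a definite description, so for positive arguments it is meaningful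
  only on enthalpy values that are attained.\<close>

definition UE :: "real set" where "UE = {enthalpy P s | s. s > 0 \<and> enthalpy P s > 0}"

lemma ff_UE: "u \<in> UE \<Longrightarrow> ff P u > 0 \<and> enthalpy P (ff P u) = u"
  using ff_enthalpy by (auto simp: UE_def)

text \<open>The inverse function rule on the open set of densities with positive enthalpy, where
  \<open>ff P\<close> is a left inverse of the enthalpy.\<close>

lemma ff_deriv: assumes u: "u \<in> UE" shows "(ff P has_real_derivative 1 / W (ff P u)) (at u)"
proof -
  define s where "s = ff P u"
  have s: "s > 0" "enthalpy P s = u" "u > 0" using ff_UE[OF u] u by (auto simp: s_def UE_def)
  have c: "continuous_on {0<..} (enthalpy P)"
    using enthalpy_deriv by (intro continuous_at_imp_continuous_on ballI) (auto intro: DERIV_isCont)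
  have op: "open {t \<in> {0<..}. enthalpy P t \<in> {0<..}}"
    using continuous_open_preimage[OF c open_greaterThan open_greaterThan[of 0]] by (simp add: vimage_def Int_def)
  have "(ff P has_derivative (*) (1 / W s)) (at (enthalpy P s))"
  proof (rule has_derivative_inverse_strong[OF op, where f="enthalpy P" and x=s])
    show "s \<in> {t \<in> {0<..}. enthalpy P t \<in> {0<..}}" using s by simp
    show "continuous_on {t \<in> {0<..}. enthalpy P t \<in> {0<..}} (enthalpy P)"
      by (rule continuous_on_subset[OF c]) auto
    show "ff P (enthalpy P t) = t" if "t \<in> {t \<in> {0<..}. enthalpy P t \<in> {0<..}}" for t
      using ff_enthalpy that by simp
    show "(enthalpy P has_derivative (*) (W s)) (at s)"
      using enthalpy_deriv[OF s(1)] by (simp add: has_field_derivative_def)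
    show "(*) (W s) \<circ> (*) (1 / W s) = id" using W_pos[OF s(1)] by (auto simp: fun_eq_iff)
  qed
  then show ?thesis using s by (simp add: has_field_derivative_def s_def)
qed

lemma ff_cont: "continuous_on UE (ff P)"
  using ff_deriv DERIV_isCont continuous_at_imp_continuous_on by blast

lemma ff_deriv2: assumes u: "u \<in> UE"
  shows "((\<lambda>u. 1 / W (ff P u)) has_real_derivative - (W' (ff P u) * (1 / W (ff P u))) / (W (ff P u))\<^sup>2) (at u)"
proof -
  have s: "ff P u > 0" using ff_UE[OF u] by simp
  have "((\<lambda>u. W (ff P u)) has_real_derivative W' (ff P u) * (1 / W (ff P u))) (at u)"
    by (rule DERIV_chain2[OF W_deriv[OF s] ff_deriv[OF u]])
  from DERIV_inverse_fun[OF this] W_pos[OF s] show ?thesis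
    by (simp add: inverse_eq_divide power2_eq_square)
qed

lemma ff_deriv2_cont: "continuous_on UE (\<lambda>u. - (W' (ff P u) * (1 / W (ff P u))) / (W (ff P u))\<^sup>2)"
proof -
  have i: "ff P ` UE \<subseteq> {0<..}" using ff_UE by auto
  show ?thesis
    using W_pos ff_UE
    by (intro continuous_on_divide continuous_on_minus continuous_on_mult continuous_on_const continuous_on_power
        continuous_on_compose2[OF W_cont(1) ff_cont i] continuous_on_compose2[OF W_cont(2) ff_cont i])
      (force simp: less_imp_neq[symmetric])+
qed

end

subsection \<open>Radial functions\<close>

text \<open>The gradient is \<open>q (norm x)\<close> times \<open>x\<close> with
  \<open>q r = u1 r / r\<close>, and the Hessian is \<open>(u2 - q) sgn x (x) sgn x + q I\<close>,
  where \<open>(x)\<close> is the tensor product. The discontinuity of \<open>sgn\<close> at the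
  origin is harmless because \<open>u2 - q\<close> tends to 0 there.\<close>

lemma radial_C2:
  fixes u u1 u2 :: "real \<Rightarrow> real"
  assumes d1: "\<forall>r\<ge>0. (u has_real_derivative u1 r) (at r within {0..})"
    and d2: "\<forall>r\<ge>0. (u1 has_real_derivative u2 r) (at r within {0..})"
    and c2: "continuous_on {0..} u2" and u10: "u1 0 = 0"
  shows "C2_on UNIV (\<lambda>x::'a::euclidean_space. u (norm x))"
proof -
  have at1: "(u has_real_derivative u1 r) (at r)" and at2: "(u1 has_real_derivative u2 r) (at r)" if "r > 0" for r
    using d1[rule_format, of r] d2[rule_format, of r] that at_within_interior[of r "{0..}"] by simp_all
  \<comment> \<open>Since \<open>u1 0 = 0\<close>, this is the difference quotient of
    \<open>u1\<close> at 0, so \<open>u2 0\<close> is its continuous value there.\<close>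
  define q where "q r = (if r = 0 then u2 0 else u1 r / r)" for r
  have qlim: "(q \<longlongrightarrow> q 0) (at 0 within {0..})"
  proof -
    have "((\<lambda>r. (u1 r - u1 0) / (r - 0)) \<longlongrightarrow> u2 0) (at 0 within {0..})"
      using d2[rule_format, of 0] by (simp add: has_field_derivative_iff)
    moreover have "\<forall>\<^sub>F r in at 0 within {0..}. (u1 r - u1 0) / (r - 0) = q r"
      using u10 by (auto simp: eventually_at_filter q_def)
    ultimately have "(q \<longlongrightarrow> u2 0) (at 0 within {0..})" by (rule Lim_transform_eventually)
    moreover have "q 0 = u2 0" by (simp add: q_def)
    ultimately show ?thesis by (simp only:)
  qed
  have qc: "continuous_on {0..} q"
    unfolding continuous_on_def
  proof
    fix r :: real assume "r \<in> {0..}"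
    show "(q \<longlongrightarrow> q r) (at r within {0..})"
    proof (cases "r = 0")
      case True then show ?thesis using qlim by simp
    next
      case False
      then have r: "r > 0" using \<open>r \<in> {0..}\<close> by simp
      have "isCont (\<lambda>r. u1 r / r) r" using DERIV_isCont[OF at2[OF r]] r by (intro continuous_intros) auto
      then have "((\<lambda>r. u1 r / r) \<longlongrightarrow> q r) (at r within {0..})"
        using r by (simp add: isCont_def q_def tendsto_within_subset[of _ _ _ UNIV])
      moreover have "\<forall>\<^sub>F s in at r within {0..}. u1 s / s = q s"
        using order_tendstoD(1)[OF tendsto_ident_at r] by eventually_elim (simp add: q_def)
      ultimately show ?thesis by (simp add: tendsto_cong)
    qed
  qed
  have nc: "continuous_on UNIV (\<lambda>x::'a. q (norm x))" "continuous_on UNIV (\<lambda>x::'a. u2 (norm x))"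
    by (rule continuous_on_compose2[OF qc continuous_on_norm_id] continuous_on_compose2[OF c2 continuous_on_norm_id]; force)+
  have nd: "(norm has_derivative (\<lambda>h. (x \<bullet> h) / norm x)) (at x)" if "x \<noteq> 0" for x :: 'a
    using has_derivative_norm[OF that] by (simp add: sgn_div_norm inner_commute divide_inverse mult.commute)
  have D1: "((\<lambda>x::'a. u (norm x)) has_derivative (\<lambda>v. q (norm x) * (x \<bullet> v))) (at x)" for x
  proof (cases "x = 0")
    case False
    have "((\<lambda>x::'a. u (norm x)) has_derivative (\<lambda>v. u1 (norm x) * ((x \<bullet> v) / norm x))) (at x)"
      using has_derivative_compose[OF nd[OF False] has_field_derivative_imp_has_derivative[OF at1]] False by simp
    then show ?thesis using False by (simp add: q_def)
  next
    case True
    have "((\<lambda>r. \<bar>(u r - u 0) / r\<bar>) \<longlongrightarrow> \<bar>u1 0\<bar>) (at 0 within {0..})"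
      using d1[rule_format, of 0] by (intro tendsto_rabs) (simp add: has_field_derivative_iff)
    moreover have "filterlim (norm :: 'a \<Rightarrow> real) (at 0 within {0..}) (at 0)"
      unfolding filterlim_at by (auto simp: eventually_at_filter tendsto_norm_zero)
    ultimately have "((\<lambda>h::'a. \<bar>(u (norm h) - u 0) / norm h\<bar>) \<longlongrightarrow> 0) (at 0)"
      using u10 filterlim_compose[of "\<lambda>r. \<bar>(u r - u 0) / r\<bar>"] by fastforce
    then show ?thesis using True by (simp add: has_derivative_at bounded_linear_zero)
  qed
  \<comment> \<open>The Hessian as a bilinear form; \<open>sgn 0 = 0\<close> lets the formula hold
    at the origin as well.\<close>
  define G where "G v x h = (u2 (norm x) - q (norm x)) * ((sgn x \<bullet> h) * (sgn x \<bullet> v)) + q (norm x) * (h \<bullet> v)" for v x h :: 'a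
  have D2: "((\<lambda>x::'a. q (norm x) * (x \<bullet> v)) has_derivative G v x) (at x)" for x v
  proof (cases "x = 0")
    case False
    then have r: "norm x > 0" by simp
    have "((\<lambda>r. u1 r / r) has_real_derivative (u2 (norm x) * norm x - u1 (norm x) * 1) / (norm x * norm x)) (at (norm x))"
      using r by (intro DERIV_divide at2 DERIV_ident) auto
    then have "(q has_real_derivative (u2 (norm x) * norm x - u1 (norm x) * 1) / (norm x * norm x)) (at (norm x))"
      by (rule has_field_derivative_transform_within_open[where S="{0<..}"]) (use r in \<open>auto simp: q_def\<close>)
    moreover have "(u2 (norm x) * norm x - u1 (norm x) * 1) / (norm x * norm x) = (u2 (norm x) - q (norm x)) / norm x"
      using r by (simp add: q_def field_simps)
    ultimately have "(q has_derivative (*) ((u2 (norm x) - q (norm x)) / norm x)) (at (norm x))"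
      by (simp add: has_field_derivative_def)
    from has_derivative_compose[OF nd[OF False] this]
    have "((\<lambda>x. q (norm x)) has_derivative (\<lambda>h. (u2 (norm x) - q (norm x)) / norm x * ((x \<bullet> h) / norm x))) (at x)" .
    then have "((\<lambda>x. q (norm x) * (x \<bullet> v)) has_derivative
        (\<lambda>h. q (norm x) * (h \<bullet> v) + (u2 (norm x) - q (norm x)) / norm x * ((x \<bullet> h) / norm x) * (x \<bullet> v))) (at x)"
      by (intro has_derivative_mult has_derivative_inner_left has_derivative_ident)
    moreover have "G v x = (\<lambda>h. q (norm x) * (h \<bullet> v) + (u2 (norm x) - q (norm x)) / norm x * ((x \<bullet> h) / norm x) * (x \<bullet> v))"
      by (simp add: fun_eq_iff G_def sgn_div_norm divide_inverse mult_ac)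
    ultimately show ?thesis by simp
  next
    case True
    have g0: "G v 0 = (\<lambda>h. q 0 * (h \<bullet> v))" by (simp add: G_def fun_eq_iff)
    have "bounded_linear (\<lambda>h. q 0 * (h \<bullet> v))"
      by (intro bounded_linear_const_mult bounded_linear_inner_left)
    moreover have "((\<lambda>h. norm (q (norm h) * (h \<bullet> v) - q 0 * (h \<bullet> v)) / norm h) \<longlongrightarrow> 0) (at 0)"
    proof (rule Lim_null_comparison)
      show "\<forall>\<^sub>F h in at 0. norm (norm (q (norm h) * (h \<bullet> v) - q 0 * (h \<bullet> v)) / norm h) \<le> \<bar>q (norm h) - q 0\<bar> * norm v"
      proof (intro always_eventually allI)
        fix h :: 'a
        have "norm (q (norm h) * (h \<bullet> v) - q 0 * (h \<bullet> v)) = \<bar>q (norm h) - q 0\<bar> * \<bar>h \<bullet> v\<bar>"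
          by (simp add: abs_mult flip: left_diff_distrib)
        also have "\<dots> \<le> \<bar>q (norm h) - q 0\<bar> * (norm h * norm v)"
          by (intro mult_left_mono Cauchy_Schwarz_ineq2) auto
        finally have "norm (q (norm h) * (h \<bullet> v) - q 0 * (h \<bullet> v)) / norm h \<le> \<bar>q (norm h) - q 0\<bar> * (norm h * norm v) / norm h"
          by (intro divide_right_mono) auto
        also have "\<dots> \<le> \<bar>q (norm h) - q 0\<bar> * norm v" by (cases "h = 0") auto
        finally show "norm (norm (q (norm h) * (h \<bullet> v) - q 0 * (h \<bullet> v)) / norm h) \<le> \<bar>q (norm h) - q 0\<bar> * norm v"
          by simp
      qed
      have "((\<lambda>h::'a. q (norm h)) \<longlongrightarrow> q (norm (0::'a))) (at 0)"
        using nc(1) continuous_on_eq_continuous_at[OF open_UNIV] isCont_def by blast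
      then have "((\<lambda>h::'a. \<bar>q (norm h) - q 0\<bar> * norm v) \<longlongrightarrow> \<bar>q 0 - q 0\<bar> * norm v) (at 0)"
        by (intro tendsto_intros) simp
      then show "((\<lambda>h::'a. \<bar>q (norm h) - q 0\<bar> * norm v) \<longlongrightarrow> 0) (at 0)" by simp
    qed
    ultimately show ?thesis unfolding True g0 has_derivative_at by simp
  qed
  have Gc: "continuous_on UNIV (\<lambda>x. G v x h)" for v h
  proof -
    have m: "continuous_on UNIV (\<lambda>x::'a. u2 (norm x) - q (norm x))" by (intro continuous_intros nc)
    have c: "continuous_on UNIV (\<lambda>x::'a. (u2 (norm x) - q (norm x)) * ((sgn x \<bullet> h) * (sgn x \<bullet> v)))"
    proof (intro continuous_at_imp_continuous_on ballI)
      fix x :: 'a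
      have mx: "isCont (\<lambda>x::'a. u2 (norm x) - q (norm x)) x"
        using m continuous_on_eq_continuous_at[OF open_UNIV] by blast
      show "isCont (\<lambda>x::'a. (u2 (norm x) - q (norm x)) * ((sgn x \<bullet> h) * (sgn x \<bullet> v))) x"
      proof (cases "x = 0")
        case False
        then show ?thesis by (intro continuous_intros mx) (auto simp: isCont_sgn)
      next
        case True
        \<comment> \<open>The angular factors are bounded, so it suffices that their coefficient
          tends to 0.\<close>
        have l: "((\<lambda>x::'a. u2 (norm x) - q (norm x)) \<longlongrightarrow> 0) (at 0)"
          using mx True by (simp add: isCont_def q_def)
        have "((\<lambda>x::'a. (u2 (norm x) - q (norm x)) * ((sgn x \<bullet> h) * (sgn x \<bullet> v))) \<longlongrightarrow> 0) (at 0)"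
        proof (rule Lim_null_comparison)
          have "((\<lambda>x::'a. \<bar>u2 (norm x) - q (norm x)\<bar> * (norm h * norm v)) \<longlongrightarrow> \<bar>0\<bar> * (norm h * norm v)) (at 0)"
            by (intro tendsto_intros l)
          then show "((\<lambda>x::'a. \<bar>u2 (norm x) - q (norm x)\<bar> * (norm h * norm v)) \<longlongrightarrow> 0) (at 0)" by simp
          show "\<forall>\<^sub>F x::'a in at 0. norm ((u2 (norm x) - q (norm x)) * ((sgn x \<bullet> h) * (sgn x \<bullet> v)))
             \<le> \<bar>u2 (norm x) - q (norm x)\<bar> * (norm h * norm v)"
          proof (intro always_eventually allI)
            fix x :: 'a
            have "\<bar>sgn x \<bullet> w\<bar> \<le> norm w" for w
              using Cauchy_Schwarz_ineq2[of "sgn x" w] by (cases "x = 0") (auto simp: norm_sgn)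
            then have "\<bar>sgn x \<bullet> h\<bar> * \<bar>sgn x \<bullet> v\<bar> \<le> norm h * norm v" by (intro mult_mono) auto
            then show "norm ((u2 (norm x) - q (norm x)) * ((sgn x \<bullet> h) * (sgn x \<bullet> v)))
               \<le> \<bar>u2 (norm x) - q (norm x)\<bar> * (norm h * norm v)"
              by (simp add: abs_mult mult_left_mono)
          qed
        qed
        then show ?thesis using True by (simp add: isCont_def)
      qed
    qed
    show ?thesis unfolding G_def by (rule continuous_on_add[OF c continuous_on_mult_right[OF nc(1)]])
  qed
  have C1v: "C1_on UNIV (\<lambda>x::'a. q (norm x) * (x \<bullet> v))" for v
    by (rule C1_onI[OF D2 Gc])
  have "C1_on UNIV (\<lambda>x::'a. u (norm x))"
    by (rule C1_onI[OF D1]) (rule C1_on_continuous[OF C1v])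
  moreover have "(\<lambda>x. fd (\<lambda>x::'a. u (norm x)) x v) = (\<lambda>x. q (norm x) * (x \<bullet> v))" for v
    using fd_eq[OF D1] by auto
  ultimately show ?thesis unfolding C2_on_def using C1v by simp
qed

subsection \<open>Regularity of the equilibrium density\<close>

locale equilibrium = pressure_law A \<gamma> \<Lambda> P
  for A \<gamma> :: real and \<Lambda> P :: "real \<Rightarrow> real" +
  fixes R \<alpha> :: real and ubar u1 u2 :: "real \<Rightarrow> real" and rho :: "real^3 \<Rightarrow> real"
  assumes R_pos: "R > 0" and alpha: "0 < \<alpha>" "\<alpha> < 1"
    and u_d1: "\<forall>r\<ge>0. (ubar has_real_derivative u1 r) (at r within {0..})"
    and u_d2: "\<forall>r\<ge>0. (u1 has_real_derivative u2 r) (at r within {0..})"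
    and u_hoelder: "\<exists>C. \<forall>r\<ge>0. \<forall>s\<ge>0. \<bar>u2 r - u2 s\<bar> \<le> C * \<bar>r - s\<bar> powr \<alpha>"
    and u_pos: "\<forall>r\<ge>0. ubar r > 0 \<longleftrightarrow> r < R"
    and u_decr: "\<forall>r>0. u1 r < 0"
    and u_range: "\<forall>r\<in>{0..<R}. \<exists>\<rho>>0. enthalpy P \<rho> = ubar r"
    and rho_def: "rho = (\<lambda>x. ff P (ubar (norm x)))"
    and P_rho_diff: "(\<lambda>y. P (rho y)) differentiable (at 0)"
begin

lemma ubar_UE: assumes "0 \<le> r" "r < R" shows "ubar r \<in> UE"
proof -
  obtain s where "s > 0" "enthalpy P s = ubar r" using bspec[OF u_range, of r] assms by auto
  moreover have "ubar r > 0" using u_pos assms by simp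
  ultimately show ?thesis unfolding UE_def by (intro CollectI exI[of _ s]) simp
qed

lemma rho_ball: assumes "x \<in> ball 0 R" shows "rho x > 0" "enthalpy P (rho x) = ubar (norm x)"
  using ff_UE[OF ubar_UE[of "norm x"]] assms by (auto simp: rho_def)

lemma rho_outside: "x \<notin> ball 0 R \<Longrightarrow> rho x = 0"
  using u_pos[rule_format, of "norm x"] by (simp add: rho_def ff_def)

lemma rho_nonneg: "rho x \<ge> 0"
  using rho_ball(1)[of x] rho_outside[of x] by (cases "x \<in> ball 0 R") auto

lemma ubar_le: assumes "0 \<le> r" shows "ubar r \<le> ubar 0"
proof (cases "r = 0")
  case False
  then have "r > 0" using assms by simp
  have "\<exists>x\<in>{0<..<r}. ubar r - ubar 0 = u1 x * (r - 0)"
  proof (rule mvt_simple[OF \<open>r > 0\<close>, where f=ubar and f'="\<lambda>x h. u1 x * h"])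
    fix x assume x: "0 \<le> x" "x \<le> r"
    have "(ubar has_real_derivative u1 x) (at x within {0..r})"
      by (rule has_field_derivative_subset[OF u_d1[rule_format, OF x(1)]]) auto
    then show "(ubar has_derivative (*) (u1 x)) (at x within {0..r})" by (simp add: has_field_derivative_def)
  qed
  then obtain x where x: "x > 0" "x < r" "ubar r - ubar 0 = u1 x * (r - 0)" by auto
  have "u1 x * (r - 0) \<le> 0" using u_decr x \<open>r > 0\<close> by (intro mult_nonpos_nonneg) (auto simp: less_imp_le)
  then show ?thesis using x by simp
qed simp

text \<open>Enthalpy increases with density and \<open>ubar\<close> is largest at the centre. The
  central density is the constant that later compares the flux with the weighted norm.\<close>

lemma rho_le: "rho x \<le> rho 0"
proof (cases "x \<in> ball 0 R")
  case True
  have z: "(0::real^3) \<in> ball 0 R" using R_pos by simp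
  have "enthalpy P (rho x) \<le> enthalpy P (rho 0)"
    using rho_ball(2)[OF True] rho_ball(2)[OF z] ubar_le[of "norm x"] by simp
  then show ?thesis using enthalpy_le_iff rho_ball(1)[OF True] rho_ball(1)[OF z] by simp
next
  case False
  then show ?thesis using rho_outside rho_nonneg by simp
qed

lemma u2_cont: "continuous_on {0..} u2"
proof -
  obtain C where C: "\<And>r s. r \<ge> 0 \<Longrightarrow> s \<ge> 0 \<Longrightarrow> \<bar>u2 r - u2 s\<bar> \<le> C * \<bar>r - s\<bar> powr \<alpha>"
    using u_hoelder by auto
  show ?thesis unfolding continuous_on_def
  proof
    fix r :: real assume r: "r \<in> {0..}"
    have "((\<lambda>s. \<bar>s - r\<bar>) \<longlongrightarrow> \<bar>r - r\<bar>) (at r within {0..})" by (intro tendsto_intros)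
    then have "((\<lambda>s. \<bar>s - r\<bar> powr \<alpha>) \<longlongrightarrow> 0) (at r within {0..})"
      using alpha by (intro tendsto_zero_powrI[where b=\<alpha>]) auto
    then have "((\<lambda>s. C * \<bar>s - r\<bar> powr \<alpha>) \<longlongrightarrow> 0) (at r within {0..})" by (rule tendsto_mult_right_zero)
    moreover have "\<forall>\<^sub>F s in at r within {0..}. norm (u2 s - u2 r) \<le> C * \<bar>s - r\<bar> powr \<alpha>"
      using C r by (auto simp: eventually_at_filter)
    ultimately have "((\<lambda>s. u2 s - u2 r) \<longlongrightarrow> 0) (at r within {0..})"
      by (rule Lim_null_comparison[rotated])
    then show "(u2 \<longlongrightarrow> u2 r) (at r within {0..})" by (simp add: LIM_zero_iff)
  qed
qed

text \<open>The radial function \<open>P \<circ> rho\<close> is even and differentiable at the centre, so its one-sided radial derivative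
  \<open>rho(0) u1(0)\<close> vanishes there.\<close>

lemma u1_zero: "u1 0 = 0"
proof -
  have u0: "ubar 0 \<in> UE" using ubar_UE[of 0] R_pos by simp
  define s where "s = ff P (ubar 0)"
  have s: "s > 0" using ff_UE[OF u0] by (simp add: s_def)
  define e :: "real^3" where "e = axis 1 1"
  have e: "norm e = 1" by (simp add: e_def norm_axis_1)
  obtain d where d: "((\<lambda>y. P (rho y)) has_derivative d) (at 0)"
    using P_rho_diff unfolding differentiable_def by blast
  have d': "((\<lambda>y. P (rho (- y))) has_derivative (\<lambda>v. d (- v))) (at 0)"
    using has_derivative_compose[of uminus uminus 0 UNIV "\<lambda>y. P (rho y)" d] d
    by (auto intro!: derivative_eq_intros)
  have ev: "(\<lambda>y. P (rho (- y))) = (\<lambda>y. P (rho y))" by (simp add: rho_def)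
  have "d e = d (- e)" by (rule fun_cong[OF has_derivative_unique[OF d d'[unfolded ev]]])
  then have de: "d e = 0" using linear_neg[OF has_derivative_linear[OF d], of e] by simp
  have l0: "((\<lambda>t. t *\<^sub>R e) has_derivative (\<lambda>t. t *\<^sub>R e)) (at 0)"
    by (intro bounded_linear_imp_has_derivative bounded_linear_scaleR_left)
  have d0: "((\<lambda>y. P (rho y)) has_derivative d) (at (0 *\<^sub>R e))" using d by simp
  have "((\<lambda>t. P (rho (t *\<^sub>R e))) has_derivative (\<lambda>t. d (t *\<^sub>R e))) (at 0)"
    using has_derivative_compose[OF l0 d0] .
  moreover have "(\<lambda>t. d (t *\<^sub>R e)) = (*) 0"
    using linear_scale[OF has_derivative_linear[OF d]] de by (simp add: fun_eq_iff)
  ultimately have "((\<lambda>t. P (rho (t *\<^sub>R e))) has_real_derivative 0) (at 0)" by (simp add: has_field_derivative_def)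
  then have l: "((\<lambda>t. P (rho (t *\<^sub>R e))) has_real_derivative 0) (at 0 within {0..})"
    by (rule has_field_derivative_at_within)
  \<comment> \<open>The factors are \<open>dP/drho\<close> and \<open>drho/du\<close>; their product
    expresses \<open>dP/du = rho\<close>.\<close>
  have "((\<lambda>u. P (ff P u)) has_real_derivative (s * W s) * (1 / W s)) (at (ubar 0))"
    unfolding s_def by (rule DERIV_chain2[OF P_deriv[OF s[unfolded s_def]] ff_deriv[OF u0]])
  then have "((\<lambda>u. P (ff P u)) has_real_derivative s) (at (ubar 0))" using W_pos[OF s] by simp
  from DERIV_chain2[where g=ubar and x=0, OF this u_d1[rule_format, OF order_refl]]
  have "((\<lambda>r. P (ff P (ubar r))) has_real_derivative s * u1 0) (at 0 within {0..})" .
  then have l': "((\<lambda>t. P (rho (t *\<^sub>R e))) has_real_derivative s * u1 0) (at 0 within {0..})"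
    by (rule has_field_derivative_transform_within[where d=1]) (auto simp: rho_def e)
  have nb: "at (0::real) within {0..} \<noteq> bot"
    by (simp add: at_within_Ici_at_right trivial_limit_at_right_real)
  have "s * u1 0 = 0"
    by (rule tendsto_unique[OF nb l'[unfolded has_field_derivative_iff] l[unfolded has_field_derivative_iff]])
  then show ?thesis using s by simp
qed

lemma rho_C2: "C2_on (ball 0 R) rho"
proof -
  have U: "C2_on (ball 0 R) (\<lambda>x::real^3. ubar (norm x))"
    by (rule C2_on_subset[OF radial_C2[OF u_d1 u_d2 u2_cont u1_zero]]) simp
  show ?thesis unfolding rho_def
  proof (rule C2_on_compose_real[OF open_ball U _ ff_deriv ff_deriv2 ff_deriv2_cont])
    show "ubar (norm x) \<in> UE" if "x \<in> ball 0 R" for x :: "real^3" using ubar_UE[of "norm x"] that by simp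
  qed
qed

lemma stiffness_C1: "C1_on (ball 0 R) (\<lambda>x. deriv P (rho x) / rho x)"
proof -
  have "C1_on (ball 0 R) (\<lambda>x. W (rho x))"
    by (rule C1_on_compose_real[OF C2_on_imp_C1_on[OF rho_C2] _ W_deriv W_cont(2)]) (auto simp: rho_ball)
  then show ?thesis by (rule C1_on_transform[OF open_ball]) (simp add: W_eq rho_ball)
qed

lemma stiffness_lower_bound: "\<exists>c>0. \<forall>x\<in>ball 0 R. c \<le> deriv P (rho x) / rho x"
proof -
  have "rho 0 > 0" using rho_ball(1)[of 0] R_pos by simp
  from W_lower_bound[OF this] obtain c where c: "c > 0" "\<And>s. 0 < s \<Longrightarrow> s \<le> rho 0 \<Longrightarrow> c \<le> W s" by blast
  then have "c \<le> deriv P (rho x) / rho x" if "x \<in> ball 0 R" for x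
    using rho_ball(1)[OF that] rho_le[of x] W_eq by simp
  then show ?thesis using c(1) by blast
qed

lemma rho_borel: "rho \<in> borel_measurable borel"
proof -
  have "(\<lambda>x. indicator (ball 0 R) x *\<^sub>R rho x) \<in> borel_measurable borel"
    by (intro borel_measurable_continuous_on_indicator C1_on_continuous C2_on_imp_C1_on rho_C2) auto
  moreover have "(\<lambda>x. indicator (ball 0 R) x *\<^sub>R rho x) = rho"
    using rho_outside by (auto simp: indicator_def fun_eq_iff)
  ultimately show ?thesis by simp
qed

lemma rho_weight: "weighted_ball R rho"
proof
  show "rho \<in> borel_measurable lebesgue" by (rule measurable_completion) (simp add: rho_borel)
  show "\<exists>B. \<forall>x. rho x \<le> B" by (intro exI[of _ "rho 0"] allI rho_le)
qed (auto simp: R_pos rho_nonneg rho_outside)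

end

section \<open>The weighted space as a semi-Hilbert space\<close>

lemma norm_vec_sq: "(norm (a :: complex^3))\<^sup>2 = (\<Sum>i\<in>UNIV. (cmod (a $ i))\<^sup>2)"
  by (simp add: norm_vec_def L2_set_def sum_nonneg)

lemma norm_vec_scale: "norm (c *s (a::complex^3)) = cmod c * norm a"
proof -
  have "(norm (c *s a))\<^sup>2 = (cmod c * norm a)\<^sup>2"
    by (simp add: norm_vec_sq power_mult_distrib norm_mult sum_distrib_left)
  then show ?thesis by (simp add: power2_eq_iff_nonneg)
qed

lemma bounded_linear_vec_scale: "bounded_linear (\<lambda>v::complex^3. c *s v)"
proof (rule bounded_linear_intro)
  show "c *s (x + y) = c *s x + c *s y" for x y :: "complex^3" by (simp add: vec_eq_iff distrib_left)
  show "c *s (r *\<^sub>R x) = r *\<^sub>R (c *s x)" for r and x :: "complex^3" by (simp add: vec_eq_iff)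
  show "norm (c *s x) \<le> norm x * cmod c" for x :: "complex^3" by (simp add: norm_vec_scale)
qed

lemma vec_scale_measurable:
  assumes "f \<in> borel_measurable N" shows "(\<lambda>x. c *s (f x :: complex^3)) \<in> borel_measurable N"
  by (rule measurable_compose[OF assms borel_measurable_continuous_onI[OF linear_continuous_on[OF bounded_linear_vec_scale]]])

lemma cinner3_self: "cinner3 a a = complex_of_real ((norm a)\<^sup>2)"
proof -
  have "cinner3 a a = (\<Sum>i\<in>UNIV. complex_of_real ((cmod (a $ i))\<^sup>2))"
    unfolding cinner3_def by (intro sum.cong refl) (simp add: complex_norm_square[symmetric])
  then show ?thesis by (simp add: norm_vec_sq)
qed

lemma cinner3_bound: "cmod (cinner3 a b) \<le> (norm a)\<^sup>2 + (norm b)\<^sup>2"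
proof -
  have "cmod (cinner3 a b) \<le> (\<Sum>i\<in>UNIV. (cmod (a $ i))\<^sup>2 + (cmod (b $ i))\<^sup>2)"
    unfolding cinner3_def
  proof (rule sum_norm_le)
    fix i :: 3
    have "2 * cmod (a $ i) * cmod (b $ i) \<le> (cmod (a $ i))\<^sup>2 + (cmod (b $ i))\<^sup>2" by (rule sum_squares_bound)
    moreover have "0 \<le> cmod (a $ i) * cmod (b $ i)" by simp
    ultimately show "cmod (a $ i * cnj (b $ i)) \<le> (cmod (a $ i))\<^sup>2 + (cmod (b $ i))\<^sup>2"
      unfolding norm_mult complex_mod_cnj by linarith
  qed
  then show ?thesis by (simp add: norm_vec_sq sum.distrib)
qed

lemma cinner3_add: "cinner3 (a + b) c = cinner3 a c + cinner3 b c"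
  by (simp add: cinner3_def distrib_right sum.distrib)

lemma cinner3_scale: "cinner3 (z *s a) c = z * cinner3 a c"
  by (simp add: cinner3_def sum_distrib_left mult.assoc)

lemma cinner3_cnj: "cnj (cinner3 a b) = cinner3 b a"
  by (simp add: cinner3_def mult.commute)

lemma cinner3_measurable:
  assumes f: "f \<in> borel_measurable M" and g: "g \<in> borel_measurable M"
  shows "(\<lambda>x. cinner3 (f x) (g x)) \<in> borel_measurable M"
proof -
  have c: "(\<lambda>v::complex^3. v $ i) \<in> borel_measurable borel" for i
    by (intro borel_measurable_continuous_onI continuous_intros)
  have d: "cnj \<in> borel_measurable borel"
    by (intro borel_measurable_continuous_onI continuous_intros)
  show ?thesis unfolding cinner3_def
    using measurable_compose[OF f c] measurable_compose[OF measurable_compose[OF g c] d]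
    by (intro borel_measurable_sum borel_measurable_times)
qed

locale weighted_hilbert = weighted_ball +
  assumes w_pos: "\<And>x. x \<in> ball 0 R \<Longrightarrow> w x > 0"
begin

text \<open>Elements of \<open>Hsp\<close> are arbitrary, possibly not measurable, outside the ball.
  Truncation makes them globally measurable without changing any weighted integral.\<close>

definition tr :: "(real^3 \<Rightarrow> complex^3) \<Rightarrow> real^3 \<Rightarrow> complex^3" where
  "tr f x = indicator (ball 0 R) x *\<^sub>R f x"

lemma tr_in: "x \<in> ball 0 R \<Longrightarrow> tr f x = f x" by (simp add: tr_def)
lemma tr_out: "x \<notin> ball 0 R \<Longrightarrow> tr f x = 0" by (simp add: tr_def)
lemma tr_add: "tr (f + g) = (\<lambda>x. tr f x + tr g x)" by (simp add: tr_def fun_eq_iff scaleR_add_right)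
lemma tr_diff: "tr (f - g) = (\<lambda>x. tr f x - tr g x)" by (simp add: tr_def fun_eq_iff fun_diff_def scaleR_diff_right)
lemma tr_scale: "tr (\<lambda>t. c *s f t) = (\<lambda>x. c *s tr f x)" by (simp add: tr_def fun_eq_iff vec_eq_iff)

lemma w_tr: "w x * (norm (tr f x))\<^sup>2 = indicator (ball 0 R) x *\<^sub>R (w x * (norm (f x))\<^sup>2)"
  by (cases "x \<in> ball 0 R") (simp_all add: tr_in tr_out w_zero)

lemma l2_M:
  assumes "g \<in> borel_measurable lebesgue"
  shows "l2 M g = (\<integral>\<^sup>+x. ennreal (w x * (norm (g x))\<^sup>2) \<partial>lebesgue)"
  unfolding l2_def M_def using assms w_meas w_nonneg
  by (subst nn_integral_density) (auto simp: ennreal_mult)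

lemma meas_M_iff: "f \<in> borel_measurable M \<longleftrightarrow> f \<in> borel_measurable lebesgue"
  by (simp only: measurable_cong_sets[OF sets_M refl])

lemma Hsp_iff: "f \<in> Hsp w R \<longleftrightarrow> tr f \<in> borel_measurable M \<and> l2 M (tr f) < \<infinity>"
proof -
  have "integrable lebesgue (\<lambda>x. w x * (norm (tr f x))\<^sup>2) \<longleftrightarrow> l2 M (tr f) < \<infinity>"
    if m: "tr f \<in> borel_measurable lebesgue"
  proof -
    have "(\<lambda>x. w x * (norm (tr f x))\<^sup>2) \<in> borel_measurable lebesgue"
      by (intro borel_measurable_times borel_measurable_power measurable_compose[OF m borel_measurable_norm] w_meas)
    moreover have "(\<integral>\<^sup>+x. ennreal (norm (w x * (norm (tr f x))\<^sup>2)) \<partial>lebesgue) = l2 M (tr f)"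
      unfolding l2_M[OF m] using w_nonneg by (intro nn_integral_cong) (simp add: abs_mult)
    ultimately show ?thesis unfolding integrable_iff_bounded by simp
  qed
  then show ?thesis
    unfolding Hsp_def set_borel_measurable_def set_integrable_def w_tr[symmetric] tr_def[symmetric] meas_M_iff
    by auto
qed

lemma Hsp_integrable: assumes "f \<in> Hsp w R" shows "integrable lebesgue (\<lambda>x. w x * (norm (tr f x))\<^sup>2)"
  using assms unfolding Hsp_def set_integrable_def w_tr by simp

definition pr :: "(real^3 \<Rightarrow> complex^3) \<Rightarrow> (real^3 \<Rightarrow> complex^3) \<Rightarrow> real^3 \<Rightarrow> complex" where
  "pr f g x = cinner3 (tr f x) (tr g x) * complex_of_real (w x)"

lemma ipH_eq: "ipH w R f g = (\<integral>x. pr f g x \<partial>lebesgue)"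
  unfolding ipH_def set_lebesgue_integral_def
proof (rule Bochner_Integration.integral_cong[OF refl])
  show "indicator (ball 0 R) x *\<^sub>R (cinner3 (f x) (g x) * complex_of_real (w x)) = pr f g x" for x
    by (cases "x \<in> ball 0 R") (simp_all add: pr_def tr_in w_zero)
qed

lemma pr_integrable: assumes f: "f \<in> Hsp w R" and g: "g \<in> Hsp w R" shows "integrable lebesgue (pr f g)"
proof (rule Bochner_Integration.integrable_bound)
  show "integrable lebesgue (\<lambda>x. w x * (norm (tr f x))\<^sup>2 + w x * (norm (tr g x))\<^sup>2)"
    by (intro Bochner_Integration.integrable_add Hsp_integrable f g)
  have m: "tr f \<in> borel_measurable lebesgue" "tr g \<in> borel_measurable lebesgue"
    using f g by (simp_all add: Hsp_iff meas_M_iff)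
  show "pr f g \<in> borel_measurable lebesgue"
    unfolding pr_def
    by (intro borel_measurable_times cinner3_measurable m measurable_compose[OF w_meas, of complex_of_real]
        borel_measurable_continuous_onI continuous_intros)
  have "norm (pr f g x) \<le> norm (w x * (norm (tr f x))\<^sup>2 + w x * (norm (tr g x))\<^sup>2)" for x
  proof -
    have "norm (pr f g x) \<le> ((norm (tr f x))\<^sup>2 + (norm (tr g x))\<^sup>2) * w x"
      unfolding pr_def norm_mult using w_nonneg cinner3_bound by (simp add: mult_right_mono)
    then show ?thesis by (simp add: algebra_simps)
  qed
  then show "AE x in lebesgue. norm (pr f g x) \<le> norm (w x * (norm (tr f x))\<^sup>2 + w x * (norm (tr g x))\<^sup>2)"
    by (intro AE_I2)
qed

lemma ipH_self: assumes f: "f \<in> Hsp w R"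
  shows "ipH w R f f = complex_of_real (\<integral>x. w x * (norm (tr f x))\<^sup>2 \<partial>lebesgue)"
    and "ennreal (Re (ipH w R f f)) = l2 M (tr f)" "Re (ipH w R f f) \<ge> 0"
proof -
  have p: "pr f f = (\<lambda>x. complex_of_real (w x * (norm (tr f x))\<^sup>2))"
    by (simp add: fun_eq_iff pr_def cinner3_self mult.commute)
  show e: "ipH w R f f = complex_of_real (\<integral>x. w x * (norm (tr f x))\<^sup>2 \<partial>lebesgue)"
    unfolding ipH_eq p by (rule integral_complex_of_real)
  have m: "tr f \<in> borel_measurable lebesgue" using f by (simp add: Hsp_iff meas_M_iff)
  show "ennreal (Re (ipH w R f f)) = l2 M (tr f)"
    unfolding e l2_M[OF m] Re_complex_of_real using w_nonneg
    by (intro nn_integral_eq_integral[symmetric] Hsp_integrable f) auto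
  show "Re (ipH w R f f) \<ge> 0"
    unfolding e Re_complex_of_real using w_nonneg by (intro integral_nonneg_AE) auto
qed

definition scH :: "complex \<Rightarrow> (real^3 \<Rightarrow> complex^3) \<Rightarrow> (real^3 \<Rightarrow> complex^3)" where
  "scH c f = (\<lambda>t. c *s f t)"

lemma Hsp_zero: "0 \<in> Hsp w R"
proof -
  have "tr 0 = (\<lambda>_. 0)" by (simp add: fun_eq_iff tr_def)
  then show ?thesis by (simp add: Hsp_iff l2_def)
qed

lemma Hsp_add: assumes f: "f \<in> Hsp w R" and g: "g \<in> Hsp w R" shows "f + g \<in> Hsp w R"
proof -
  have m: "tr f \<in> borel_measurable M" "tr g \<in> borel_measurable M" and fin: "l2 M (tr f) < \<infinity>" "l2 M (tr g) < \<infinity>"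
    using f g by (simp_all add: Hsp_iff)
  have "l2 M (tr (f + g)) \<le> 2 * l2 M (tr f) + 2 * l2 M (tr g)" unfolding tr_add by (rule l2_add[OF m])
  also have "\<dots> < \<infinity>" using fin by (simp add: ennreal_mult_less_top)
  finally show ?thesis unfolding Hsp_iff tr_add using m by (intro conjI borel_measurable_add)
qed

lemma Hsp_scale: assumes f: "f \<in> Hsp w R" shows "scH c f \<in> Hsp w R"
proof -
  have m: "tr f \<in> borel_measurable M" and fin: "l2 M (tr f) < \<infinity>" using f by (simp_all add: Hsp_iff)
  have "l2 M (\<lambda>x. c *s tr f x) = (\<integral>\<^sup>+x. ennreal ((cmod c)\<^sup>2) * ennreal ((norm (tr f x))\<^sup>2) \<partial>M)"
    unfolding l2_def by (simp add: norm_vec_scale power_mult_distrib ennreal_mult)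
  also have "\<dots> = ennreal ((cmod c)\<^sup>2) * l2 M (tr f)"
    unfolding l2_def
    by (intro nn_integral_cmult measurable_compose[OF _ measurable_ennreal] borel_measurable_power
        measurable_compose[OF m borel_measurable_norm])
  also have "\<dots> < \<infinity>" using fin by (simp add: ennreal_mult_less_top)
  finally show ?thesis unfolding Hsp_iff scH_def tr_scale using vec_scale_measurable[OF m] by simp
qed

lemma l2_tr: "l2 M (tr f) = l2 M f"
proof (rule l2_cong_AE, rule AE_M, intro AE_I2 impI)
  show "tr f x = f x" if "x \<in> ball 0 R" for x using that by (rule tr_in)
qed

sublocale H: sesquilinear_form scH "Hsp w R" "ipH w R"
proof
  fix x y z :: "real^3 \<Rightarrow> complex^3" and c
  show "scH (- 1) x = - x" by (simp add: scH_def fun_eq_iff vec_eq_iff)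
  show "scH c (x - y) = scH c x - scH c y"
    by (simp add: scH_def fun_eq_iff vec_eq_iff fun_diff_def right_diff_distrib)
  show "0 \<in> Hsp w R" by (rule Hsp_zero)
  assume x: "x \<in> Hsp w R"
  show "scH c x \<in> Hsp w R" by (rule Hsp_scale[OF x])
  show "0 \<le> Re (ipH w R x x)" by (rule ipH_self(3)[OF x])
  show "ipH w R (scH c x) z = c * ipH w R x z" if "z \<in> Hsp w R"
  proof -
    have "pr (scH c x) z = (\<lambda>t. c * pr x z t)"
      by (simp add: fun_eq_iff pr_def scH_def tr_scale cinner3_scale mult.assoc)
    then show ?thesis unfolding ipH_eq by simp
  qed
  assume y: "y \<in> Hsp w R"
  show "x + y \<in> Hsp w R" by (rule Hsp_add[OF x y])
  show "ipH w R x y = cnj (ipH w R y x)"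
  proof -
    have "pr x y = (\<lambda>t. cnj (pr y x t))" by (simp add: fun_eq_iff pr_def cinner3_cnj)
    then show ?thesis unfolding ipH_eq by simp
  qed
  show "ipH w R (x + y) z = ipH w R x z + ipH w R y z" if z: "z \<in> Hsp w R"
  proof -
    have "pr (x + y) z = (\<lambda>t. pr x z t + pr y z t)"
      by (simp add: fun_eq_iff pr_def tr_add cinner3_add distrib_right)
    then show ?thesis unfolding ipH_eq using pr_integrable[OF x z] pr_integrable[OF y z] by simp
  qed
qed

lemma nrm_eq: "H.nrm f = normH w R f"
  by (simp add: H.nrm_def H.qf_def normH_def)

lemma nrm_l2: assumes "f \<in> Hsp w R" shows "ennreal ((normH w R f)\<^sup>2) = l2 M f"
  using ipH_self(2,3)[OF assms] l2_tr[of f] by (simp add: normH_def)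

text \<open>Completeness is applied to the truncations. The limit is truncated in turn to obtain an
  element of the space, at no cost because the measure is carried by the ball.\<close>

sublocale H: semi_hilbert scH "Hsp w R" "ipH w R"
proof
  fix X :: "nat \<Rightarrow> real^3 \<Rightarrow> complex^3" assume X: "\<And>n. X n \<in> Hsp w R"
    and C: "\<And>e. e > 0 \<Longrightarrow> \<exists>N. \<forall>m\<ge>N. \<forall>n\<ge>N. H.nrm (X m - X n) < e"
  have Xm: "tr (X n) \<in> borel_measurable M" for n using X by (simp add: Hsp_iff)
  have n2: "ennreal ((H.nrm (f - g))\<^sup>2) = l2 M (\<lambda>x. tr f x - tr g x)" if "f \<in> Hsp w R" "g \<in> Hsp w R" for f g
    using nrm_l2[OF H.diff_closed[OF that]] l2_tr[of "f - g"] by (simp add: nrm_eq tr_diff)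
  have "\<exists>g\<in>borel_measurable M. \<forall>e>0. \<exists>N. \<forall>n\<ge>N. l2 M (\<lambda>x. tr (X n) x - g x) \<le> ennreal e"
  proof (rule l2_complete[where f="\<lambda>n. tr (X n)", OF Xm])
    fix e :: real assume "e > 0"
    then have "sqrt e > 0" by simp
    from C[OF this] obtain N where N: "\<And>m n. m \<ge> N \<Longrightarrow> n \<ge> N \<Longrightarrow> H.nrm (X m - X n) < sqrt e" by auto
    have "l2 M (\<lambda>x. tr (X m) x - tr (X n) x) \<le> ennreal e" if "m \<ge> N" "n \<ge> N" for m n
    proof -
      have "(H.nrm (X m - X n))\<^sup>2 \<le> (sqrt e)\<^sup>2"
        using N[OF that] H.nrm_nonneg[OF H.diff_closed[OF X X]] by (intro power_mono) auto
      then show ?thesis unfolding n2[OF X X, symmetric] using \<open>e > 0\<close> by (simp add: ennreal_leI)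
    qed
    then show "\<exists>N. \<forall>m\<ge>N. \<forall>n\<ge>N. l2 M (\<lambda>x. tr (X m) x - tr (X n) x) \<le> ennreal e" by blast
  qed
  then obtain g where gm: "g \<in> borel_measurable M"
    and g: "\<And>e. e > 0 \<Longrightarrow> \<exists>N. \<forall>n\<ge>N. l2 M (\<lambda>x. tr (X n) x - g x) \<le> ennreal e" by blast
  have trg: "tr g \<in> borel_measurable M"
    unfolding tr_def[abs_def] using gm by (intro borel_measurable_scaleR borel_measurable_indicator) auto
  have eqd: "l2 M (\<lambda>x. tr (X n) x - tr g x) = l2 M (\<lambda>x. tr (X n) x - g x)" for n
    by (rule l2_cong_AE, rule AE_M) (simp add: tr_in)
  obtain N where N: "\<And>n. n \<ge> N \<Longrightarrow> l2 M (\<lambda>x. tr (X n) x - g x) \<le> ennreal 1" using g[of 1] by auto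
  have "l2 M (tr g) = l2 M (\<lambda>x. (tr g x - tr (X N) x) + tr (X N) x)" by simp
  also have "\<dots> \<le> 2 * l2 M (\<lambda>x. tr g x - tr (X N) x) + 2 * l2 M (tr (X N))"
    using trg Xm by (intro l2_add borel_measurable_diff)
  also have "\<dots> < \<infinity>"
    using N[of N] X[of N] eqd[of N] l2_minus_commute[of M "tr g" "tr (X N)"]
    by (auto simp: Hsp_iff ennreal_mult_less_top intro: le_less_trans)
  finally have gH: "g \<in> Hsp w R" using trg by (simp add: Hsp_iff)
  have "(\<lambda>n. H.nrm (X n - g)) \<longlonglongrightarrow> 0"
  proof (rule LIMSEQ_I)
    fix e :: real assume e: "e > 0"
    then have "(e/2)\<^sup>2 > 0" by simp
    from g[OF this] obtain N where N: "\<And>n. n \<ge> N \<Longrightarrow> l2 M (\<lambda>x. tr (X n) x - g x) \<le> ennreal ((e/2)\<^sup>2)" by auto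
    have "norm (H.nrm (X n - g) - 0) < e" if "n \<ge> N" for n
    proof -
      have "ennreal ((H.nrm (X n - g))\<^sup>2) \<le> ennreal ((e/2)\<^sup>2)"
        unfolding n2[OF X gH] eqd using N[OF that] .
      then have "(H.nrm (X n - g))\<^sup>2 \<le> (e/2)\<^sup>2" by (subst (asm) ennreal_le_iff) auto
      then have "H.nrm (X n - g) \<le> e/2" by (rule power2_le_imp_le) (use e in simp)
      then show ?thesis using e H.nrm_nonneg[OF H.diff_closed[OF X gH]] by simp
    qed
    then show "\<exists>N. \<forall>n\<ge>N. norm (H.nrm (X n - g) - 0) < e" by blast
  qed
  then show "\<exists>u\<in>Hsp w R. (\<lambda>n. H.nrm (X n - u)) \<longlonglongrightarrow> 0" using gH by blast
qed

text \<open>Strict positivity of the weight in the ball makes null sets of the weighted measure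
  Lebesgue null there, so the seminorm kernel is exactly almost everywhere equality.\<close>

lemma eqH_iff: assumes f: "f \<in> Hsp w R" and g: "g \<in> Hsp w R"
  shows "eqH R f g \<longleftrightarrow> H.nrm (f - g) = 0"
proof -
  have d: "f - g \<in> Hsp w R" by (rule H.diff_closed[OF f g])
  have m: "tr (f - g) \<in> borel_measurable M" using d by (simp add: Hsp_iff)
  have "H.nrm (f - g) = 0 \<longleftrightarrow> ennreal ((normH w R (f - g))\<^sup>2) = 0" by (simp add: nrm_eq)
  also have "\<dots> \<longleftrightarrow> l2 M (tr (f - g)) = 0" using nrm_l2[OF d] by (simp add: l2_tr)
  also have "\<dots> \<longleftrightarrow> (AE x in M. ennreal ((norm (tr (f - g) x))\<^sup>2) = 0)"
    unfolding l2_def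
    by (intro nn_integral_0_iff_AE measurable_compose[OF _ measurable_ennreal] borel_measurable_power
        measurable_compose[OF m borel_measurable_norm])
  also have "\<dots> \<longleftrightarrow> (AE x in lebesgue. 0 < ennreal (w x) \<longrightarrow> ennreal ((norm (tr (f - g) x))\<^sup>2) = 0)"
    unfolding M_def using w_meas by (intro AE_density) auto
  also have "\<dots> \<longleftrightarrow> (AE x in lebesgue. x \<in> ball 0 R \<longrightarrow> f x = g x)"
  proof (intro arg_cong[where f="\<lambda>Q. almost_everywhere lebesgue Q"] ext)
    fix x
    show "(0 < ennreal (w x) \<longrightarrow> ennreal ((norm (tr (f - g) x))\<^sup>2) = 0) = (x \<in> ball 0 R \<longrightarrow> f x = g x)"
      using w_pos[of x] w_zero[of x]
      by (cases "x \<in> ball 0 R") (simp_all add: tr_in fun_diff_def)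
  qed
  finally show ?thesis by (simp add: eqH_def)
qed

text \<open>The translation of \<open>eqH\<close> holds only between elements of the space, hence
  the split on the inclusion clause; without it both sides are false.\<close>

lemma is_operator_iff: "is_operator w R T \<longleftrightarrow> H.op T"
proof (cases "T \<subseteq> Hsp w R \<times> Hsp w R")
  case True
  then have inH: "x \<in> Hsp w R" "y \<in> Hsp w R" if "(x, y) \<in> T" for x y using that by auto
  have e1: "(\<forall>x y x' y'. (x, y) \<in> T \<longrightarrow> x' \<in> Hsp w R \<longrightarrow> y' \<in> Hsp w R \<longrightarrow> eqH R x x' \<longrightarrow> eqH R y y' \<longrightarrow> (x', y') \<in> T)
     \<longleftrightarrow> (\<forall>x y x' y'. (x, y) \<in> T \<longrightarrow> x' \<in> Hsp w R \<longrightarrow> y' \<in> Hsp w R \<longrightarrow> H.nrm (x - x') = 0 \<longrightarrow> H.nrm (y - y') = 0 \<longrightarrow> (x', y') \<in> T)"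
    using eqH_iff inH by (intro iff_allI) (auto 0 3)
  have e2: "(\<forall>x y x' y'. (x, y) \<in> T \<longrightarrow> (x', y') \<in> T \<longrightarrow> eqH R x x' \<longrightarrow> eqH R y y')
     \<longleftrightarrow> (\<forall>x y x' y'. (x, y) \<in> T \<longrightarrow> (x', y') \<in> T \<longrightarrow> H.nrm (x - x') = 0 \<longrightarrow> H.nrm (y - y') = 0)"
    using eqH_iff inH by (intro iff_allI) (auto 0 3)
  show ?thesis
    unfolding is_operator_def H.op_def e1 e2 plus_fun_def zero_fun_def scH_def ..
next
  case False
  then show ?thesis unfolding is_operator_def H.op_def by simp
qed

lemma densely_defined_iff: "densely_defined w R T \<longleftrightarrow> H.dense T"
  unfolding densely_defined_def H.dense_def nrm_eq fun_diff_def ..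

lemma adjoint_eq: "adjoint w R T = H.adj T"
  unfolding adjoint_def H.adj_def ..

lemma symmetric_op_iff: "symmetric_op w R T \<longleftrightarrow> H.symm T"
  unfolding symmetric_op_def H.symm_def ..

lemma lower_bound_iff: "lower_bound w R T m \<longleftrightarrow> H.lower T m"
  unfolding lower_bound_def H.lower_def nrm_eq ..

lemma form_domain_eq: "form_domain w R T m = H.fdom T m"
  unfolding form_domain_def H.fdom_def nrm_eq fun_diff_def ..

theorem Friedrichs_ext_self_adjoint:
  assumes "is_operator w R T" "densely_defined w R T" "symmetric_op w R T" "bounded_below w R T"
  shows "self_adjoint w R (Friedrichs_ext w R T) \<and> bounded_below w R (Friedrichs_ext w R T)"
proof -
  \<comment> \<open>The selected bound is arbitrary; the abstract theorem holds for each
    one.\<close>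
  define m where "m = (SOME m. lower_bound w R T m)"
  have m: "lower_bound w R T m" unfolding m_def using assms(4) unfolding bounded_below_def by (rule someI_ex)
  have "semibounded_axioms scH (Hsp w R) (ipH w R) T m"
    using assms m unfolding is_operator_iff densely_defined_iff symmetric_op_iff lower_bound_iff
    by (intro semibounded_axioms.intro)
  then interpret S: semibounded scH "Hsp w R" "ipH w R" T m
    by (intro semibounded.intro H.semi_hilbert_axioms)
  have e: "Friedrichs_ext w R T = H.friedrichs T m"
    unfolding Friedrichs_ext_def Let_def m_def[symmetric] adjoint_eq form_domain_eq H.friedrichs_def ..
  show ?thesis
    unfolding e self_adjoint_def bounded_below_def is_operator_iff densely_defined_iff adjoint_eq lower_bound_iff
    using S.friedrichs_extension by blast
qed

end

subsection \<open>The operator \<open>L\<close> on test functions\<close>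

lemma C2_component: "smooth3 (\<xi> :: real^3 \<Rightarrow> complex^3) \<Longrightarrow> C2_on UNIV (\<lambda>x. \<xi> x $ i)"
  by (rule C2_on_linear[OF open_UNIV bounded_linear_vec_nth smooth3_C2_on])

lemma cdiv_zero:
  assumes "closed K" "\<And>x. x \<notin> K \<Longrightarrow> F x = 0" "x \<notin> K" shows "cdiv F x = 0"
proof -
  have "fd (\<lambda>y. F y $ i) x v = 0" for i v
    by (rule fd_zero_outside[OF assms(1) _ assms(3)]) (simp add: assms(2))
  then show ?thesis by (simp add: cdiv_def)
qed

lemma Kop_scale: "Kop (\<lambda>y. c * f y :: complex) x = c * Kop f x"
  unfolding Kop_def mult_scaleR_right by (simp del: mult_scaleR_right add: mult_scaleR_right[symmetric])

lemma integral_lebesgue_lborel: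
  fixes f :: "real^3 \<Rightarrow> 'b::{banach, second_countable_topology}"
  shows "f \<in> borel_measurable borel \<Longrightarrow> (\<integral>x. f x \<partial>lebesgue) = (\<integral>x. f x \<partial>lborel)"
  by (rule integral_completion) simp

text \<open>The set of disagreement is open, and nonempty open sets have positive measure. Hence a
  class has at most one test function as representative, which makes the operator
  single-valued.\<close>

lemma eqH_continuous:
  assumes f: "continuous_on UNIV f" and g: "continuous_on UNIV g" and e: "eqH R f g" and x: "x \<in> ball 0 R"
  shows "f x = g x"
proof (rule ccontr)
  assume "f x \<noteq> g x"
  let ?S = "ball 0 R \<inter> {y. f y \<noteq> g y}"
  have "open ?S" by (intro open_Int open_ball open_Collect_neq f g)
  moreover have "x \<in> ?S" using x \<open>f x \<noteq> g x\<close> by simp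
  ultimately have "\<not> negligible ?S" using open_not_negligible by blast
  moreover have "?S \<in> null_sets lebesgue"
  proof -
    have "AE x in lebesgue. x \<notin> ?S" using e unfolding eqH_def by eventually_elim simp
    moreover have "?S \<in> sets lebesgue" using \<open>open ?S\<close> by simp
    ultimately show ?thesis by (simp only: AE_iff_null_sets)
  qed
  ultimately show False by (simp add: negligible_iff_null_sets)
qed

lemma eqH_sym: "eqH R f g \<Longrightarrow> eqH R g f"
proof -
  assume "eqH R f g"
  then show ?thesis unfolding eqH_def by eventually_elim simp
qed

lemma eqH_trans: "eqH R f g \<Longrightarrow> eqH R g h \<Longrightarrow> eqH R f h"
proof -
  assume "eqH R f g" "eqH R g h"
  then show ?thesis unfolding eqH_def by eventually_elim simp
qed

lemma eqH_refl: "eqH R f f" by (simp add: eqH_def)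

context equilibrium
begin

sublocale weighted_hilbert R rho
  by (intro weighted_hilbert.intro weighted_hilbert_axioms.intro rho_weight rho_ball(1))

definition flux :: "(real^3 \<Rightarrow> complex^3) \<Rightarrow> real^3 \<Rightarrow> complex^3" where
  "flux \<xi> x = rho x *\<^sub>R \<xi> x"

lemma flux_component: "flux \<xi> x $ i = complex_of_real (rho x) * \<xi> x $ i"
  unfolding flux_def vector_scaleR_component by (rule scaleR_conv_of_real)

text \<open>Two derivatives are required because \<open>Lop\<close> differentiates the divergence of
  the flux once more.\<close>

lemma flux_C2: assumes \<xi>: "\<xi> \<in> Ccinf R" shows "C2_on UNIV (\<lambda>x. flux \<xi> x $ i)"
proof -
  obtain K where K: "compact K" "K \<subseteq> ball 0 R" "\<And>x. x \<notin> K \<Longrightarrow> \<xi> x = 0" using Ccinf_supp[OF \<xi>] by auto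
  have "C2_on (ball 0 R) (\<lambda>x. rho x *\<^sub>R (\<xi> x $ i))"
    using \<xi> by (intro C2_on_bilinear[OF open_ball bounded_bilinear_scaleR rho_C2] C2_on_subset[OF C2_component])
      (auto simp: Ccinf_def)
  then have "C2_on UNIV (\<lambda>x. rho x *\<^sub>R (\<xi> x $ i))"
    by (rule C2_on_extend_zero[OF open_ball _ compact_imp_closed[OF K(1)] K(2)]) (simp add: K(3))
  then show ?thesis by (simp add: flux_def)
qed

lemma div_flux_C1: assumes "\<xi> \<in> Ccinf R" shows "C1_on UNIV (cdiv (flux \<xi>))"
  unfolding cdiv_def[abs_def] using flux_C2[OF assms] by (intro C1_on_sum) (auto simp: C2_on_def)

lemma div_flux_zero:
  assumes "compact K" "\<And>x. x \<notin> K \<Longrightarrow> \<xi> x = 0" "x \<notin> K" shows "cdiv (flux \<xi>) x = 0"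
  by (rule cdiv_zero[OF compact_imp_closed[OF assms(1)] _ assms(3)]) (simp add: flux_def assms(2))

definition stiff :: "real^3 \<Rightarrow> real" where "stiff x = deriv P (rho x) / rho x"

definition potential :: "real \<Rightarrow> (real^3 \<Rightarrow> complex^3) \<Rightarrow> real^3 \<Rightarrow> complex" where
  "potential G \<xi> y = - (complex_of_real (stiff y) * cdiv (flux \<xi>) y) + complex_of_real (4 * pi * G) * Kop (cdiv (flux \<xi>)) y"

text \<open>The divergence already vanishes off the support of the test function, so the explicit
  cut-off at the ball changes nothing and introduces no jump.\<close>

lemma Lop_eq: assumes \<xi>: "\<xi> \<in> Ccinf R" shows "Lop G P rho R \<xi> = cgrad (potential G \<xi>)"
proof -
  obtain K where K: "compact K" "K \<subseteq> ball 0 R" "\<And>x. x \<notin> K \<Longrightarrow> \<xi> x = 0" using Ccinf_supp[OF \<xi>] by auto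
  have e: "(\<lambda>y. if y \<in> ball 0 R then cdiv (\<lambda>z. rho z *\<^sub>R \<xi> z) y else 0) = cdiv (flux \<xi>)"
  proof
    fix y
    have "cdiv (flux \<xi>) y = 0" if "y \<notin> ball 0 R"
    proof -
      have y: "y \<notin> K" using K(2) that by blast
      show ?thesis by (rule div_flux_zero[OF K(1,3) y])
    qed
    then show "(if y \<in> ball 0 R then cdiv (\<lambda>z. rho z *\<^sub>R \<xi> z) y else 0) = cdiv (flux \<xi>) y"
      by (simp add: flux_def[abs_def])
  qed
  show ?thesis unfolding Lop_def e unfolding Let_def potential_def[abs_def] stiff_def by simp
qed

lemma Kop_C1: assumes \<xi>: "\<xi> \<in> Ccinf R" shows "C1_on UNIV (Kop (cdiv (flux \<xi>)))"
proof -
  obtain K where K: "compact K" "K \<subseteq> ball 0 R" "\<And>x. x \<notin> K \<Longrightarrow> \<xi> x = 0" using Ccinf_supp[OF \<xi>] by auto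
  have "C1_on UNIV (newton (cdiv (flux \<xi>)))"
    by (rule newton_C1[OF div_flux_C1[OF \<xi>] K(1) div_flux_zero[OF K(1,3)]])
  then show ?thesis unfolding Kop_eq_newton[abs_def] by (rule C1_on_linear[OF bounded_linear_scaleR_right])
qed

lemma stiff_term_C1: assumes \<xi>: "\<xi> \<in> Ccinf R" shows "C1_on UNIV (\<lambda>y. stiff y *\<^sub>R cdiv (flux \<xi>) y)"
proof -
  obtain K where K: "compact K" "K \<subseteq> ball 0 R" "\<And>x. x \<notin> K \<Longrightarrow> \<xi> x = 0" using Ccinf_supp[OF \<xi>] by auto
  have "C1_on (ball 0 R) (\<lambda>y. stiff y *\<^sub>R cdiv (flux \<xi>) y)"
    by (intro C1_on_bilinear[OF bounded_bilinear_scaleR stiffness_C1[folded stiff_def]] C1_on_subset[OF div_flux_C1[OF \<xi>]]) simp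
  then show ?thesis
    by (rule C1_on_extend_zero[OF open_ball _ compact_imp_closed[OF K(1)] K(2)]) (simp add: div_flux_zero[OF K(1,3)])
qed

lemma potential_C1: assumes \<xi>: "\<xi> \<in> Ccinf R" shows "C1_on UNIV (potential G \<xi>)"
proof -
  have "C1_on UNIV (\<lambda>y. - (stiff y *\<^sub>R cdiv (flux \<xi>) y) + (4 * pi * G) *\<^sub>R Kop (cdiv (flux \<xi>)) y)"
    by (intro C1_on_add C1_on_linear[OF bounded_linear_minus[OF bounded_linear_ident]] stiff_term_C1[OF \<xi>]
        C1_on_linear[OF bounded_linear_scaleR_right] Kop_C1[OF \<xi>])
  then show ?thesis unfolding potential_def[abs_def] by (simp add: scaleR_conv_of_real)
qed

text \<open>Used for the image under \<open>Lop\<close>, which has no compact support: continuity on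
  the closed ball gives a bound, and the weighted measure is finite.\<close>

lemma continuous_in_Hsp:
  assumes c: "continuous_on UNIV f" shows "f \<in> Hsp rho R"
proof -
  have "compact (f ` cball 0 R)"
    using c by (intro compact_continuous_image continuous_on_subset[OF c]) auto
  then have "bounded (f ` cball 0 R)" by (rule compact_imp_bounded)
  then obtain B where B: "\<And>x. x \<in> cball 0 R \<Longrightarrow> norm (f x) \<le> B" unfolding bounded_iff by blast
  have m: "f \<in> borel_measurable M" by (rule borel_M[OF borel_measurable_continuous_onI[OF c]])
  have "tr f \<in> borel_measurable M"
    unfolding tr_def[abs_def] using m by (intro borel_measurable_scaleR borel_measurable_indicator) auto
  moreover have "l2 M (tr f) \<le> l2 M (\<lambda>_::real^3. B)"
  proof (rule l2_mono)
    fix x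
    show "norm (tr f x) \<le> norm B"
      using B[of x] B[of 0] norm_ge_zero[of "f 0"] R_pos by (cases "x \<in> ball 0 R") (simp_all add: tr_in tr_out)
  qed
  then have "l2 M (tr f) < \<infinity>" using l2_const[of B] by (rule le_less_trans)
  ultimately show ?thesis by (simp add: Hsp_iff)
qed

lemma Ccinf_Hsp: "\<xi> \<in> Ccinf R \<Longrightarrow> \<xi> \<in> Hsp rho R"
  by (intro continuous_in_Hsp Ccinf_continuous)

lemma Lop_continuous: assumes \<xi>: "\<xi> \<in> Ccinf R" shows "continuous_on UNIV (Lop G P rho R \<xi>)"
  unfolding Lop_eq[OF \<xi>] cgrad_def[abs_def]
  by (intro continuous_on_vec_lambda C1_on_fd_continuous potential_C1 \<xi>)

lemma Lop_Hsp: "\<xi> \<in> Ccinf R \<Longrightarrow> Lop G P rho R \<xi> \<in> Hsp rho R"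
  by (intro continuous_in_Hsp Lop_continuous)

lemma continuous_flux: assumes "\<xi> \<in> Ccinf R" shows "continuous_on UNIV (flux \<xi>)"
proof -
  have "continuous_on UNIV (\<lambda>x. \<chi> i. flux \<xi> x $ i)"
    by (intro continuous_on_vec_lambda C1_on_continuous C2_on_imp_C1_on flux_C2 assms)
  then show ?thesis by simp
qed

text \<open>The weight \<open>rho\<close> of the inner product turns the second argument into its
  flux, so integrating the gradient by parts yields the divergence of a flux on both sides. This is
  why the weighted space makes \<open>Lop\<close> symmetric.\<close>

lemma ipH_Lop:
  assumes \<xi>: "\<xi> \<in> Ccinf R" and \<eta>: "\<eta> \<in> Ccinf R"
  shows "ipH rho R (Lop G P rho R \<xi>) \<eta> =
     (\<integral>x. stiff x *\<^sub>R (cdiv (flux \<xi>) x * cnj (cdiv (flux \<eta>) x)) \<partial>lborel)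
      - complex_of_real (4 * pi * G) * (\<integral>x. Kop (cdiv (flux \<xi>)) x * cnj (cdiv (flux \<eta>) x) \<partial>lborel)"
proof -
  obtain K where K: "compact K" "K \<subseteq> ball 0 R" "\<And>x. x \<notin> K \<Longrightarrow> \<eta> x = 0" using Ccinf_supp[OF \<eta>] by auto
  let ?h = "potential G \<xi>" and ?F = "\<lambda>i x. cnj (flux \<eta> x $ i)" and ?g = "cdiv (flux \<eta>)" and ?f = "cdiv (flux \<xi>)"
  have h: "C1_on UNIV ?h" by (rule potential_C1[OF \<xi>])
  have F1: "C1_on UNIV (\<lambda>x. flux \<eta> x $ i)" for i by (rule C2_on_imp_C1_on[OF flux_C2[OF \<eta>]])
  have F: "C1_on UNIV (?F i)" for i by (rule C1_on_linear[OF bounded_linear_cnj F1])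
  have fdF: "fd (?F i) x v = cnj (fd (\<lambda>x. flux \<eta> x $ i) x v)" for i x v
    by (rule fd_linear[OF bounded_linear_cnj F1 UNIV_I])
  have F0: "?F i x = 0" if "x \<notin> K" for i x using K(3)[OF that] by (simp add: flux_def)
  have g0: "?g x = 0" if "x \<notin> K" for x by (rule div_flux_zero[OF K(1,3) that])
  \<comment> \<open>The flux supplies the compact support; the potential is merely C1 on all of
    space.\<close>
  note ibp = integral_by_parts_fd[OF bounded_bilinear_mult h F K(1) F0]
  have "pr (Lop G P rho R \<xi>) \<eta> = (\<lambda>x. \<Sum>i\<in>UNIV. fd ?h x (axis i 1) * ?F i x)"
  proof
    fix x
    show "pr (Lop G P rho R \<xi>) \<eta> x = (\<Sum>i\<in>UNIV. fd ?h x (axis i 1) * ?F i x)"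
    proof (cases "x \<in> ball 0 R")
      case True
      then have "pr (Lop G P rho R \<xi>) \<eta> x = (\<Sum>i\<in>UNIV. fd ?h x (axis i 1) * cnj (\<eta> x $ i)) * complex_of_real (rho x)"
        by (simp add: pr_def tr_in cinner3_def Lop_eq[OF \<xi>] cgrad_def)
      also have "\<dots> = (\<Sum>i\<in>UNIV. fd ?h x (axis i 1) * ?F i x)"
        unfolding sum_distrib_right by (intro sum.cong refl) (simp add: flux_component mult_ac)
      finally show ?thesis .
    next
      case False
      then show ?thesis using F0[of x] K(2) by (subst sum.neutral) (auto simp: pr_def tr_out w_zero flux_def rho_outside)
    qed
  qed
  moreover have "(\<lambda>x. \<Sum>i\<in>UNIV. fd ?h x (axis i 1) * ?F i x) \<in> borel_measurable borel"
    by (intro borel_measurable_continuous_onI continuous_on_sum continuous_on_mult C1_on_fd_continuous[OF h] C1_on_continuous[OF F])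
  ultimately have "ipH rho R (Lop G P rho R \<xi>) \<eta> = (\<integral>x. (\<Sum>i\<in>UNIV. fd ?h x (axis i 1) * ?F i x) \<partial>lborel)"
    unfolding ipH_eq by (simp add: integral_lebesgue_lborel)
  also have "\<dots> = (\<Sum>i\<in>UNIV. \<integral>x. fd ?h x (axis i 1) * ?F i x \<partial>lborel)"
    by (rule Bochner_Integration.integral_sum) (rule ibp(3))
  also have "\<dots> = (\<Sum>i\<in>UNIV. - (\<integral>x. ?h x * fd (?F i) x (axis i 1) \<partial>lborel))"
    by (intro sum.cong refl) (simp add: ibp(1))
  also have "\<dots> = - (\<integral>x. (\<Sum>i\<in>UNIV. ?h x * fd (?F i) x (axis i 1)) \<partial>lborel)"
    unfolding sum_negf by (subst Bochner_Integration.integral_sum) (auto intro: ibp(2))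
  also have "(\<lambda>x. \<Sum>i\<in>UNIV. ?h x * fd (?F i) x (axis i 1)) = (\<lambda>x. ?h x * cnj (?g x))"
    by (simp add: fun_eq_iff cdiv_def fdF sum_distrib_left)
  also have "(\<integral>x. ?h x * cnj (?g x) \<partial>lborel) =
     (\<integral>x. complex_of_real (4 * pi * G) * (Kop ?f x * cnj (?g x)) - stiff x *\<^sub>R (?f x * cnj (?g x)) \<partial>lborel)"
    by (rule Bochner_Integration.integral_cong[OF refl]) (simp add: potential_def scaleR_conv_of_real algebra_simps)
  also have "\<dots> = complex_of_real (4 * pi * G) * (\<integral>x. Kop ?f x * cnj (?g x) \<partial>lborel) - (\<integral>x. stiff x *\<^sub>R (?f x * cnj (?g x)) \<partial>lborel)"
  proof -
    have gc: "continuous_on UNIV ?g" by (rule C1_on_continuous[OF div_flux_C1[OF \<eta>]])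
    have "integrable lborel (\<lambda>x. Kop ?f x * cnj (?g x))"
      using g0 by (intro integrable_continuous_compact_support[OF _ K(1)] continuous_on_mult continuous_on_cnj gc
          C1_on_continuous[OF Kop_C1[OF \<xi>]]) auto
    moreover have "integrable lborel (\<lambda>x. (stiff x *\<^sub>R ?f x) * cnj (?g x))"
      using g0 by (intro integrable_continuous_compact_support[OF _ K(1)] continuous_on_mult continuous_on_cnj gc
          C1_on_continuous[OF stiff_term_C1[OF \<xi>]]) auto
    ultimately show ?thesis by simp
  qed
  finally show ?thesis by simp
qed

text \<open>The pressure term is hermitian because the stiffness is real, the gravitational term by
  \<open>Kop_symmetric\<close>.\<close>

lemma Lop_symmetric:
  assumes \<xi>: "\<xi> \<in> Ccinf R" and \<eta>: "\<eta> \<in> Ccinf R"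
  shows "ipH rho R (Lop G P rho R \<xi>) \<eta> = ipH rho R \<xi> (Lop G P rho R \<eta>)"
proof -
  obtain K where K: "compact K" "K \<subseteq> ball 0 R" "\<And>x. x \<notin> K \<Longrightarrow> \<xi> x = 0" using Ccinf_supp[OF \<xi>] by auto
  obtain K' where K': "compact K'" "K' \<subseteq> ball 0 R" "\<And>x. x \<notin> K' \<Longrightarrow> \<eta> x = 0" using Ccinf_supp[OF \<eta>] by auto
  let ?g = "cdiv (flux \<eta>)" and ?f = "cdiv (flux \<xi>)"
  have sym: "(\<integral>x. Kop ?f x * cnj (?g x) \<partial>lborel) = (\<integral>x. ?f x * cnj (Kop ?g x) \<partial>lborel)"
    by (rule Kop_symmetric[OF C1_on_continuous[OF div_flux_C1[OF \<xi>]] C1_on_continuous[OF div_flux_C1[OF \<eta>]]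
        K(1) div_flux_zero[OF K(1,3)] K'(1) div_flux_zero[OF K'(1,3)]])
  have "ipH rho R \<xi> (Lop G P rho R \<eta>) = cnj (ipH rho R (Lop G P rho R \<eta>) \<xi>)"
    by (rule H.hermitian[OF Ccinf_Hsp[OF \<xi>] Lop_Hsp[OF \<eta>]])
  also have "\<dots> = (\<integral>x. stiff x *\<^sub>R (?f x * cnj (?g x)) \<partial>lborel) - complex_of_real (4 * pi * G) * (\<integral>x. ?f x * cnj (Kop ?g x) \<partial>lborel)"
    unfolding ipH_Lop[OF \<eta> \<xi>] complex_cnj_diff complex_cnj_mult complex_cnj_complex_of_real Bochner_Integration.integral_cnj[symmetric]
    by (simp add: mult.commute)
  finally show ?thesis unfolding ipH_Lop[OF \<xi> \<eta>] sym ..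
qed

text \<open>The pressure term controls \<open>\<parallel>div (rho \<xi>)\<parallel>\<^sup>2\<close> from below, and the gravitational term is absorbed by taking
  \<open>l\<close> large.\<close>

lemma Lop_lower_bound:
  assumes G: "G > 0"
  shows "\<exists>m. \<forall>\<xi>\<in>Ccinf R. m * (normH rho R \<xi>)\<^sup>2 \<le> Re (ipH rho R (Lop G P rho R \<xi>) \<xi>)"
proof -
  obtain c where c: "c > 0" "\<And>x. x \<in> ball 0 R \<Longrightarrow> c \<le> stiff x"
    using stiffness_lower_bound unfolding stiff_def by blast
  obtain C where C: "C \<ge> 0" and est: "\<And>F :: real^3 \<Rightarrow> complex^3. \<And>K l. (\<And>i. C1_on UNIV (\<lambda>y. F y $ i)) \<Longrightarrow> compact K \<Longrightarrow> K \<subseteq> ball 0 R \<Longrightarrow>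
     (\<And>x. x \<notin> K \<Longrightarrow> F x = 0) \<Longrightarrow> l > 0 \<Longrightarrow> norm (\<integral>x. Kop (cdiv F) x * cnj (cdiv F x) \<partial>lborel)
       \<le> C * (l * (\<integral>y. (norm (F y))\<^sup>2 \<partial>lborel) + (1 / l) * (\<integral>x. (norm (cdiv F x))\<^sup>2 \<partial>lborel))"
    using Kop_div_pairing_bound[OF R_pos] by auto
  define k where "k = 4 * pi * G * C"
  have k: "k \<ge> 0" using G C by (simp add: k_def)
  \<comment> \<open>Gives \<open>k / l <= c\<close>, so the pressure term absorbs the divergence
    part; the 1 keeps \<open>l\<close> positive when \<open>k = 0\<close>.\<close>
  define l where "l = (k + 1) / c"
  have l: "l > 0" using k c by (simp add: l_def)
  have kl: "k / l \<le> c" using k c by (simp add: l_def divide_simps)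
  show ?thesis
  \<comment> \<open>What remains after absorption is \<open>k * l\<close> times the squared norm of
    the flux, which is at most \<open>rho 0\<close> times the squared weighted norm.\<close>
  proof (intro exI[of _ "- (k * l * rho 0)"] ballI)
    fix \<xi> assume \<xi>: "\<xi> \<in> Ccinf R"
    obtain K where K: "compact K" "K \<subseteq> ball 0 R" "\<And>x. x \<notin> K \<Longrightarrow> \<xi> x = 0" using Ccinf_supp[OF \<xi>] by auto
    let ?g = "cdiv (flux \<xi>)"
    have g0: "?g x = 0" if "x \<notin> K" for x by (rule div_flux_zero[OF K(1,3) that])
    have gc: "continuous_on UNIV ?g" by (rule C1_on_continuous[OF div_flux_C1[OF \<xi>]])
    have F0: "flux \<xi> x = 0" if "x \<notin> K" for x using K(3)[OF that] by (simp add: flux_def)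
    define I where "I = (\<integral>x. (norm (?g x))\<^sup>2 \<partial>lborel)"
    define J where "J = (\<integral>x. (norm (flux \<xi> x))\<^sup>2 \<partial>lborel)"
    have I0: "I \<ge> 0" unfolding I_def by (intro integral_nonneg_AE) auto
    have iI: "integrable lborel (\<lambda>x. (norm (?g x))\<^sup>2)"
      using g0 by (intro integrable_continuous_compact_support[OF _ K(1)] continuous_on_power continuous_on_norm gc) auto
    have iS: "integrable lborel (\<lambda>x. (stiff x *\<^sub>R ?g x) * cnj (?g x))"
      using g0 by (intro integrable_continuous_compact_support[OF _ K(1)] continuous_on_mult continuous_on_cnj gc
          C1_on_continuous[OF stiff_term_C1[OF \<xi>]]) auto
    have Sx: "(stiff x *\<^sub>R ?g x) * cnj (?g x) = complex_of_real (stiff x * (norm (?g x))\<^sup>2)" for x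
      by (simp add: scaleR_conv_of_real mult.assoc complex_norm_square[symmetric])
    have iS': "integrable lborel (\<lambda>x. stiff x * (norm (?g x))\<^sup>2)"
      using iS unfolding Sx by (simp only: complex_of_real_integrable_eq)
    have S: "(\<integral>x. stiff x *\<^sub>R (?g x * cnj (?g x)) \<partial>lborel) = complex_of_real (\<integral>x. stiff x * (norm (?g x))\<^sup>2 \<partial>lborel)"
      using Sx by (simp only: mult_scaleR_left integral_complex_of_real)
    have "c * I = (\<integral>x. c * (norm (?g x))\<^sup>2 \<partial>lborel)" by (simp add: I_def)
    also have "\<dots> \<le> (\<integral>x. stiff x * (norm (?g x))\<^sup>2 \<partial>lborel)"
    proof (rule integral_mono)
      show "integrable lborel (\<lambda>x. c * (norm (?g x))\<^sup>2)" using iI by simp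
      show "integrable lborel (\<lambda>x. stiff x * (norm (?g x))\<^sup>2)" by (rule iS')
      \<comment> \<open>The lower bound on the stiffness holds only in the ball; off the support
        both sides are 0.\<close>
      show "c * (norm (?g x))\<^sup>2 \<le> stiff x * (norm (?g x))\<^sup>2" for x
        using c(2)[of x] g0[of x] K(2) by (cases "x \<in> K") (auto intro!: mult_right_mono)
    qed
    finally have SI: "c * I \<le> (\<integral>x. stiff x * (norm (?g x))\<^sup>2 \<partial>lborel)" .
    have E: "norm (\<integral>x. Kop ?g x * cnj (?g x) \<partial>lborel) \<le> C * (l * J + (1 / l) * I)"
      unfolding I_def J_def by (rule est[OF C2_on_imp_C1_on[OF flux_C2[OF \<xi>]] K(1,2) F0 l])
    have "J = (\<integral>x. (norm (flux \<xi> x))\<^sup>2 \<partial>lebesgue)"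
      unfolding J_def using continuous_flux[OF \<xi>]
      by (intro integral_lebesgue_lborel[symmetric] borel_measurable_continuous_onI continuous_on_power continuous_on_norm)
    also have "\<dots> \<le> (\<integral>x. rho 0 * (rho x * (norm (tr \<xi> x))\<^sup>2) \<partial>lebesgue)"
    proof (rule integral_mono_AE')
      show "integrable lebesgue (\<lambda>x. rho 0 * (rho x * (norm (tr \<xi> x))\<^sup>2))"
        using Hsp_integrable[OF Ccinf_Hsp[OF \<xi>]] by simp
      show "AE x in lebesgue. (norm (flux \<xi> x))\<^sup>2 \<le> rho 0 * (rho x * (norm (tr \<xi> x))\<^sup>2)"
      proof (intro AE_I2)
        fix x
        show "(norm (flux \<xi> x))\<^sup>2 \<le> rho 0 * (rho x * (norm (tr \<xi> x))\<^sup>2)"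
        proof (cases "x \<in> ball 0 R")
          case True
          \<comment> \<open>The squared flux carries two factors of the density: one is bounded by
            the central value, the other is the weight.\<close>
          have "rho x * (rho x * (norm (\<xi> x))\<^sup>2) \<le> rho 0 * (rho x * (norm (\<xi> x))\<^sup>2)"
            using rho_nonneg[of x] by (intro mult_right_mono rho_le) auto
          then show ?thesis using True by (simp add: flux_def tr_in power_mult_distrib power2_eq_square mult_ac)
        next
          case False then show ?thesis by (simp add: flux_def rho_outside)
        qed
      qed
    qed (auto intro!: AE_I2 mult_nonneg_nonneg rho_nonneg)
    also have "\<dots> = rho 0 * (normH rho R \<xi>)\<^sup>2"
      using ipH_self[OF Ccinf_Hsp[OF \<xi>]] by (simp add: normH_def)
    finally have JN: "J \<le> rho 0 * (normH rho R \<xi>)\<^sup>2" .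
    have "Re (complex_of_real (4 * pi * G) * (\<integral>x. Kop ?g x * cnj (?g x) \<partial>lborel)) = 4 * pi * G * Re (\<integral>x. Kop ?g x * cnj (?g x) \<partial>lborel)"
      by simp
    also have "\<dots> \<le> 4 * pi * G * (C * (l * J + (1 / l) * I))"
      using G order_trans[OF complex_Re_le_cmod E] by (intro mult_left_mono) auto
    also have "\<dots> = k * l * J + (k / l) * I" by (simp add: k_def algebra_simps)
    also have "\<dots> \<le> k * l * (rho 0 * (normH rho R \<xi>)\<^sup>2) + c * I"
      using k l JN kl I0 by (intro add_mono mult_left_mono mult_right_mono) auto
    finally have "Re (complex_of_real (4 * pi * G) * (\<integral>x. Kop ?g x * cnj (?g x) \<partial>lborel)) \<le> k * l * (rho 0 * (normH rho R \<xi>)\<^sup>2) + c * I" .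
    then show "- (k * l * rho 0) * (normH rho R \<xi>)\<^sup>2 \<le> Re (ipH rho R (Lop G P rho R \<xi>) \<xi>)"
      unfolding ipH_Lop[OF \<xi> \<xi>] S using SI by (simp add: mult.assoc)
  qed
qed

section \<open>Linearity of \<open>Lop\<close> and the graph of the operator\<close>

lemma Kop_add:
  assumes \<xi>: "\<xi> \<in> Ccinf R" and \<eta>: "\<eta> \<in> Ccinf R"
  shows "Kop (\<lambda>y. cdiv (flux \<xi>) y + cdiv (flux \<eta>) y) x = Kop (cdiv (flux \<xi>)) x + Kop (cdiv (flux \<eta>)) x"
proof -
  have i: "integrable lborel (\<lambda>z. (1 / norm z) *\<^sub>R cdiv (flux \<zeta>) (x + z))" if \<zeta>: "\<zeta> \<in> Ccinf R" for \<zeta>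
  proof -
    obtain K where K: "compact K" "K \<subseteq> ball 0 R" "\<And>x. x \<notin> K \<Longrightarrow> \<zeta> x = 0" using Ccinf_supp[OF \<zeta>] by auto
    have c: "continuous_on UNIV (cdiv (flux \<zeta>))" by (rule C1_on_continuous[OF div_flux_C1[OF \<zeta>]])
    have z: "cdiv (flux \<zeta>) x = 0" if "x \<notin> K" for x by (rule div_flux_zero[OF K(1,3) that])
    obtain B where B: "\<And>x. norm (cdiv (flux \<zeta>) x) \<le> B" using continuous_compact_support_bounded[OF c K(1) z] by auto
    have "K \<subseteq> cball 0 R" using K(2) ball_subset_cball by blast
    then show ?thesis by (rule newton_integrable[OF borel_measurable_continuous_onI[OF c] B _ z])
  qed
  show ?thesis unfolding Kop_eq_newton newton_def scaleR_add_right
    using i[OF \<xi>] i[OF \<eta>] by (simp add: scaleR_add_right)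
qed

lemma Ccinf_scale: assumes \<xi>: "\<xi> \<in> Ccinf R" shows "scH c \<xi> \<in> Ccinf R"
proof -
  obtain K where K: "compact K" "K \<subseteq> ball 0 R" "\<And>x. x \<notin> K \<Longrightarrow> \<xi> x = 0" using Ccinf_supp[OF \<xi>] by auto
  have "smooth3 (scH c \<xi>)"
    unfolding scH_def using \<xi> by (intro smooth3_linear[OF bounded_linear_vec_scale]) (simp add: Ccinf_def)
  moreover have "\<forall>x. x \<notin> K \<longrightarrow> scH c \<xi> x = 0" using K by (simp add: scH_def)
  ultimately show ?thesis using K unfolding Ccinf_def by blast
qed

lemma div_flux_add:
  assumes \<xi>: "\<xi> \<in> Ccinf R" and \<eta>: "\<eta> \<in> Ccinf R"
  shows "cdiv (flux (\<lambda>x. \<xi> x + \<eta> x)) = (\<lambda>y. cdiv (flux \<xi>) y + cdiv (flux \<eta>) y)"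
proof
  fix y
  have C: "C1_on UNIV (\<lambda>x. flux \<zeta> x $ i)" if "\<zeta> \<in> Ccinf R" for \<zeta> i using C2_on_imp_C1_on[OF flux_C2[OF that]] .
  have "(\<lambda>x. flux (\<lambda>x. \<xi> x + \<eta> x) x $ i) = (\<lambda>x. flux \<xi> x $ i + flux \<eta> x $ i)" for i
    by (simp add: flux_def scaleR_add_right fun_eq_iff)
  then show "cdiv (flux (\<lambda>x. \<xi> x + \<eta> x)) y = cdiv (flux \<xi>) y + cdiv (flux \<eta>) y"
    by (simp add: cdiv_def fd_add[OF C[OF \<xi>] C[OF \<eta>] UNIV_I] sum.distrib)
qed

lemma div_flux_scale:
  assumes \<xi>: "\<xi> \<in> Ccinf R" shows "cdiv (flux (scH c \<xi>)) = (\<lambda>y. c * cdiv (flux \<xi>) y)"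
proof
  fix y
  have C: "C1_on UNIV (\<lambda>x. flux \<xi> x $ i)" for i by (rule C2_on_imp_C1_on[OF flux_C2[OF \<xi>]])
  have "(\<lambda>x. flux (scH c \<xi>) x $ i) = (\<lambda>x. c * flux \<xi> x $ i)" for i
    by (simp add: flux_def scH_def fun_eq_iff)
  then show "cdiv (flux (scH c \<xi>)) y = c * cdiv (flux \<xi>) y"
    by (simp add: cdiv_def fd_linear[OF bounded_linear_mult_right C UNIV_I] sum_distrib_left)
qed

lemma Lop_add:
  assumes \<xi>: "\<xi> \<in> Ccinf R" and \<eta>: "\<eta> \<in> Ccinf R"
  shows "Lop G P rho R (\<lambda>x. \<xi> x + \<eta> x) = (\<lambda>x. Lop G P rho R \<xi> x + Lop G P rho R \<eta> x)"
proof -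
  have "potential G (\<lambda>x. \<xi> x + \<eta> x) = (\<lambda>y. potential G \<xi> y + potential G \<eta> y)"
    unfolding potential_def[abs_def] div_flux_add[OF \<xi> \<eta>] Kop_add[OF \<xi> \<eta>] by (simp add: fun_eq_iff algebra_simps)
  then show ?thesis
    unfolding Lop_eq[OF Ccinf_add[OF \<xi> \<eta>]] Lop_eq[OF \<xi>] Lop_eq[OF \<eta>] by (simp only:)
      (simp add: fun_eq_iff cgrad_def vec_eq_iff fd_add[OF potential_C1[OF \<xi>] potential_C1[OF \<eta>] UNIV_I])
qed

lemma Lop_scale:
  assumes \<xi>: "\<xi> \<in> Ccinf R" shows "Lop G P rho R (scH c \<xi>) = scH c (Lop G P rho R \<xi>)"
proof -
  have "potential G (scH c \<xi>) = (\<lambda>y. c * potential G \<xi> y)"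
    unfolding potential_def[abs_def] div_flux_scale[OF \<xi>] Kop_scale by (simp add: fun_eq_iff algebra_simps)
  then show ?thesis
    unfolding Lop_eq[OF Ccinf_scale[OF \<xi>]] Lop_eq[OF \<xi>] by (simp only:)
      (simp add: fun_eq_iff cgrad_def vec_eq_iff scH_def
        fd_linear[OF bounded_linear_mult_right potential_C1[OF \<xi>] UNIV_I])
qed

text \<open>\<open>Aop\<close> states membership in the space for the argument alone; for the image
  it follows from almost everywhere equality, with measurability supplied by completeness of
  Lebesgue measure.\<close>

lemma eqH_Hsp: assumes g: "g \<in> Hsp rho R" and e: "eqH R f g" shows "f \<in> Hsp rho R"
proof -
  have ae: "AE x in lebesgue. tr g x = tr f x"
    using e unfolding eqH_def by eventually_elim (auto simp: tr_def indicator_def)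
  have "tr g \<in> borel_measurable lebesgue" using g by (simp add: Hsp_iff meas_M_iff)
  then have "tr f \<in> borel_measurable lebesgue" using ae by (rule borel_measurable_AE)
  moreover have "l2 M (tr f) = l2 M (tr g)"
    by (rule l2_cong_AE, rule AE_M) (use ae in eventually_elim, simp)
  ultimately show ?thesis using g by (simp add: Hsp_iff meas_M_iff)
qed

lemma AopE:
  assumes "(a, b) \<in> Aop G P rho R"
  shows "\<exists>\<xi>\<in>Ccinf R. a \<in> Hsp rho R \<and> b \<in> Hsp rho R \<and> eqH R a \<xi> \<and> eqH R b (Lop G P rho R \<xi>)"
  using assms Lop_Hsp eqH_Hsp unfolding Aop_def by blast

lemma AopI: "\<xi> \<in> Ccinf R \<Longrightarrow> a \<in> Hsp rho R \<Longrightarrow> eqH R a \<xi> \<Longrightarrow> eqH R b (Lop G P rho R \<xi>) \<Longrightarrow> (a, b) \<in> Aop G P rho R"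
  unfolding Aop_def by blast

lemma Aop_operator: "is_operator rho R (Aop G P rho R)"
  unfolding is_operator_def
proof (intro conjI allI impI)
  show "Aop G P rho R \<subseteq> Hsp rho R \<times> Hsp rho R" using AopE by auto
  have z: "(\<lambda>_. 0) \<in> Ccinf R" by (auto simp: Ccinf_def smooth3_const intro: exI[of _ "{}"])
  \<comment> \<open>The image of 0 is obtained from homogeneity with the scalar 0.\<close>
  have "scH 0 (\<lambda>_. 0) = (\<lambda>_. 0)" by (simp add: scH_def fun_eq_iff vec_eq_iff)
  then have "Lop G P rho R (\<lambda>_. 0) = scH 0 (Lop G P rho R (\<lambda>_. 0))" using Lop_scale[OF z, of G 0] by simp
  also have "\<dots> = (\<lambda>_. 0)" by (simp add: scH_def fun_eq_iff vec_eq_iff)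
  finally have L0: "Lop G P rho R (\<lambda>_. 0) = (\<lambda>_. 0)" .
  show "(\<lambda>_. 0, \<lambda>_. 0) \<in> Aop G P rho R"
    by (rule AopI[OF z Ccinf_Hsp[OF z]]) (simp_all add: L0 eqH_refl)
next
  fix x y x' y' assume "(x, y) \<in> Aop G P rho R" "(x', y') \<in> Aop G P rho R"
  then obtain \<xi> \<eta> where \<xi>: "\<xi> \<in> Ccinf R" "x \<in> Hsp rho R" "eqH R x \<xi>" "eqH R y (Lop G P rho R \<xi>)"
    and \<eta>: "\<eta> \<in> Ccinf R" "x' \<in> Hsp rho R" "eqH R x' \<eta>" "eqH R y' (Lop G P rho R \<eta>)"
    using AopE by meson
  have add: "eqH R (\<lambda>t. a t + a' t) (\<lambda>t. b t + b' t)" if "eqH R a b" "eqH R a' b'" for a b a' b'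
    using that unfolding eqH_def by eventually_elim simp
  show "(\<lambda>t. x t + x' t, \<lambda>t. y t + y' t) \<in> Aop G P rho R"
    using Hsp_add[OF \<xi>(2) \<eta>(2)]
    by (intro AopI[OF Ccinf_add[OF \<xi>(1) \<eta>(1)]]) (simp_all add: plus_fun_def Lop_add \<xi> \<eta> add)
next
  fix x y c assume "(x, y) \<in> Aop G P rho R"
  then obtain \<xi> where \<xi>: "\<xi> \<in> Ccinf R" "x \<in> Hsp rho R" "eqH R x \<xi>" "eqH R y (Lop G P rho R \<xi>)"
    using AopE by meson
  have sc: "eqH R (scH c a) (scH c b)" if "eqH R a b" for a b
    using that unfolding eqH_def scH_def by eventually_elim simp
  have "(scH c x, scH c y) \<in> Aop G P rho R"
    by (rule AopI[OF Ccinf_scale[OF \<xi>(1), of c] Hsp_scale[OF \<xi>(2)]]) (simp_all add: sc \<xi> Lop_scale)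
  then show "(\<lambda>t. c *s x t, \<lambda>t. c *s y t) \<in> Aop G P rho R" by (simp add: scH_def)
next
  fix x y x' y'
  assume a: "(x, y) \<in> Aop G P rho R" "x' \<in> Hsp rho R" "y' \<in> Hsp rho R" "eqH R x x'" "eqH R y y'"
  then obtain \<xi> where \<xi>: "\<xi> \<in> Ccinf R" "eqH R x \<xi>" "eqH R y (Lop G P rho R \<xi>)" using AopE by meson
  show "(x', y') \<in> Aop G P rho R"
    by (rule AopI[OF \<xi>(1) a(2) eqH_trans[OF eqH_sym[OF a(4)] \<xi>(2)] eqH_trans[OF eqH_sym[OF a(5)] \<xi>(3)]])
next
  fix x y x' y'
  assume a: "(x, y) \<in> Aop G P rho R" "(x', y') \<in> Aop G P rho R" "eqH R x x'"
  then obtain \<xi> \<eta> where \<xi>: "\<xi> \<in> Ccinf R" "eqH R x \<xi>" "eqH R y (Lop G P rho R \<xi>)"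
    and \<eta>: "\<eta> \<in> Ccinf R" "eqH R x' \<eta>" "eqH R y' (Lop G P rho R \<eta>)"
    using AopE by meson
  have e: "eqH R \<xi> \<eta>" by (rule eqH_trans[OF eqH_trans[OF eqH_sym[OF \<xi>(2)] a(3)] \<eta>(2)])
  \<comment> \<open>Equal classes force equal test functions: by continuity inside the ball, and
    because both vanish outside.\<close>
  have "\<xi> = \<eta>"
  proof
    fix t
    show "\<xi> t = \<eta> t"
    proof (cases "t \<in> ball 0 R")
      case True
      then show ?thesis by (rule eqH_continuous[OF Ccinf_continuous[OF \<xi>(1)] Ccinf_continuous[OF \<eta>(1)] e])
    next
      case False
      then show ?thesis using Ccinf_supp[OF \<xi>(1)] Ccinf_supp[OF \<eta>(1)] by (metis subsetD)
    qed
  qed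
  then show "eqH R y y'" using eqH_trans[OF \<xi>(3)] eqH_sym[OF \<eta>(3)] by simp
qed

lemma Aop_dense: "densely_defined rho R (Aop G P rho R)"
  unfolding densely_defined_def
proof (intro ballI allI impI)
  fix u and \<epsilon> :: real assume u: "u \<in> Hsp rho R" and \<epsilon>: "\<epsilon> > 0"
  have "approximable (tr u)" using u by (intro approximable_l2) (auto simp: Hsp_iff)
  moreover have "(\<epsilon>/2)\<^sup>2 > 0" using \<epsilon> by simp
  ultimately have "\<exists>\<xi>\<in>Ccinf R. l2 M (\<lambda>x. \<xi> x - tr u x) \<le> ennreal ((\<epsilon>/2)\<^sup>2)" unfolding approximable_def by blast
  then obtain \<xi> where \<xi>: "\<xi> \<in> Ccinf R" "l2 M (\<lambda>x. \<xi> x - tr u x) \<le> ennreal ((\<epsilon>/2)\<^sup>2)" ..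
  have d: "\<xi> - u \<in> Hsp rho R" by (rule H.diff_closed[OF Ccinf_Hsp[OF \<xi>(1)] u])
  have "l2 M (\<xi> - u) = l2 M (\<lambda>x. \<xi> x - tr u x)"
    by (rule l2_cong_AE, rule AE_M) (simp add: tr_in fun_diff_def)
  then have "ennreal ((normH rho R (\<xi> - u))\<^sup>2) \<le> ennreal ((\<epsilon>/2)\<^sup>2)" using \<xi>(2) nrm_l2[OF d] by simp
  then have "(normH rho R (\<xi> - u))\<^sup>2 \<le> (\<epsilon>/2)\<^sup>2" by (subst (asm) ennreal_le_iff) auto
  then have "normH rho R (\<xi> - u) \<le> \<epsilon>/2" by (rule power2_le_imp_le) (use \<epsilon> in simp)
  then have "normH rho R (\<lambda>t. \<xi> t - u t) < \<epsilon>" using \<epsilon> by (simp add: fun_diff_def)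
  moreover have "(\<xi>, Lop G P rho R \<xi>) \<in> Aop G P rho R"
    by (rule AopI[OF \<xi>(1) Ccinf_Hsp[OF \<xi>(1)] eqH_refl eqH_refl])
  then have "\<xi> \<in> fst ` Aop G P rho R" by force
  ultimately show "\<exists>x\<in>fst ` Aop G P rho R. normH rho R (\<lambda>t. x t - u t) < \<epsilon>" by blast
qed

text \<open>A pair in the graph agrees with a test function and its image only almost everywhere;
  null differences do not change inner products, so pairings may be computed on test
  functions.\<close>

lemma Aop_ip:
  assumes "(a, b) \<in> Aop G P rho R" "(a', b') \<in> Aop G P rho R"
  shows "\<exists>\<xi>\<in>Ccinf R. \<exists>\<eta>\<in>Ccinf R. ipH rho R b a' = ipH rho R (Lop G P rho R \<xi>) \<eta> \<and>
     ipH rho R a b' = ipH rho R \<xi> (Lop G P rho R \<eta>) \<and> ipH rho R a a' = ipH rho R \<xi> \<eta>"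
proof -
  obtain \<xi> \<eta> where \<xi>: "\<xi> \<in> Ccinf R" "a \<in> Hsp rho R" "b \<in> Hsp rho R" "eqH R a \<xi>" "eqH R b (Lop G P rho R \<xi>)"
    and \<eta>: "\<eta> \<in> Ccinf R" "a' \<in> Hsp rho R" "b' \<in> Hsp rho R" "eqH R a' \<eta>" "eqH R b' (Lop G P rho R \<eta>)"
    using AopE[OF assms(1)] AopE[OF assms(2)] by blast
  have c: "ipH rho R x x' = ipH rho R y y'"
    if "x \<in> Hsp rho R" "x' \<in> Hsp rho R" "y \<in> Hsp rho R" "y' \<in> Hsp rho R" "eqH R x y" "eqH R x' y'" for x x' y y'
    using H.null_diff_left[of x y x'] H.null_diff_right[of x' y' y] that eqH_iff by simp
  have "ipH rho R b a' = ipH rho R (Lop G P rho R \<xi>) \<eta>"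
    by (rule c[OF \<xi>(3) \<eta>(2) Lop_Hsp[OF \<xi>(1)] Ccinf_Hsp[OF \<eta>(1)] \<xi>(5) \<eta>(4)])
  moreover have "ipH rho R a b' = ipH rho R \<xi> (Lop G P rho R \<eta>)"
    by (rule c[OF \<xi>(2) \<eta>(3) Ccinf_Hsp[OF \<xi>(1)] Lop_Hsp[OF \<eta>(1)] \<xi>(4) \<eta>(5)])
  moreover have "ipH rho R a a' = ipH rho R \<xi> \<eta>"
    by (rule c[OF \<xi>(2) \<eta>(2) Ccinf_Hsp[OF \<xi>(1)] Ccinf_Hsp[OF \<eta>(1)] \<xi>(4) \<eta>(4)])
  ultimately show ?thesis using \<xi>(1) \<eta>(1) by blast
qed

theorem Aop_Friedrichs:
  assumes "G > 0"
  shows "admits_Friedrichs rho R (Aop G P rho R)"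
  unfolding admits_Friedrichs_def
proof (intro conjI)
  show "is_operator rho R (Aop G P rho R)" by (rule Aop_operator)
  show "densely_defined rho R (Aop G P rho R)" by (rule Aop_dense)
  show "symmetric_op rho R (Aop G P rho R)"
    unfolding symmetric_op_def
  proof clarify
    fix a b a' b' assume "(a, b) \<in> Aop G P rho R" "(a', b') \<in> Aop G P rho R"
    from Aop_ip[OF this] show "ipH rho R b a' = ipH rho R a b'" using Lop_symmetric by auto
  qed
  obtain m where m: "\<And>\<xi>. \<xi> \<in> Ccinf R \<Longrightarrow> m * (normH rho R \<xi>)\<^sup>2 \<le> Re (ipH rho R (Lop G P rho R \<xi>) \<xi>)"
    using Lop_lower_bound[OF assms] by blast
  show "bounded_below rho R (Aop G P rho R)"
    unfolding bounded_below_def lower_bound_def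
  proof (intro exI[of _ m] ballI, clarify)
    fix a b assume ab: "(a, b) \<in> Aop G P rho R"
    then obtain \<xi> where \<xi>: "\<xi> \<in> Ccinf R" "a \<in> Hsp rho R" "b \<in> Hsp rho R" "eqH R a \<xi>" "eqH R b (Lop G P rho R \<xi>)"
      using AopE by blast
    have "ipH rho R b a = ipH rho R (Lop G P rho R \<xi>) a" "ipH rho R (Lop G P rho R \<xi>) a = ipH rho R (Lop G P rho R \<xi>) \<xi>"
      "ipH rho R a a = ipH rho R \<xi> a" "ipH rho R \<xi> a = ipH rho R \<xi> \<xi>"
      using \<xi> Ccinf_Hsp[OF \<xi>(1)] Lop_Hsp[OF \<xi>(1)] eqH_iff by (auto intro!: H.null_diff_left H.null_diff_right)
    then show "m * (normH rho R a)\<^sup>2 \<le> Re (ipH rho R b a)" using m[OF \<xi>(1)] by (simp add: normH_def)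
  qed
qed

end

theorem theorem1:
  fixes G A \<gamma> R \<alpha> :: real
    and \<Lambda> P ubar u1 u2 :: "real \<Rightarrow> real"
    and rho :: "real^3 \<Rightarrow> real"
  assumes G_pos: "G > 0"
    and A_pos: "A > 0" and gamma: "1 < \<gamma>" "\<gamma> < 2"
    and Lambda_smooth: "smooth_on_real UNIV \<Lambda>" and Lambda0: "\<Lambda> 0 = 0"
    and P_law: "\<forall>\<rho>>0. P \<rho> = A * \<rho> powr \<gamma> * (1 + \<Lambda> (\<rho> powr (\<gamma> - 1)))"
    and P_pos: "\<forall>\<rho>>0. P \<rho> > 0"
    and dP_pos: "\<forall>\<rho>>0. P differentiable (at \<rho>) \<and> deriv P \<rho> > 0"
    and R_pos: "R > 0" and alpha: "0 < \<alpha>" "\<alpha> < 1"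
    and u_d1: "\<forall>r\<ge>0. (ubar has_real_derivative u1 r) (at r within {0..})"
    and u_d2: "\<forall>r\<ge>0. (u1 has_real_derivative u2 r) (at r within {0..})"
    and u_hoelder: "\<exists>C. \<forall>r\<ge>0. \<forall>s\<ge>0. \<bar>u2 r - u2 s\<bar> \<le> C * \<bar>r - s\<bar> powr \<alpha>"
    and u_smooth: "smooth_on_real {0..<R} ubar"
    and u_pos: "\<forall>r\<ge>0. ubar r > 0 \<longleftrightarrow> r < R"
    and u_decr: "\<forall>r>0. u1 r < 0"
    and u_range: "\<forall>r\<in>{0..<R}. \<exists>\<rho>>0. enthalpy P \<rho> = ubar r"
    and rho_def: "rho = (\<lambda>x. ff P (ubar (norm x)))"
    and equil_diff: "\<forall>x\<in>ball 0 R. (\<lambda>y. P (rho y)) differentiable (at x) \<and>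
                        (\<lambda>y. - 4 * pi * G * Kop rho y) differentiable (at x)"
    and equil: "\<forall>x\<in>ball 0 R. rgrad (\<lambda>y. P (rho y)) x
                   + rho x *\<^sub>R rgrad (\<lambda>y. - 4 * pi * G * Kop rho y) x = 0"
  shows "admits_Friedrichs rho R (Aop G P rho R)
       \<and> self_adjoint rho R (Friedrichs_ext rho R (Aop G P rho R))
       \<and> bounded_below rho R (Friedrichs_ext rho R (Aop G P rho R))"
proof -
  \<comment> \<open>The centre lies in the ball, so the instance \<open>x = 0\<close> supplies the
    regularity assumption of the locale.\<close>
  have "(\<lambda>y. P (rho y)) differentiable (at 0)" using bspec[OF equil_diff, of 0] R_pos by simp
  then interpret equilibrium A \<gamma> \<Lambda> P R \<alpha> ubar u1 u2 rho
    by (intro equilibrium.intro pressure_law.intro equilibrium_axioms.intro assms)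
  have "admits_Friedrichs rho R (Aop G P rho R)" by (rule Aop_Friedrichs[OF G_pos])
  then show ?thesis using Friedrichs_ext_self_adjoint unfolding admits_Friedrichs_def by blast
qed

end
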